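(* Let $\Omega$ be a Hausdorff locally compact space, let $\mathcal{U}=\{\Omega,A_t,\Theta\}$ be a disjoint union of $\sigma$-locally trivial continuous fields $\mathcal{U}|_{W_\mu}$, $\mu\in\mathcal{M}$, of Banach algebras, and let the Banach algebra $\mathcal{A}$ be defined by $\mathcal{U}$. Suppose that $\mathcal{A}$ is left or right projective. Then $\Omega$ is paracompact.
   Context: Continuous fields. A continuous field of Banach algebras is a triple $\mathcal{U}=\{\Omega,A_t,\Theta\}$ where $\Omega$ is a locally compact Hausdorff space, $(A_t)_{t\in\Omega}$ is a family of Banach algebras, and $\Theta$ is a subalgebra of $\prod_{t\in\Omega}A_t$ such that: (i) for every $t\in\Omega$ the set $\{x(t):x\in\Theta\}$ is dense in $A_t$; (ii) for every $x\in\Theta$ the function $t\mapsto\|x(t)\|$ is continuous on $\Omega$; (iii) if $x\in\prod_{t}A_t$ and for every $t\in\Omega$ and every $\varepsilon>0$ there is $x'\in\Theta$ with $\|x(s)-x'(s)\|\le\varepsilon$ for all $s$ in some neighbourhood of $t$, then $x\in\Theta$. The Banach algebra $\mathcal{A}$ defined by $\mathcal{U}$ is the set of $x\in\Theta$ such that $t\mapsto\|x(t)\|$ vanishes at infinity on $\Omega$, with pointwise operations and norm $\|x\|=\sup_t\|x(t)\|$. For $Y\subseteq\Omega$, the induced field is $\mathcal{U}|_Y=\{Y,(A_t)_{t\in Y},\Theta|_Y\}$, where $\Theta|_Y$ is the set of $x\in\prod_{t\in Y}A_t$ such that for every $t_0\in Y$ and $\varepsilon>0$ there is $x'\in\Theta$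 with $\|x(t)-x'(t)\|\le\varepsilon$ for all $t\in Y$ in some neighbourhood of $t_0$. An isomorphism of fields over the same space is a family of isometric algebra isomorphisms $\phi_t:A_t\to A'_t$ carrying $\Theta$ into $\Theta'$. The constant field over $\Omega$ defined by a Banach algebra $A$ has $A_t=A$ for all $t$ and $\Theta$ equal to the algebra of all continuous maps $\Omega\to A$. A field is trivial if it is isomorphic to a constant field. A continuous field $\mathcal{V}$ over a locally compact Hausdorff space $W$ is $\sigma$-locally trivial if there is an open cover $\{U_\alpha\}$ of $W$ such that each $\mathcal{V}|_{U_\alpha}$ is trivial and, in addition, there is a countable open cover $\{V_j\}$ of $W$ such that for each $j$ one has $\overline{V_j}\subset U_{\alpha(j)}$ for some index $\alpha(j)$. If $\Omega$ is a disjoint union of a family of open subsets $\{W_\mu\}_{\mu\in\mathcal{M}}$, then $\mathcal{U}$ is said to be a disjoint union of the fields $\mathcal{U}|_{W_\mu}$, $\mu\in\mathcal{M}$. Projectivity. A Banach algebra $B$ is left (right) projective if it is projective as a left (right) Banach module over itself, where a left (right) Banach $B$-module $P$ is projective if every epimorphism of left (right) Banach $B$-modules $\varphi:Y\to P$ that has a right inverse as a morphism of Banach spaces has a right inverse that is a module morphism. Equivalently, in the left case with $P=B$: there is a morphism of left Banach $B$-modules $\rho:B\to B_+\widehat{\otimes}B$ with $\pi\circ\rho=\mathrm{id}_B$, where $B_+$ is $B$ with an identity adjoined, $\widehat{\otimes}$ is the projective tensor product, and $\pi(a\otimes b)=ab$. A Hausdorff topological space is paracompact if every open cover has an open locally finite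 refinement that is also a cover.
   Formalization: All fibres A_t are assumed to be nonzero Banach algebras; with zero fibres the claim fails, e.g. A_t = {0} over a locally compact Hausdorff space that is not paracompact. *)

theory Defs
  imports "HOL-Analysis.Analysis"
begin

section \<open>Banach spaces, algebras and modules with explicit carriers\<close>

text \<open>
  The fibres of a continuous field form a family of Banach algebras that vary with the point,
  so they cannot be types of a type class; spaces and algebras are records with a carrier.
  The scalars are the complex numbers, and algebras need not have an identity.
\<close>

record 'a nspace =
  vcarrier :: "'a set"
  vadd :: "'a \<Rightarrow> 'a \<Rightarrow> 'a"
  vzero :: 'a
  vscale :: "complex \<Rightarrow> 'a \<Rightarrow> 'a"
  vnorm :: "'a \<Rightarrow> real"

record 'a nalgebra = "'a nspace" +
  amult :: "'a \<Rightarrow> 'a \<Rightarrow> 'a"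

text \<open>
  The locale \<^locale>\<open>Metric_space\<close> wants a distance that is nonnegative and symmetric on the whole
  type, hence the value 0 off the carrier.
\<close>

definition vdist :: "('a, 'z) nspace_scheme \<Rightarrow> 'a \<Rightarrow> 'a \<Rightarrow> real" where
  "vdist E x y = (if x \<in> vcarrier E \<and> y \<in> vcarrier E
                  then vnorm E (vadd E x (vscale E (-1) y)) else 0)"

abbreviation vtopology :: "('a, 'z) nspace_scheme \<Rightarrow> 'a topology" where
  "vtopology E \<equiv> Metric_space.mtopology (vcarrier E) (vdist E)"

locale banach_space =
  fixes E :: "('a, 'z) nspace_scheme"
  assumes zero_closed: "vzero E \<in> vcarrier E"
    and add_closed: "\<lbrakk>x \<in> vcarrier E; y \<in> vcarrier E\<rbrakk> \<Longrightarrow> vadd E x y \<in> vcarrier E"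
    and scale_closed: "x \<in> vcarrier E \<Longrightarrow> vscale E c x \<in> vcarrier E"
    and add_assoc: "\<lbrakk>x \<in> vcarrier E; y \<in> vcarrier E; z \<in> vcarrier E\<rbrakk>
      \<Longrightarrow> vadd E (vadd E x y) z = vadd E x (vadd E y z)"
    and add_commute: "\<lbrakk>x \<in> vcarrier E; y \<in> vcarrier E\<rbrakk> \<Longrightarrow> vadd E x y = vadd E y x"
    and add_zero: "x \<in> vcarrier E \<Longrightarrow> vadd E x (vzero E) = x"
    and add_inverse: "x \<in> vcarrier E \<Longrightarrow> \<exists>y\<in>vcarrier E. vadd E x y = vzero E"
    and scale_add_right: "\<lbrakk>x \<in> vcarrier E; y \<in> vcarrier E\<rbrakk>
      \<Longrightarrow> vscale E c (vadd E x y) = vadd E (vscale E c x) (vscale E c y)"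
    and scale_add_left: "x \<in> vcarrier E
      \<Longrightarrow> vscale E (c + d) x = vadd E (vscale E c x) (vscale E d x)"
    and scale_scale: "x \<in> vcarrier E \<Longrightarrow> vscale E c (vscale E d x) = vscale E (c * d) x"
    and scale_one: "x \<in> vcarrier E \<Longrightarrow> vscale E 1 x = x"
    and norm_nonneg: "x \<in> vcarrier E \<Longrightarrow> 0 \<le> vnorm E x"
    and norm_eq_zero: "x \<in> vcarrier E \<Longrightarrow> vnorm E x = 0 \<longleftrightarrow> x = vzero E"
    and norm_triangle: "\<lbrakk>x \<in> vcarrier E; y \<in> vcarrier E\<rbrakk>
      \<Longrightarrow> vnorm E (vadd E x y) \<le> vnorm E x + vnorm E y"
    and norm_scale: "x \<in> vcarrier E \<Longrightarrow> vnorm E (vscale E c x) = cmod c * vnorm E x"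
    and complete: "Metric_space.mcomplete (vcarrier E) (vdist E)"

locale banach_algebra = banach_space A for A :: "('a, 'z) nalgebra_scheme" +
  assumes mult_closed: "\<lbrakk>x \<in> vcarrier A; y \<in> vcarrier A\<rbrakk> \<Longrightarrow> amult A x y \<in> vcarrier A"
    and mult_assoc: "\<lbrakk>x \<in> vcarrier A; y \<in> vcarrier A; z \<in> vcarrier A\<rbrakk>
      \<Longrightarrow> amult A (amult A x y) z = amult A x (amult A y z)"
    and mult_add_left: "\<lbrakk>x \<in> vcarrier A; y \<in> vcarrier A; z \<in> vcarrier A\<rbrakk>
      \<Longrightarrow> amult A (vadd A x y) z = vadd A (amult A x z) (amult A y z)"
    and mult_add_right: "\<lbrakk>x \<in> vcarrier A; y \<in> vcarrier A; z \<in> vcarrier A\<rbrakk>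
      \<Longrightarrow> amult A x (vadd A y z) = vadd A (amult A x y) (amult A x z)"
    and mult_scale_left: "\<lbrakk>x \<in> vcarrier A; y \<in> vcarrier A\<rbrakk>
      \<Longrightarrow> amult A (vscale A c x) y = vscale A c (amult A x y)"
    and mult_scale_right: "\<lbrakk>x \<in> vcarrier A; y \<in> vcarrier A\<rbrakk>
      \<Longrightarrow> amult A x (vscale A c y) = vscale A c (amult A x y)"
    and norm_mult: "\<lbrakk>x \<in> vcarrier A; y \<in> vcarrier A\<rbrakk>
      \<Longrightarrow> vnorm A (amult A x y) \<le> vnorm A x * vnorm A y"

definition linear_map ::
  "('a, 'y) nspace_scheme \<Rightarrow> ('b, 'z) nspace_scheme \<Rightarrow> ('a \<Rightarrow> 'b) \<Rightarrow> bool" where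
  "linear_map E F T \<longleftrightarrow>
     (\<forall>x\<in>vcarrier E. T x \<in> vcarrier F) \<and>
     (\<forall>x\<in>vcarrier E. \<forall>y\<in>vcarrier E. T (vadd E x y) = vadd F (T x) (T y)) \<and>
     (\<forall>c. \<forall>x\<in>vcarrier E. T (vscale E c x) = vscale F c (T x))"

definition banach_morphism ::
  "('a, 'y) nspace_scheme \<Rightarrow> ('b, 'z) nspace_scheme \<Rightarrow> ('a \<Rightarrow> 'b) \<Rightarrow> bool" where
  "banach_morphism E F T \<longleftrightarrow>
     linear_map E F T \<and> (\<exists>K. \<forall>x\<in>vcarrier E. vnorm F (T x) \<le> K * vnorm E x)"

text \<open>The outer multiplication of a Banach module is a bounded bilinear map.\<close>

locale left_banach_module = banach_space Y
  for B :: "('b, 'u) nalgebra_scheme" and Y :: "('y, 'z) nspace_scheme"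
    and act :: "'b \<Rightarrow> 'y \<Rightarrow> 'y" +
  assumes act_closed: "\<lbrakk>a \<in> vcarrier B; y \<in> vcarrier Y\<rbrakk> \<Longrightarrow> act a y \<in> vcarrier Y"
    and act_add_left: "\<lbrakk>a \<in> vcarrier B; b \<in> vcarrier B; y \<in> vcarrier Y\<rbrakk>
      \<Longrightarrow> act (vadd B a b) y = vadd Y (act a y) (act b y)"
    and act_add_right: "\<lbrakk>a \<in> vcarrier B; x \<in> vcarrier Y; y \<in> vcarrier Y\<rbrakk>
      \<Longrightarrow> act a (vadd Y x y) = vadd Y (act a x) (act a y)"
    and act_scale_left: "\<lbrakk>a \<in> vcarrier B; y \<in> vcarrier Y\<rbrakk>
      \<Longrightarrow> act (vscale B c a) y = vscale Y c (act a y)"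
    and act_scale_right: "\<lbrakk>a \<in> vcarrier B; y \<in> vcarrier Y\<rbrakk>
      \<Longrightarrow> act a (vscale Y c y) = vscale Y c (act a y)"
    and act_mult: "\<lbrakk>a \<in> vcarrier B; b \<in> vcarrier B; y \<in> vcarrier Y\<rbrakk>
      \<Longrightarrow> act (amult B a b) y = act a (act b y)"
    and act_bounded: "\<exists>K. \<forall>a\<in>vcarrier B. \<forall>y\<in>vcarrier Y.
      vnorm Y (act a y) \<le> K * vnorm B a * vnorm Y y"

locale right_banach_module = banach_space Y
  for B :: "('b, 'u) nalgebra_scheme" and Y :: "('y, 'z) nspace_scheme"
    and act :: "'y \<Rightarrow> 'b \<Rightarrow> 'y" +
  assumes act_closed: "\<lbrakk>a \<in> vcarrier B; y \<in> vcarrier Y\<rbrakk> \<Longrightarrow> act y a \<in> vcarrier Y"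
    and act_add_right: "\<lbrakk>a \<in> vcarrier B; b \<in> vcarrier B; y \<in> vcarrier Y\<rbrakk>
      \<Longrightarrow> act y (vadd B a b) = vadd Y (act y a) (act y b)"
    and act_add_left: "\<lbrakk>a \<in> vcarrier B; x \<in> vcarrier Y; y \<in> vcarrier Y\<rbrakk>
      \<Longrightarrow> act (vadd Y x y) a = vadd Y (act x a) (act y a)"
    and act_scale_right: "\<lbrakk>a \<in> vcarrier B; y \<in> vcarrier Y\<rbrakk>
      \<Longrightarrow> act y (vscale B c a) = vscale Y c (act y a)"
    and act_scale_left: "\<lbrakk>a \<in> vcarrier B; y \<in> vcarrier Y\<rbrakk>
      \<Longrightarrow> act (vscale Y c y) a = vscale Y c (act y a)"
    and act_mult: "\<lbrakk>a \<in> vcarrier B; b \<in> vcarrier B; y \<in> vcarrier Y\<rbrakk>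
      \<Longrightarrow> act y (amult B a b) = act (act y a) b"
    and act_bounded: "\<exists>K. \<forall>a\<in>vcarrier B. \<forall>y\<in>vcarrier Y.
      vnorm Y (act y a) \<le> K * vnorm Y y * vnorm B a"

definition left_module_morphism ::
  "('b, 'u) nalgebra_scheme \<Rightarrow> ('x, 'v) nspace_scheme \<Rightarrow> ('b \<Rightarrow> 'x \<Rightarrow> 'x) \<Rightarrow>
   ('y, 'w) nspace_scheme \<Rightarrow> ('b \<Rightarrow> 'y \<Rightarrow> 'y) \<Rightarrow> ('x \<Rightarrow> 'y) \<Rightarrow> bool" where
  "left_module_morphism B X actX Y actY T \<longleftrightarrow>
     banach_morphism X Y T \<and>
     (\<forall>a\<in>vcarrier B. \<forall>x\<in>vcarrier X. T (actX a x) = actY a (T x))"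

definition right_module_morphism ::
  "('b, 'u) nalgebra_scheme \<Rightarrow> ('x, 'v) nspace_scheme \<Rightarrow> ('x \<Rightarrow> 'b \<Rightarrow> 'x) \<Rightarrow>
   ('y, 'w) nspace_scheme \<Rightarrow> ('y \<Rightarrow> 'b \<Rightarrow> 'y) \<Rightarrow> ('x \<Rightarrow> 'y) \<Rightarrow> bool" where
  "right_module_morphism B X actX Y actY T \<longleftrightarrow>
     banach_morphism X Y T \<and>
     (\<forall>a\<in>vcarrier B. \<forall>x\<in>vcarrier X. T (actX x a) = actY (T x) a)"


section \<open>Projectivity\<close>

text \<open>
  A formula cannot quantify over all types, so the type \<open>'y\<close> that contains the carriers of the
  modules \<open>Y\<close> is a parameter here.
\<close>

definition projective_left_module_wrt ::
  "'y itself \<Rightarrow> ('b, 'u) nalgebra_scheme \<Rightarrow> ('p, 'v) nspace_scheme \<Rightarrow> ('b \<Rightarrow> 'p \<Rightarrow> 'p) \<Rightarrow> bool"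
where
  "projective_left_module_wrt (_ :: 'y itself) B P actP \<longleftrightarrow>
     (\<forall>(Y :: 'y nspace) actY \<phi>.
        left_banach_module B Y actY \<longrightarrow>
        left_module_morphism B Y actY P actP \<phi> \<longrightarrow>
        \<phi> ` vcarrier Y = vcarrier P \<longrightarrow>
        (\<exists>\<psi>. banach_morphism P Y \<psi> \<and> (\<forall>p\<in>vcarrier P. \<phi> (\<psi> p) = p)) \<longrightarrow>
        (\<exists>\<rho>. left_module_morphism B P actP Y actY \<rho> \<and> (\<forall>p\<in>vcarrier P. \<phi> (\<rho> p) = p)))"

definition projective_right_module_wrt ::
  "'y itself \<Rightarrow> ('b, 'u) nalgebra_scheme \<Rightarrow> ('p, 'v) nspace_scheme \<Rightarrow> ('p \<Rightarrow> 'b \<Rightarrow> 'p) \<Rightarrow> bool"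
where
  "projective_right_module_wrt (_ :: 'y itself) B P actP \<longleftrightarrow>
     (\<forall>(Y :: 'y nspace) actY \<phi>.
        right_banach_module B Y actY \<longrightarrow>
        right_module_morphism B Y actY P actP \<phi> \<longrightarrow>
        \<phi> ` vcarrier Y = vcarrier P \<longrightarrow>
        (\<exists>\<psi>. banach_morphism P Y \<psi> \<and> (\<forall>p\<in>vcarrier P. \<phi> (\<psi> p) = p)) \<longrightarrow>
        (\<exists>\<rho>. right_module_morphism B P actP Y actY \<rho> \<and> (\<forall>p\<in>vcarrier P. \<phi> (\<rho> p) = p)))"

text \<open>
  For \<open>P = B\<close> one type of carriers is enough. Given \<open>\<phi>\<close> and \<open>\<psi>\<close>, one can replace \<open>Y\<close> by its closed
  submodule generated by \<open>\<psi> ` B\<close>, whose elements are limits of sequences of finite sums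
  \<open>\<psi> b + a\<^sub>1 \<cdot> \<psi> b\<^sub>1 + \<dots> + a\<^sub>k \<cdot> \<psi> b\<^sub>k\<close>; the type below holds codes of such sequences.
  The theorems \<open>left_projective_wrt\<close> and \<open>right_projective_wrt\<close> at the end of the
  section show that the resulting notions have the lifting property for \<open>'y\<close> arbitrary.
\<close>

type_synonym 'b module_code = "nat \<Rightarrow> 'b \<times> ('b \<times> 'b) list"

definition left_projective :: "('b, 'u) nalgebra_scheme \<Rightarrow> bool" where
  "left_projective B \<longleftrightarrow>
     projective_left_module_wrt TYPE('b module_code) B B (amult B)"

definition right_projective :: "('b, 'u) nalgebra_scheme \<Rightarrow> bool" where
  "right_projective B \<longleftrightarrow>
     projective_right_module_wrt TYPE('b module_code) B B (amult B)"

subsection \<open>Independence of the type of carriers\<close>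

context banach_space
begin

lemma add_closed_zero: "x \<in> vcarrier E \<Longrightarrow> vadd E (vzero E) x = x"
  using add_commute add_zero zero_closed by metis

lemma scale_zero: assumes x: "x \<in> vcarrier E" shows "vscale E 0 x = vzero E"
proof -
  let ?z = "vscale E 0 x"
  have z: "?z \<in> vcarrier E" using x by (rule scale_closed)
  have zz: "vadd E ?z ?z = ?z" using scale_add_left[OF x, of 0 0] by simp
  obtain w where w: "w \<in> vcarrier E" "vadd E ?z w = vzero E" using add_inverse[OF z] by blast
  have "vadd E (vadd E ?z ?z) w = vadd E ?z (vadd E ?z w)" using add_assoc[OF z z w(1)] .
  then show ?thesis using zz w add_zero[OF z] by simp
qed

lemma add_neg: "x \<in> vcarrier E \<Longrightarrow> vadd E x (vscale E (-1) x) = vzero E"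
  using scale_add_left[of x 1 "-1"] by (simp add: scale_one scale_zero)

lemma neg_neg: "x \<in> vcarrier E \<Longrightarrow> vscale E (-1) (vscale E (-1) x) = x"
  by (simp add: scale_scale scale_one)

lemma add_left_commute: "\<lbrakk>x \<in> vcarrier E; y \<in> vcarrier E; z \<in> vcarrier E\<rbrakk>
    \<Longrightarrow> vadd E x (vadd E y z) = vadd E y (vadd E x z)"
  using add_assoc add_commute by metis

lemmas vadd_ac = add_assoc add_commute add_left_commute

lemma norm_zero: "vnorm E (vzero E) = 0"
  using norm_eq_zero zero_closed by blast

lemma diff_cancel: 
  assumes "x \<in> vcarrier E" "y \<in> vcarrier E" "z \<in> vcarrier E"
  shows "vadd E x (vscale E (-1) z) =
         vadd E (vadd E x (vscale E (-1) y)) (vadd E y (vscale E (-1) z))"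
proof -
  let ?m = "\<lambda>x. vscale E (-1) x"
  have "vadd E (vadd E x (?m y)) (vadd E y (?m z)) = vadd E x (vadd E (vadd E y (?m y)) (?m z))"
    using assms by (simp add: vadd_ac add_closed scale_closed)
  also have "\<dots> = vadd E x (?m z)"
    using assms by (simp add: add_neg add_closed_zero scale_closed)
  finally show ?thesis ..
qed

lemma diff_eq_zero:
  assumes "x \<in> vcarrier E" "y \<in> vcarrier E"
  shows "vadd E x (vscale E (-1) y) = vzero E \<longleftrightarrow> x = y"
proof
  assume *: "vadd E x (vscale E (-1) y) = vzero E"
  have "x = vadd E x (vadd E (vscale E (-1) y) y)"
    using assms by (metis add_commute add_neg add_zero scale_closed)
  also have "\<dots> = vadd E (vadd E x (vscale E (-1) y)) y"
    using assms by (simp add: add_assoc scale_closed)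
  also have "\<dots> = y" using assms by (simp add: * add_closed_zero)
  finally show "x = y" .
qed (use assms add_neg in simp)

lemma vdist_eq: "\<lbrakk>x \<in> vcarrier E; y \<in> vcarrier E\<rbrakk>
    \<Longrightarrow> vdist E x y = vnorm E (vadd E x (vscale E (-1) y))"
  by (simp add: vdist_def)

sublocale metric: Metric_space "vcarrier E" "vdist E"
proof
  show "0 \<le> vdist E x y" for x y
    by (simp add: vdist_def norm_nonneg add_closed scale_closed)
  show "vdist E x y = vdist E y x" for x y
  proof (cases "x \<in> vcarrier E \<and> y \<in> vcarrier E")
    case True
    then have "vadd E y (vscale E (-1) x) = vscale E (-1) (vadd E x (vscale E (-1) y))"
      by (metis add_commute neg_neg scale_add_right scale_closed)
    then show ?thesis
      using True by (simp add: vdist_eq norm_scale add_closed scale_closed)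
  qed (auto simp: vdist_def)
  show "(vdist E x y = 0) = (x = y)" if "x \<in> vcarrier E" "y \<in> vcarrier E" for x y
    using that by (simp add: vdist_eq norm_eq_zero add_closed scale_closed diff_eq_zero)
  show "vdist E x z \<le> vdist E x y + vdist E y z"
    if "x \<in> vcarrier E" "y \<in> vcarrier E" "z \<in> vcarrier E" for x y z
    using that norm_triangle diff_cancel[OF that]
    by (simp add: vdist_eq add_closed scale_closed)
qed

lemma vdist_add:
  assumes "x \<in> vcarrier E" "y \<in> vcarrier E" "x' \<in> vcarrier E" "y' \<in> vcarrier E"
  shows "vdist E (vadd E x y) (vadd E x' y') \<le> vdist E x x' + vdist E y y'"
proof -
  have "vadd E (vadd E x y) (vscale E (-1) (vadd E x' y')) =
        vadd E (vadd E x (vscale E (-1) x')) (vadd E y (vscale E (-1) y'))"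
    using assms by (simp add: scale_add_right vadd_ac add_closed scale_closed)
  then show ?thesis
    using assms norm_triangle by (simp add: vdist_eq add_closed scale_closed)
qed

lemma vdist_scale:
  assumes "x \<in> vcarrier E" "y \<in> vcarrier E"
  shows "vdist E (vscale E c x) (vscale E c y) = cmod c * vdist E x y"
proof -
  have "vadd E (vscale E c x) (vscale E (-1) (vscale E c y)) =
        vscale E c (vadd E x (vscale E (-1) y))"
    using assms by (simp add: scale_add_right scale_scale scale_closed)
  then show ?thesis
    using assms by (simp add: vdist_eq norm_scale add_closed scale_closed)
qed

lemma banach_space_copy:
  fixes g :: "'a \<Rightarrow> 'c" and S :: "'a set"
  defines "h \<equiv> inv_into S g"
  defines "F \<equiv> \<lparr>vcarrier = g ` S, vadd = (\<lambda>x y. g (vadd E (h x) (h y))), vzero = g (vzero E),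
                vscale = (\<lambda>c x. g (vscale E c (h x))), vnorm = (\<lambda>x. vnorm E (h x))\<rparr>"
  assumes inj: "inj_on g S" and S: "S \<subseteq> vcarrier E"
    and S_zero: "vzero E \<in> S"
    and S_add: "\<And>x y. \<lbrakk>x \<in> S; y \<in> S\<rbrakk> \<Longrightarrow> vadd E x y \<in> S"
    and S_scale: "\<And>c x. x \<in> S \<Longrightarrow> vscale E c x \<in> S"
    and S_closed: "\<And>y. \<lbrakk>y \<in> vcarrier E; \<And>e. e > 0 \<Longrightarrow> \<exists>x\<in>S. vdist E x y < e\<rbrakk> \<Longrightarrow> y \<in> S"
  shows "banach_space F"
proof -
  have hg [simp]: "h (g x) = x" if "x \<in> S" for x
    using that inj by (simp add: h_def)
  have SE: "x \<in> vcarrier E" if "x \<in> S" for x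
    using that S by auto
  note cl = S_zero S_add S_scale
  have dist: "vdist F (g x) (g y) = vdist E x y" if "x \<in> S" "y \<in> S" for x y
    using that by (simp add: vdist_def F_def cl SE)
  have F_carrier: "vcarrier F = g ` S" by (simp add: F_def)
  have pre: "Metric_space (vcarrier F) (vdist F)"
  proof
    have eq: "vdist F x y = (if x \<in> g ` S \<and> y \<in> g ` S then vdist E (h x) (h y) else 0)" for x y
    proof (cases "x \<in> g ` S \<and> y \<in> g ` S")
      case True
      then show ?thesis using dist by auto
    next
      case False
      then show ?thesis by (auto simp: vdist_def F_carrier)
    qed
    show "0 \<le> vdist F x y" "vdist F x y = vdist F y x" for x y
      by (simp_all add: eq metric.commute[of "h x"])
    show "(vdist F x y = 0) = (x = y)" if xy: "x \<in> vcarrier F" "y \<in> vcarrier F" for x y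
    proof -
      obtain u v where uv: "x = g u" "y = g v" "u \<in> S" "v \<in> S"
        using xy unfolding F_carrier by blast
      then show ?thesis by (simp add: dist SE inj_on_eq_iff[OF inj])
    qed
    show "vdist F x z \<le> vdist F x y + vdist F y z"
      if xy: "x \<in> vcarrier F" "y \<in> vcarrier F" "z \<in> vcarrier F" for x y z
    proof -
      obtain u v w where uv: "x = g u" "y = g v" "z = g w" "u \<in> S" "v \<in> S" "w \<in> S"
        using xy unfolding F_carrier by blast
      then show ?thesis by (simp add: dist SE metric.triangle)
    qed
  qed
  interpret F: Metric_space "vcarrier F" "vdist F" by (rule pre)
  have "F.mcomplete"
    unfolding F.mcomplete_def
  proof (intro allI impI)
    fix \<sigma> assume \<sigma>: "F.MCauchy \<sigma>"
    define \<tau> where "\<tau> = (\<lambda>n. h (\<sigma> n))"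
    have ran': "\<sigma> n \<in> vcarrier F" for n using \<sigma> by (auto simp: F.MCauchy_def)
    then have ran: "\<sigma> n \<in> g ` S" for n by (simp add: F_carrier)
    have \<tau>S: "\<tau> n \<in> S" for n
      unfolding \<tau>_def h_def using ran by (rule inv_into_into)
    have g\<tau>: "g (\<tau> n) = \<sigma> n" for n
      unfolding \<tau>_def h_def using ran by (rule f_inv_into_f)
    have "metric.MCauchy \<tau>"
      unfolding metric.MCauchy_def
    proof (intro conjI)
      show "range \<tau> \<subseteq> vcarrier E" using \<tau>S SE by auto
      have "vdist E (\<tau> n) (\<tau> n') = vdist F (\<sigma> n) (\<sigma> n')" for n n'
        using dist[OF \<tau>S \<tau>S] g\<tau> by simp
      then show "\<forall>\<epsilon>>0. \<exists>N. \<forall>n n'. N \<le> n \<longrightarrow> N \<le> n' \<longrightarrow> vdist E (\<tau> n) (\<tau> n') < \<epsilon>"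
        using \<sigma> by (simp add: F.MCauchy_def)
    qed
    then obtain y where y: "limitin metric.mtopology \<tau> y sequentially"
      using complete by (auto simp: metric.mcomplete_def)
    then have yE: "y \<in> vcarrier E"
      and lim: "\<And>e. e > 0 \<Longrightarrow> \<exists>N. \<forall>n\<ge>N. vdist E (\<tau> n) y < e"
      unfolding metric.limit_metric_sequentially by blast+
    have yS: "y \<in> S"
      using yE by (rule S_closed) (use lim \<tau>S in blast)
    have "vdist F (\<sigma> n) (g y) = vdist E (\<tau> n) y" for n
      using dist[OF \<tau>S yS] g\<tau> by simp
    then have "limitin F.mtopology \<sigma> (g y) sequentially"
      unfolding F.limit_metric_sequentially using lim yS ran by (auto simp: F_carrier)
    then show "\<exists>x. limitin F.mtopology \<sigma> x sequentially" by blast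
  qed
  moreover have inv: "\<exists>y\<in>S. vadd E x y = vzero E" if "x \<in> S" for x
    using that S_scale[of x "-1"] add_neg SE by blast
  ultimately show ?thesis
    apply unfold_locales
    apply (simp_all add: F_def)
    apply (auto simp: cl SE vadd_ac add_zero scale_add_right scale_add_left scale_scale scale_one
        norm_nonneg norm_eq_zero norm_triangle norm_scale inj_on_eq_iff[OF inj])
    done
qed

end

theorem left_projective_wrt:
  fixes B :: "('b, 'u) nalgebra_scheme"
  assumes B: "banach_algebra B" and proj: "left_projective B"
  shows "projective_left_module_wrt TYPE('y) B B (amult B)"
  unfolding projective_left_module_wrt_def
proof (intro allI impI)
  fix Y :: "'y nspace" and act \<phi>
  assume mod: "left_banach_module B Y act"
    and \<phi>: "left_module_morphism B Y act B (amult B) \<phi>"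
    and "\<exists>\<psi>. banach_morphism B Y \<psi> \<and> (\<forall>p\<in>vcarrier B. \<phi> (\<psi> p) = p)"
  then obtain \<psi> where \<psi>: "banach_morphism B Y \<psi>" and \<phi>\<psi>: "\<And>p. p \<in> vcarrier B \<Longrightarrow> \<phi> (\<psi> p) = p"
    by blast
  interpret B: banach_algebra B by (rule B)
  interpret Y: left_banach_module B Y act by (rule mod)
  have \<psi>Y: "\<psi> b \<in> vcarrier Y" if "b \<in> vcarrier B" for b
    using that \<psi> by (simp add: banach_morphism_def linear_map_def)
  have \<psi>_add: "\<psi> (vadd B a b) = vadd Y (\<psi> a) (\<psi> b)"
    if "a \<in> vcarrier B" "b \<in> vcarrier B" for a b
    using that \<psi> by (simp add: banach_morphism_def linear_map_def)
  have \<psi>_scale: "\<psi> (vscale B c b) = vscale Y c (\<psi> b)" if "b \<in> vcarrier B" for b c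
    using that \<psi> by (simp add: banach_morphism_def linear_map_def)

  define val where "val = (\<lambda>(b0, l). fold (\<lambda>(a, b) y. vadd Y y (act a (\<psi> b))) l (\<psi> b0))"
  define C where "C = vcarrier B \<times> lists (vcarrier B \<times> vcarrier B)"
  have fold_Y: "fold (\<lambda>(a, b) y. vadd Y y (act a (\<psi> b))) l y \<in> vcarrier Y"
    if "l \<in> lists (vcarrier B \<times> vcarrier B)" "y \<in> vcarrier Y" for l y
    using that
    by (induction l arbitrary: y) (auto simp: Y.add_closed Y.act_closed \<psi>Y)
  have val_Y: "val c \<in> vcarrier Y" if c: "c \<in> C" for c
  proof -
    obtain b k where "c = (b, k)" "b \<in> vcarrier B" "k \<in> lists (vcarrier B \<times> vcarrier B)"
      using c unfolding C_def by blast
    then show ?thesis by (simp only: val_def prod.case fold_Y \<psi>Y)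
  qed
  have fold_add: "fold (\<lambda>(a, b) y. vadd Y y (act a (\<psi> b))) l (vadd Y x y) =
      vadd Y x (fold (\<lambda>(a, b) y. vadd Y y (act a (\<psi> b))) l y)"
    if "l \<in> lists (vcarrier B \<times> vcarrier B)" "x \<in> vcarrier Y" "y \<in> vcarrier Y" for l x y
    using that
    by (induction l arbitrary: y)
       (auto simp: Y.add_closed Y.act_closed \<psi>Y Y.add_assoc)
  have val_add: "\<exists>e\<in>C. val e = vadd Y (val c) (val d)" if c: "c \<in> C" and d: "d \<in> C" for c d
  proof -
    obtain b k b' l where eq: "c = (b, k)" "d = (b', l)"
      and mem: "b \<in> vcarrier B" "b' \<in> vcarrier B"
        "k \<in> lists (vcarrier B \<times> vcarrier B)" "l \<in> lists (vcarrier B \<times> vcarrier B)"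
      using c d unfolding C_def by blast
    let ?f = "fold (\<lambda>(a, b) y. vadd Y y (act a (\<psi> b)))"
    have "val (vadd B b b', l @ k) = ?f k (?f l (vadd Y (\<psi> b) (\<psi> b')))"
      by (simp add: val_def \<psi>_add mem)
    also have "\<dots> = ?f k (vadd Y (\<psi> b) (?f l (\<psi> b')))"
      by (simp add: fold_add mem \<psi>Y)
    also have "\<dots> = ?f k (vadd Y (?f l (\<psi> b')) (\<psi> b))"
      by (simp add: Y.add_commute fold_Y mem \<psi>Y)
    also have "\<dots> = vadd Y (?f l (\<psi> b')) (?f k (\<psi> b))"
      by (simp add: fold_add fold_Y mem \<psi>Y)
    also have "\<dots> = vadd Y (val c) (val d)"
      by (simp add: eq val_def Y.add_commute fold_Y mem \<psi>Y)
    finally show ?thesis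
      using mem by (intro bexI[of _ "(vadd B b b', l @ k)"]) (auto simp: C_def B.add_closed)
  qed
  have val_scale: "\<exists>e\<in>C. val e = vscale Y z (val c)" if c: "c \<in> C" for c z
  proof -
    obtain b k where eq: "c = (b, k)" and mem: "b \<in> vcarrier B"
        "k \<in> lists (vcarrier B \<times> vcarrier B)"
      using c unfolding C_def by blast
    let ?f = "fold (\<lambda>(a, b) y. vadd Y y (act a (\<psi> b)))"
    let ?m = "map (\<lambda>(a, b). (vscale B z a, b))"
    have "?f (?m k) (vscale Y z y) = vscale Y z (?f k y)" if "y \<in> vcarrier Y" for y
      using mem(2) that
    proof (induction k arbitrary: y)
      case (Cons p k)
      then obtain a b where p: "p = (a, b)" "a \<in> vcarrier B" "b \<in> vcarrier B" by auto
      then have "vadd Y (vscale Y z y) (act (vscale B z a) (\<psi> b)) =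
          vscale Y z (vadd Y y (act a (\<psi> b)))"
        using Cons.prems by (simp add: Y.act_scale_left Y.scale_add_right Y.act_closed \<psi>Y)
      then show ?case
        using Cons p by (simp add: Y.add_closed Y.act_closed \<psi>Y)
    qed simp
    then have "val (vscale B z b, ?m k) = vscale Y z (val c)"
      by (simp add: val_def eq \<psi>_scale mem \<psi>Y)
    moreover have "(vscale B z b, ?m k) \<in> C"
      using mem by (fastforce simp: C_def B.scale_closed)
    ultimately show ?thesis by blast
  qed
  have val_act: "\<exists>e\<in>C. val e = act a (val c)" if a: "a \<in> vcarrier B" and c: "c \<in> C" for a c
  proof -
    obtain b k where eq: "c = (b, k)" and mem: "b \<in> vcarrier B"
        "k \<in> lists (vcarrier B \<times> vcarrier B)"
      using c unfolding C_def by blast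
    let ?f = "fold (\<lambda>(a, b) y. vadd Y y (act a (\<psi> b)))"
    let ?m = "map (\<lambda>(a', b). (amult B a a', b))"
    have "?f (?m k) (act a y) = act a (?f k y)" if "y \<in> vcarrier Y" for y
      using mem(2) that
    proof (induction k arbitrary: y)
      case (Cons p k)
      then obtain a' b where p: "p = (a', b)" "a' \<in> vcarrier B" "b \<in> vcarrier B" by auto
      then have "vadd Y (act a y) (act (amult B a a') (\<psi> b)) = act a (vadd Y y (act a' (\<psi> b)))"
        using Cons.prems a by (simp add: Y.act_mult Y.act_add_right Y.act_closed \<psi>Y)
      then show ?case
        using Cons p by (simp add: Y.add_closed Y.act_closed \<psi>Y)
    qed simp
    note * = this[OF \<psi>Y[OF mem(1)]]
    have \<psi>0: "\<psi> (vzero B) = vzero Y"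
      using \<psi>_scale[of "vzero B" 0] by (simp add: B.scale_zero Y.scale_zero B.zero_closed \<psi>Y)
    have "val (vzero B, (a, b) # ?m k) = act a (val c)"
      using * by (simp add: val_def eq \<psi>0 Y.add_closed_zero Y.act_closed a \<psi>Y mem)
    moreover have "(vzero B, (a, b) # ?m k) \<in> C"
      using mem a by (fastforce simp: C_def B.mult_closed B.zero_closed)
    ultimately show ?thesis by blast
  qed

  define S where "S = {y \<in> vcarrier Y. \<forall>e>0. \<exists>c\<in>C. vdist Y (val c) y < e}"
  have SY: "S \<subseteq> vcarrier Y" by (auto simp: S_def)
  have val_S: "val c \<in> S" if "c \<in> C" for c
  proof -
    have "\<exists>d\<in>C. vdist Y (val d) (val c) < e" if "e > 0" for e
      using \<open>e > 0\<close> \<open>c \<in> C\<close> val_Y[OF \<open>c \<in> C\<close>] by (intro bexI[of _ c]) simp_all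
    then show ?thesis using val_Y[OF that] by (simp add: S_def)
  qed
  have \<psi>S: "\<psi> b \<in> S" if "b \<in> vcarrier B" for b
    using val_S[of "(b, [])"] that by (simp add: val_def C_def)
  have S_zero: "vzero Y \<in> S"
    using \<psi>S[OF B.zero_closed] \<psi>_scale[of "vzero B" 0]
    by (simp add: B.scale_zero Y.scale_zero B.zero_closed \<psi>Y)
  have S_add: "vadd Y x y \<in> S" if x: "x \<in> S" and y: "y \<in> S" for x y
  proof -
    have "\<exists>c\<in>C. vdist Y (val c) (vadd Y x y) < e" if "e > 0" for e
    proof -
      obtain c d where cd: "c \<in> C" "d \<in> C" "vdist Y (val c) x < e / 2" "vdist Y (val d) y < e / 2"
        using x y \<open>e > 0\<close> half_gt_zero[of e] unfolding S_def by blast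
      then obtain f where f: "f \<in> C" "val f = vadd Y (val c) (val d)" using val_add by blast
      have "vdist Y (val f) (vadd Y x y) \<le> vdist Y (val c) x + vdist Y (val d) y"
        using cd x y SY by (auto simp: f val_Y intro!: Y.vdist_add)
      then show ?thesis using f cd by (intro bexI[of _ f]) auto
    qed
    then show ?thesis using x y SY by (auto simp: S_def intro: Y.add_closed)
  qed
  have S_scale: "vscale Y z x \<in> S" if x: "x \<in> S" for z x
  proof -
    have "\<exists>c\<in>C. vdist Y (val c) (vscale Y z x) < e" if "e > 0" for e
    proof -
      have pos: "e / (cmod z + 1) > 0" using \<open>e > 0\<close> by (simp add: add_nonneg_pos)
      then obtain c where c: "c \<in> C" "vdist Y (val c) x < e / (cmod z + 1)"
        using x unfolding S_def by blast
      then obtain f where f: "f \<in> C" "val f = vscale Y z (val c)" using val_scale by blast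
      have "vdist Y (val f) (vscale Y z x) = cmod z * vdist Y (val c) x"
        using c x SY by (auto simp: f val_Y intro!: Y.vdist_scale)
      also have "\<dots> \<le> cmod z * (e / (cmod z + 1))"
        using c by (intro mult_left_mono) auto
      also have "\<dots> < e"
        using \<open>e > 0\<close> by (simp add: divide_simps add_nonneg_pos)
      finally show ?thesis using f by blast
    qed
    then show ?thesis using x SY by (auto simp: S_def intro: Y.scale_closed)
  qed
  have S_act: "act a x \<in> S" if a: "a \<in> vcarrier B" and x: "x \<in> S" for a x
  proof -
    obtain K where K: "\<And>a y. \<lbrakk>a \<in> vcarrier B; y \<in> vcarrier Y\<rbrakk>
        \<Longrightarrow> vnorm Y (act a y) \<le> K * vnorm B a * vnorm Y y"
      using Y.act_bounded by blast
    define L where "L = \<bar>K * vnorm B a\<bar>"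
    have L: "L \<ge> 0" by (simp add: L_def)
    have act_dist: "vdist Y (act a u) (act a v) \<le> L * vdist Y u v"
      if "u \<in> vcarrier Y" "v \<in> vcarrier Y" for u v
    proof -
      have "vadd Y (act a u) (vscale Y (-1) (act a v)) = act a (vadd Y u (vscale Y (-1) v))"
        using that a by (simp add: Y.act_add_right Y.act_scale_right Y.scale_closed)
      then have "vdist Y (act a u) (act a v) \<le> K * vnorm B a * vdist Y u v"
        using that a K[OF a, of "vadd Y u (vscale Y (-1) v)"]
        by (simp add: Y.vdist_eq Y.act_closed Y.add_closed Y.scale_closed)
      also have "\<dots> \<le> L * vdist Y u v"
        unfolding L_def by (intro mult_right_mono) auto
      finally show ?thesis .
    qed
    have "\<exists>c\<in>C. vdist Y (val c) (act a x) < e" if "e > 0" for e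
    proof -
      have pos: "e / (L + 1) > 0" using \<open>e > 0\<close> L by simp
      then obtain c where c: "c \<in> C" "vdist Y (val c) x < e / (L + 1)"
        using x unfolding S_def by blast
      then obtain f where f: "f \<in> C" "val f = act a (val c)" using val_act a by blast
      have "vdist Y (val f) (act a x) \<le> L * vdist Y (val c) x"
        using c x SY by (auto simp: f val_Y intro!: act_dist)
      also have "\<dots> \<le> L * (e / (L + 1))"
        using c L by (intro mult_left_mono) auto
      also have "\<dots> < e"
        using \<open>e > 0\<close> L by (simp add: divide_simps)
      finally show ?thesis using f by blast
    qed
    then show ?thesis using x a SY by (auto simp: S_def intro: Y.act_closed)
  qed
  have S_closed: "y \<in> S" if y: "y \<in> vcarrier Y" "\<And>e. e > 0 \<Longrightarrow> \<exists>x\<in>S. vdist Y x y < e" for y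
  proof -
    have "\<exists>c\<in>C. vdist Y (val c) y < e" if "e > 0" for e
    proof -
      obtain x where x: "x \<in> S" "vdist Y x y < e / 2"
        using y(2)[of "e / 2"] \<open>e > 0\<close> by auto
      then obtain c where c: "c \<in> C" "vdist Y (val c) x < e / 2"
        using \<open>e > 0\<close> half_gt_zero[of e] unfolding S_def by blast
      have "vdist Y (val c) y \<le> vdist Y (val c) x + vdist Y x y"
        using c x y SY val_Y by (intro Y.metric.triangle) auto
      then show ?thesis using c x by (intro bexI[of _ c]) auto
    qed
    then show ?thesis using y by (simp add: S_def)
  qed

  define g :: "'y \<Rightarrow> 'b module_code"
    where "g = (\<lambda>y n. SOME c. c \<in> C \<and> vdist Y (val c) y < inverse (real (Suc n)))"
  have g: "g y n \<in> C" "vdist Y (val (g y n)) y < inverse (real (Suc n))" if "y \<in> S" for y n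
  proof -
    have "0 < inverse (real (Suc n))" by simp
    then have "\<exists>c. c \<in> C \<and> vdist Y (val c) y < inverse (real (Suc n))"
      using that unfolding S_def by blast
    from someI_ex[OF this]
    show "g y n \<in> C" "vdist Y (val (g y n)) y < inverse (real (Suc n))"
      unfolding g_def by auto
  qed
  have inj: "inj_on g S"
  proof (rule inj_onI, rule ccontr)
    fix x y assume xy: "x \<in> S" "y \<in> S" "g x = g y" "x \<noteq> y"
    then have pos: "vdist Y x y > 0" using SY by (auto intro: Y.metric.mdist_pos_less)
    then obtain n where n: "inverse (real (Suc n)) < vdist Y x y / 2"
      using reals_Archimedean[of "vdist Y x y / 2"] by auto
    have "vdist Y x y \<le> vdist Y x (val (g x n)) + vdist Y (val (g x n)) y"
      using xy SY g val_Y by (intro Y.metric.triangle) auto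
    moreover have "vdist Y x (val (g x n)) < inverse (real (Suc n))"
      using g(2)[OF xy(1), of n] Y.metric.commute by simp
    moreover have "vdist Y (val (g x n)) y < inverse (real (Suc n))"
      using g(2)[OF xy(2), of n] xy(3) by simp
    ultimately show False using n by simp
  qed

  define h where "h = inv_into S g"
  define F where "F = \<lparr>vcarrier = g ` S, vadd = (\<lambda>x y. g (vadd Y (h x) (h y))),
    vzero = g (vzero Y), vscale = (\<lambda>c x. g (vscale Y c (h x))), vnorm = (\<lambda>x. vnorm Y (h x))\<rparr>"
  define actF where "actF = (\<lambda>a x. g (act a (h x)))"
  have hg: "h (g x) = x" if "x \<in> S" for x using that inj by (simp add: h_def)
  note cl = S_zero S_add S_scale S_act
  have SY': "x \<in> vcarrier Y" if "x \<in> S" for x using that SY by blast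
  have F: "banach_space F"
    unfolding F_def h_def
    by (rule Y.banach_space_copy[OF inj SY S_zero S_add S_scale S_closed])
  have modF: "left_banach_module B F actF"
  proof (intro left_banach_module.intro F left_banach_module_axioms.intro)
    obtain K where "\<And>a y. \<lbrakk>a \<in> vcarrier B; y \<in> vcarrier Y\<rbrakk>
        \<Longrightarrow> vnorm Y (act a y) \<le> K * vnorm B a * vnorm Y y"
      using Y.act_bounded by blast
    then show "\<exists>K. \<forall>a\<in>vcarrier B. \<forall>y\<in>vcarrier F. vnorm F (actF a y) \<le> K * vnorm B a * vnorm F y"
      by (intro exI[of _ K]) (auto simp: F_def actF_def hg cl SY')
  qed (auto simp: F_def actF_def hg cl SY' Y.act_add_left Y.act_add_right Y.act_scale_left
      Y.act_scale_right Y.act_mult)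
  have morF: "left_module_morphism B F actF B (amult B) (\<lambda>x. \<phi> (h x))"
  proof -
    obtain K where "\<And>x. x \<in> vcarrier Y \<Longrightarrow> vnorm B (\<phi> x) \<le> K * vnorm Y x"
      using \<phi> by (auto simp: left_module_morphism_def banach_morphism_def)
    then have "\<exists>K. \<forall>x\<in>vcarrier F. vnorm B (\<phi> (h x)) \<le> K * vnorm F x"
      by (intro exI[of _ K]) (auto simp: F_def hg SY')
    then show ?thesis
      using \<phi> unfolding left_module_morphism_def banach_morphism_def linear_map_def
      by (auto simp: F_def actF_def hg cl SY')
  qed
  have surF: "(\<lambda>x. \<phi> (h x)) ` vcarrier F = vcarrier B"
  proof
    show "(\<lambda>x. \<phi> (h x)) ` vcarrier F \<subseteq> vcarrier B"
      using morF by (auto simp: left_module_morphism_def banach_morphism_def linear_map_def)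
    show "vcarrier B \<subseteq> (\<lambda>x. \<phi> (h x)) ` vcarrier F"
    proof
      fix b assume "b \<in> vcarrier B"
      then show "b \<in> (\<lambda>x. \<phi> (h x)) ` vcarrier F"
        by (intro image_eqI[of _ _ "g (\<psi> b)"]) (auto simp: hg \<psi>S \<phi>\<psi> F_def)
    qed
  qed
  have "banach_morphism B F (\<lambda>b. g (\<psi> b))"
    using \<psi> unfolding banach_morphism_def linear_map_def
    by (auto simp: F_def hg \<psi>S)
  then have "\<exists>\<psi>. banach_morphism B F \<psi> \<and> (\<forall>p\<in>vcarrier B. \<phi> (h (\<psi> p)) = p)"
    by (intro exI[of _ "\<lambda>b. g (\<psi> b)"]) (simp add: hg \<psi>S \<phi>\<psi>)
  then obtain \<rho> where \<rho>: "left_module_morphism B B (amult B) F actF \<rho>"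
      "\<And>p. p \<in> vcarrier B \<Longrightarrow> \<phi> (h (\<rho> p)) = p"
    using proj modF morF surF
    unfolding left_projective_def projective_left_module_wrt_def by blast
  have \<rho>S: "h (\<rho> p) \<in> S" "g (h (\<rho> p)) = \<rho> p" if "p \<in> vcarrier B" for p
  proof -
    have "\<rho> p \<in> g ` S"
      using \<rho>(1) that
      by (simp add: left_module_morphism_def banach_morphism_def linear_map_def F_def)
    then show "h (\<rho> p) \<in> S" "g (h (\<rho> p)) = \<rho> p"
      unfolding h_def by (auto simp: inv_into_into f_inv_into_f)
  qed
  have \<rho>_hom: "\<rho> (vadd B p q) = g (vadd Y (h (\<rho> p)) (h (\<rho> q)))"
    "\<rho> (vscale B c p) = g (vscale Y c (h (\<rho> p)))"
    "\<rho> (amult B p q) = g (act p (h (\<rho> q)))"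
    if "p \<in> vcarrier B" "q \<in> vcarrier B" for p q c
    using \<rho>(1) that
    by (simp_all add: left_module_morphism_def banach_morphism_def linear_map_def F_def actF_def)
  have "\<exists>K. \<forall>p\<in>vcarrier B. vnorm Y (h (\<rho> p)) \<le> K * vnorm B p"
    using \<rho>(1) by (simp add: left_module_morphism_def banach_morphism_def F_def)
  then have "left_module_morphism B B (amult B) Y act (\<lambda>p. h (\<rho> p))"
    unfolding left_module_morphism_def banach_morphism_def linear_map_def
    by (simp add: \<rho>_hom \<rho>S(1) hg cl SY')
  then show "\<exists>\<rho>. left_module_morphism B B (amult B) Y act \<rho> \<and> (\<forall>p\<in>vcarrier B. \<phi> (\<rho> p) = p)"
    using \<rho>(2) by (intro exI[of _ "\<lambda>p. h (\<rho> p)"]) simp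
qed

definition opposite :: "('b, 'u) nalgebra_scheme \<Rightarrow> ('b, 'u) nalgebra_scheme" where
  "opposite B = B\<lparr>amult := (\<lambda>x y. amult B y x)\<rparr>"

lemma projective_right_module_opposite:
  "projective_right_module_wrt T B P actP \<longleftrightarrow>
   projective_left_module_wrt T (opposite B) P (\<lambda>a p. actP p a)"
proof -
  have mod: "right_banach_module B Y act \<longleftrightarrow> left_banach_module (opposite B) Y (\<lambda>a y. act y a)"
    for Y :: "'x nspace" and act
    unfolding left_banach_module_def right_banach_module_def left_banach_module_axioms_def
      right_banach_module_axioms_def opposite_def
    by (simp add: mult_ac, intro conj_cong refl) blast
  have mor: "right_module_morphism B X actX Y actY f \<longleftrightarrow>
      left_module_morphism (opposite B) X (\<lambda>a x. actX x a) Y (\<lambda>a y. actY y a) f"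
    for X :: "('x, 'v) nspace_scheme" and actX and Y :: "('y, 'w) nspace_scheme" and actY f
    by (simp add: right_module_morphism_def left_module_morphism_def opposite_def)
  have flip: "(\<forall>Y act \<phi>. Q Y act \<phi>) \<longleftrightarrow> (\<forall>Y act \<phi>. Q Y (\<lambda>a y. act y a) \<phi>)"
    for Q :: "'x nspace \<Rightarrow> ('b \<Rightarrow> 'x \<Rightarrow> 'x) \<Rightarrow> ('x \<Rightarrow> 'p) \<Rightarrow> bool"
  proof
    assume *: "\<forall>Y act \<phi>. Q Y (\<lambda>a y. act y a) \<phi>"
    show "\<forall>Y act \<phi>. Q Y act \<phi>"
    proof (intro allI)
      fix Y act \<phi> show "Q Y act \<phi>" using *[rule_format, of Y "\<lambda>y a. act a y" \<phi>] by simp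
    qed
  qed blast
  show ?thesis
    unfolding projective_right_module_wrt_def projective_left_module_wrt_def mod mor
    by (rule sym, rule flip)
qed

theorem right_projective_wrt:
  fixes B :: "('b, 'u) nalgebra_scheme"
  assumes "banach_algebra B" and "right_projective B"
  shows "projective_right_module_wrt TYPE('y) B B (amult B)"
proof -
  interpret B: banach_algebra B by (rule assms(1))
  have op: "vcarrier (opposite B) = vcarrier B" "vadd (opposite B) = vadd B"
      "vzero (opposite B) = vzero B" "vscale (opposite B) = vscale B" "vnorm (opposite B) = vnorm B"
      "\<And>x y. amult (opposite B) x y = amult B y x"
    by (simp_all add: opposite_def)
  have dist: "vdist (opposite B) = vdist B"
    by (intro ext) (simp only: vdist_def op)
  have "banach_algebra (opposite B)"
  proof (intro banach_algebra.intro banach_algebra_axioms.intro)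
    show "banach_space (opposite B)"
      using B.banach_space_axioms unfolding banach_space_def op dist .
    show "vnorm (opposite B) (amult (opposite B) x y) \<le> vnorm (opposite B) x * vnorm (opposite B) y"
      if "x \<in> vcarrier (opposite B)" "y \<in> vcarrier (opposite B)" for x y
      using that B.norm_mult[of y x] by (simp add: op mult.commute)
  qed (simp_all add: op B.mult_closed B.mult_assoc B.mult_add_left B.mult_add_right
      B.mult_scale_left B.mult_scale_right)
  moreover have space: "left_module_morphism R X actX (opposite B) actY f \<longleftrightarrow>
      left_module_morphism R X actX B actY f"
    "left_module_morphism R (opposite B) actX' X actX g \<longleftrightarrow>
      left_module_morphism R B actX' X actX g"
    "banach_morphism (opposite B) X g \<longleftrightarrow> banach_morphism B X g"
    "vcarrier (opposite B) = vcarrier B"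
    for R :: "('b, 'u) nalgebra_scheme" and X :: "'x nspace" and actX actY actX' f g
    by (simp_all add: left_module_morphism_def banach_morphism_def linear_map_def opposite_def)
  have self: "projective_left_module_wrt T (opposite B) (opposite B) (amult (opposite B)) \<longleftrightarrow>
      projective_right_module_wrt T B B (amult B)" for T :: "'x itself"
  proof -
    have "projective_left_module_wrt T (opposite B) (opposite B) act \<longleftrightarrow>
        projective_left_module_wrt T (opposite B) B act" for act
      unfolding projective_left_module_wrt_def space ..
    then show ?thesis
      by (simp add: projective_right_module_opposite) (simp add: opposite_def)
  qed
  have "left_projective (opposite B)"
    using assms(2) by (simp add: left_projective_def right_projective_def self)
  ultimately show ?thesis
    using left_projective_wrt[of "opposite B"] by (simp add: self)
qed

section \<open>Continuous fields of Banach algebras\<close>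

record ('t, 'a) alg_field =
  base :: "'t topology"
  fibre :: "'t \<Rightarrow> 'a nalgebra"
  sections :: "('t \<Rightarrow> 'a) set"

text \<open>
  The product of the fibres over \<open>S\<close>. Its elements are extensional functions, so that they are
  determined by their values on \<open>S\<close>. A single type \<open>'a\<close> for all fibres is no restriction: any family
  of algebras can be copied into a disjoint sum.
\<close>

abbreviation fibre_prod :: "'t set \<Rightarrow> ('t \<Rightarrow> ('a, 'z) nspace_scheme) \<Rightarrow> ('t \<Rightarrow> 'a) set" where
  "fibre_prod S A \<equiv> \<Pi>\<^sub>E t\<in>S. vcarrier (A t)"

definition locally_approximable ::
  "'t topology \<Rightarrow> ('t \<Rightarrow> 'a nalgebra) \<Rightarrow> ('t \<Rightarrow> 'a) set \<Rightarrow> ('t \<Rightarrow> 'a) \<Rightarrow> bool" where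
  "locally_approximable X A \<Theta> x \<longleftrightarrow>
     (\<forall>t\<in>topspace X. \<forall>\<epsilon>>0. \<exists>x'\<in>\<Theta>. \<exists>N. openin X N \<and> t \<in> N \<and>
        (\<forall>s\<in>N. vdist (A s) (x s) (x' s) \<le> \<epsilon>))"

definition sec_add :: "('t, 'a) alg_field \<Rightarrow> ('t \<Rightarrow> 'a) \<Rightarrow> ('t \<Rightarrow> 'a) \<Rightarrow> 't \<Rightarrow> 'a" where
  "sec_add U x y = (\<lambda>t\<in>topspace (base U). vadd (fibre U t) (x t) (y t))"

definition sec_zero :: "('t, 'a) alg_field \<Rightarrow> 't \<Rightarrow> 'a" where
  "sec_zero U = (\<lambda>t\<in>topspace (base U). vzero (fibre U t))"

definition sec_scale :: "('t, 'a) alg_field \<Rightarrow> complex \<Rightarrow> ('t \<Rightarrow> 'a) \<Rightarrow> 't \<Rightarrow> 'a" where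
  "sec_scale U c x = (\<lambda>t\<in>topspace (base U). vscale (fibre U t) c (x t))"

definition sec_mult :: "('t, 'a) alg_field \<Rightarrow> ('t \<Rightarrow> 'a) \<Rightarrow> ('t \<Rightarrow> 'a) \<Rightarrow> 't \<Rightarrow> 'a" where
  "sec_mult U x y = (\<lambda>t\<in>topspace (base U). amult (fibre U t) (x t) (y t))"

locale continuous_field =
  fixes U :: "('t, 'a) alg_field"
  assumes Hausdorff: "Hausdorff_space (base U)"
    and locally_compact: "locally_compact_space (base U)"
    and fibre_algebra: "t \<in> topspace (base U) \<Longrightarrow> banach_algebra (fibre U t)"
    and sections_subset: "sections U \<subseteq> fibre_prod (topspace (base U)) (fibre U)"
    and zero_section: "sec_zero U \<in> sections U"
    and add_section: "\<lbrakk>x \<in> sections U; y \<in> sections U\<rbrakk> \<Longrightarrow> sec_add U x y \<in> sections U"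
    and scale_section: "x \<in> sections U \<Longrightarrow> sec_scale U c x \<in> sections U"
    and mult_section: "\<lbrakk>x \<in> sections U; y \<in> sections U\<rbrakk> \<Longrightarrow> sec_mult U x y \<in> sections U"
    and sections_dense: "t \<in> topspace (base U) \<Longrightarrow>
      vtopology (fibre U t) closure_of ((\<lambda>x. x t) ` sections U) = vcarrier (fibre U t)"
    and norm_continuous: "x \<in> sections U \<Longrightarrow>
      continuous_map (base U) euclideanreal (\<lambda>t. vnorm (fibre U t) (x t))"
    and sections_closed:
      "\<lbrakk>x \<in> fibre_prod (topspace (base U)) (fibre U);
        locally_approximable (base U) (fibre U) (sections U) x\<rbrakk> \<Longrightarrow> x \<in> sections U"

definition vanishes_at_infinity :: "'t topology \<Rightarrow> ('t \<Rightarrow> real) \<Rightarrow> bool" where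
  "vanishes_at_infinity X f \<longleftrightarrow>
     (\<forall>\<epsilon>>0. \<exists>K. compactin X K \<and> (\<forall>t\<in>topspace X - K. \<bar>f t\<bar> < \<epsilon>))"

text \<open>
  Inserting 0 does not change a supremum of norms, except over an empty base, where it
  gives the norm of the only section its correct value 0.
\<close>

definition field_algebra :: "('t, 'a) alg_field \<Rightarrow> ('t \<Rightarrow> 'a) nalgebra" where
  "field_algebra U =
     \<lparr>vcarrier = {x \<in> sections U. vanishes_at_infinity (base U) (\<lambda>t. vnorm (fibre U t) (x t))},
      vadd = sec_add U,
      vzero = sec_zero U,
      vscale = sec_scale U,
      vnorm = (\<lambda>x. Sup (insert 0 ((\<lambda>t. vnorm (fibre U t) (x t)) ` topspace (base U)))),
      amult = sec_mult U\<rparr>"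

definition induced_field :: "('t, 'a) alg_field \<Rightarrow> 't set \<Rightarrow> ('t, 'a) alg_field" where
  "induced_field U Y =
     \<lparr>base = subtopology (base U) Y,
      fibre = fibre U,
      sections = {x \<in> fibre_prod (topspace (subtopology (base U) Y)) (fibre U).
                    locally_approximable (subtopology (base U) Y) (fibre U) (sections U) x}\<rparr>"

definition isometric_algebra_iso ::
  "('a, 'y) nalgebra_scheme \<Rightarrow> ('b, 'z) nalgebra_scheme \<Rightarrow> ('a \<Rightarrow> 'b) \<Rightarrow> bool" where
  "isometric_algebra_iso A B f \<longleftrightarrow>
     linear_map A B f \<and> bij_betw f (vcarrier A) (vcarrier B) \<and>
     (\<forall>x\<in>vcarrier A. \<forall>y\<in>vcarrier A. f (amult A x y) = amult B (f x) (f y)) \<and>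
     (\<forall>x\<in>vcarrier A. vnorm B (f x) = vnorm A x)"

definition isomorphic_fields :: "('t, 'a) alg_field \<Rightarrow> ('t, 'b) alg_field \<Rightarrow> bool" where
  "isomorphic_fields U V \<longleftrightarrow>
     base U = base V \<and>
     (\<exists>\<phi>. (\<forall>t\<in>topspace (base U). isometric_algebra_iso (fibre U t) (fibre V t) (\<phi> t)) \<and>
          (\<forall>x\<in>sections U. (\<lambda>t\<in>topspace (base U). \<phi> t (x t)) \<in> sections V))"

definition constant_field :: "'t topology \<Rightarrow> 'a nalgebra \<Rightarrow> ('t, 'a) alg_field" where
  "constant_field X A =
     \<lparr>base = X,
      fibre = (\<lambda>t. A),
      sections = {x \<in> extensional (topspace X). continuous_map X (vtopology A) x}\<rparr>"

text \<open>
  It is no restriction that \<open>A\<close> below has the type \<open>'a\<close> of the fibres: a field isomorphic to a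
  constant field over a nonempty base is isomorphic to the one defined by any of its own fibres.
\<close>

definition trivial_field :: "('t, 'a) alg_field \<Rightarrow> bool" where
  "trivial_field U \<longleftrightarrow>
     (\<exists>A :: 'a nalgebra. banach_algebra A \<and> isomorphic_fields U (constant_field (base U) A))"

definition sigma_locally_trivial :: "('t, 'a) alg_field \<Rightarrow> bool" where
  "sigma_locally_trivial V \<longleftrightarrow>
     (\<exists>\<U>. (\<forall>G\<in>\<U>. openin (base V) G) \<and> \<Union>\<U> = topspace (base V) \<and>
          (\<forall>G\<in>\<U>. trivial_field (induced_field V G)) \<and>
          (\<exists>\<V>. countable \<V> \<and> (\<forall>H\<in>\<V>. openin (base V) H) \<and> \<Union>\<V> = topspace (base V) \<and>
               (\<forall>H\<in>\<V>. \<exists>G\<in>\<U>. base V closure_of H \<subseteq> G)))"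


section \<open>Paracompactness\<close>

definition paracompact_space :: "'t topology \<Rightarrow> bool" where
  "paracompact_space X \<longleftrightarrow>
     Hausdorff_space X \<and>
     (\<forall>\<U>. (\<forall>G\<in>\<U>. openin X G) \<and> \<Union>\<U> = topspace X \<longrightarrow>
          (\<exists>\<V>. (\<forall>H\<in>\<V>. openin X H) \<and> \<Union>\<V> = topspace X \<and>
               (\<forall>H\<in>\<V>. \<exists>G\<in>\<U>. H \<subseteq> G) \<and> locally_finite_in X \<V>))"

end

theory Submission
  imports Defs
begin

text \<open>
  Let \<open>B\<close> be the algebra of the field. Everything rests on one topological observation. Call a
  relation \<open>R\<close> on a locally compact Hausdorff space \<open>X\<close> proper if it sends compact sets into
  countable unions of compact sets, and suppose that every \<open>t\<close> has a neighbourhood whose points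
  are related to \<open>t\<close> in both directions. Then every \<open>R\<close>-invariant subset is clopen: going along
  \<open>R\<close> from a point of the set stays in it, which makes it open, and coming along \<open>R\<close> from a point
  near a boundary point would put the boundary point in it, which makes it closed. Arbitrary
  unions of invariant sets are invariant, so after well-ordering the points, the orbits \<open>R\<^sup>* ``
  {p}\<close> can be cut down to a clopen partition of \<open>X\<close>. Each orbit is covered by countably many
  compact sets, so the parts are Lindelof, and a regular Lindelof space is paracompact
  (\<open>paracompact_space_if_proper_neighbourhood_relation\<close>). The relation may be patched together
  from countably many pieces on each of the sets \<open>W \<mu>\<close>, since a compact set meets only finitely
  many of them (\<open>paracompact_space_if_countable_local_relations\<close>).

  Projectivity supplies the relation. Let the field be trivial over an open set \<open>G\<close>, with fibre
  \<open>A\<close> and isomorphisms \<open>\<phi> t\<close>. A module section \<open>\<rho>\<close> of the multiplication \<open>B\<^sub>+ \<otimes> B \<rightarrow> B\<close> assigns to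
  \<open>b\<close> a sum \<open>\<Sum> b\<^sub>k \<otimes> c\<^sub>k\<close>, hence a kernel \<open>F(s, t) = \<Sum> b\<^sub>k(s) \<phi>\<^sub>s\<^sup>-\<^sup>1 (\<phi>\<^sub>t (c\<^sub>k(t)))\<close> on \<open>G \<times> G\<close>
  with values in the fibre at \<open>s\<close>. The kernel restricts to \<open>b\<close> on the diagonal, is continuous
  there in each variable, and vanishes at infinity in \<open>t\<close>, uniformly in \<open>s\<close>. The tensor product
  can be bypassed: the bounded kernels with these three properties, normed by the supremum, form
  a Banach module themselves, and restriction to the diagonal is a module morphism onto \<open>B\<close> with
  a bounded linear right inverse, so projectivity lifts it.

  Take \<open>x\<close> and \<open>y\<close> in \<open>A\<close> with \<open>y x \<noteq> 0\<close>, let \<open>g\<close> be a bump function on \<open>G\<close> with \<open>g(s) = 1\<close>, and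
  consider \<open>\<Phi>(s, t) = y \<cdot> \<rho>(g x)(s, t)\<close>, with \<open>x\<close> and \<open>y\<close> read in the fibres over \<open>G\<close>. It does
  not depend on \<open>g\<close>, because \<open>(f y) \<cdot> \<rho>(g x) = \<rho>(f g y x) = (g y) \<cdot> \<rho>(f x)\<close>. On the diagonal its
  norm is \<open>\<parallel>y x\<parallel>\<close>, and for \<open>s\<close> in a compact subset of \<open>G\<close> a single \<open>g\<close> serves, so \<open>\<Phi>(s, t)\<close> is
  small for \<open>t\<close> off a compact set. Hence \<open>\<parallel>\<Phi>(s, t)\<parallel> \<ge> \<parallel>y x\<parallel> / 2\<close> is a relation of the required
  kind over \<open>G\<close>. It sends compact subsets of \<open>G\<close> into compact sets; after restriction to an open
  set whose closure lies in \<open>G\<close> it does so for all compact subsets of the space, and this is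
  where the sets \<open>V\<^sub>j\<close> of a \<open>\<sigma>\<close>-locally trivial field come in.

  Elements with \<open>y x \<noteq> 0\<close> exist, because a projective \<open>B\<close> cannot have zero multiplication over
  \<open>G\<close>: otherwise, for a nonzero bounded functional on a fibre, the bilinear map \<open>(b, c) \<mapsto> f(b(s))
  c(s)\<close> would define a module extension of \<open>B\<close> that splits linearly but not as a module
  (\<open>exists_nonzero_product\<close>). The functional comes from a Hahn-Banach argument.

  The right projective case follows by passing to the opposite field.
\<close>

section \<open>Paracompactness from relations\<close>

text \<open>
  Shrink a cover by regularity to sets \<open>P x\<close> whose closures lie in the chosen members \<open>G x\<close>,
  select countably many of them that still cover, and subtract from the \<open>n\<close>-th member the
  closures of the earlier \<open>P\<close>.
\<close>

lemma regular_Lindelof_open_refinement: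
  assumes reg: "regular_space X" and Q: "openin X Q" and Lin: "Lindelof_space (subtopology X Q)"
    and \<U>: "\<And>G. G \<in> \<U> \<Longrightarrow> openin X G" and cover: "Q \<subseteq> \<Union>\<U>"
  obtains \<V> where "\<And>H. H \<in> \<V> \<Longrightarrow> openin X H" "\<Union>\<V> = Q" "\<And>H. H \<in> \<V> \<Longrightarrow> \<exists>G\<in>\<U>. H \<subseteq> G"
    "\<And>x. x \<in> Q \<Longrightarrow> \<exists>N. openin X N \<and> x \<in> N \<and> N \<subseteq> Q \<and> finite {H \<in> \<V>. H \<inter> N \<noteq> {}}"
proof (cases "Q = {}")
  case True
  then show thesis using that[of "{}"] by simp
next
  case False
  have "\<exists>P G. openin X P \<and> x \<in> P \<and> G \<in> \<U> \<and> X closure_of P \<subseteq> G \<inter> Q" if x: "x \<in> Q" for x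
  proof -
    obtain G where G: "G \<in> \<U>" "x \<in> G" using x cover by blast
    have "neighbourhood_base_of (closedin X) X" using reg by (simp add: neighbourhood_base_of_closedin)
    moreover have "openin X (G \<inter> Q)" using \<U>[OF G(1)] Q by (rule openin_Int)
    moreover have "x \<in> G \<inter> Q" using G x by simp
    ultimately obtain P C where "openin X P" "closedin X C" "x \<in> P" "P \<subseteq> C" "C \<subseteq> G \<inter> Q"
      unfolding neighbourhood_base_of by metis
    then show ?thesis using G closure_of_minimal by (metis subset_trans)
  qed
  then have "\<forall>x\<in>Q. \<exists>PG. openin X (fst PG) \<and> x \<in> fst PG \<and> snd PG \<in> \<U> \<and>
      X closure_of (fst PG) \<subseteq> snd PG \<inter> Q"
    by auto
  from bchoice[OF this] obtain PG where PG: "\<forall>x\<in>Q. openin X (fst (PG x)) \<and> x \<in> fst (PG x) \<and>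
      snd (PG x) \<in> \<U> \<and> X closure_of (fst (PG x)) \<subseteq> snd (PG x) \<inter> Q" ..
  define P G where "P x = fst (PG x)" and "G x = snd (PG x)" for x
  have PG: "openin X (P x)" "x \<in> P x" "G x \<in> \<U>" "X closure_of (P x) \<subseteq> G x \<inter> Q" if "x \<in> Q" for x
    using PG that by (simp_all add: P_def G_def)
  have QX: "Q \<subseteq> topspace X" using Q by (rule openin_subset)
  have "Q \<subseteq> \<Union>(P ` Q)" "\<forall>H\<in>P ` Q. openin X H" using PG(1,2) by blast+
  then obtain \<C> where \<C>: "countable \<C>" "\<C> \<subseteq> P ` Q" "Q \<subseteq> \<Union>\<C>"
    using Lin[unfolded Lindelof_space_subtopology_subset[OF QX], rule_format, of "P ` Q"] by metis
  then have "\<C> \<noteq> {}" using False by auto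
  define p where "p n = (SOME x. x \<in> Q \<and> P x = from_nat_into \<C> n)" for n
  have p: "p n \<in> Q" "P (p n) = from_nat_into \<C> n" for n
  proof -
    have "from_nat_into \<C> n \<in> P ` Q" using from_nat_into[OF \<open>\<C> \<noteq> {}\<close>] \<C>(2) by blast
    then have "\<exists>x. x \<in> Q \<and> P x = from_nat_into \<C> n" by auto
    from someI_ex[OF this] show "p n \<in> Q" "P (p n) = from_nat_into \<C> n" by (auto simp: p_def)
  qed
  have cov: "\<exists>n. x \<in> P (p n)" if x: "x \<in> Q" for x
  proof -
    obtain C where "C \<in> \<C>" "x \<in> C" using \<C>(3) x by blast
    then show ?thesis using from_nat_into_surj[OF \<C>(1)] p(2) by metis
  qed
  have Pcl: "P (p n) \<subseteq> X closure_of P (p n)" for n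
    using closure_of_subset[OF openin_subset[OF PG(1)[OF p(1)]]] .
  \<comment> \<open>Removing the earlier closures makes the family locally finite, as \<open>P (p n)\<close> misses all later sets.\<close>
  define O' where "O' n = (G (p n) \<inter> Q) - (\<Union>k<n. X closure_of P (p k))" for n
  show thesis
  proof (rule that)
    show "openin X H" if H: "H \<in> range O'" for H
    proof -
      obtain n where "H = O' n" using H by auto
      moreover have "closedin X (\<Union>k<n. X closure_of P (p k))"
        by (rule closedin_Union) auto
      ultimately show ?thesis
        unfolding O'_def using \<U>[OF PG(3)[OF p(1)[of n]]] Q by (simp add: openin_diff openin_Int)
    qed
    show "\<Union>(range O') = Q"
    proof
      show "Q \<subseteq> \<Union>(range O')"
      proof
        fix x assume x: "x \<in> Q"
        let ?S = "\<lambda>n. x \<in> G (p n) \<inter> Q"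
        have ex: "\<exists>n. ?S n" using cov[OF x] Pcl PG(4)[OF p(1)] by blast
        have "x \<in> O' (LEAST n. ?S n)"
        proof -
          have "x \<notin> X closure_of P (p k)" if "k < (LEAST n. ?S n)" for k
            using not_less_Least[OF that] PG(4)[OF p(1)[of k]] by blast
          then show ?thesis unfolding O'_def using LeastI_ex[OF ex] by blast
        qed
        then show "x \<in> \<Union>(range O')" by blast
      qed
    qed (auto simp: O'_def)
    show "\<exists>G\<in>\<U>. H \<subseteq> G" if "H \<in> range O'" for H
      using that PG(3)[OF p(1)] by (auto simp: O'_def)
    show "\<exists>N. openin X N \<and> x \<in> N \<and> N \<subseteq> Q \<and> finite {H \<in> range O'. H \<inter> N \<noteq> {}}" if x: "x \<in> Q" for x
    proof -
      obtain n where n: "x \<in> P (p n)" using cov[OF x] by blast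
      have "O' m \<inter> P (p n) = {}" if "n < m" for m
        using that Pcl[of n] by (auto simp: O'_def)
      then have "{H \<in> range O'. H \<inter> P (p n) \<noteq> {}} \<subseteq> O' ` {..n}"
        by (auto simp: not_less) (metis linorder_not_less imageI atMost_iff IntI empty_iff)
      then have "finite {H \<in> range O'. H \<inter> P (p n) \<noteq> {}}"
        by (rule finite_subset) simp
      moreover have "P (p n) \<subseteq> Q" using Pcl[of n] PG(4)[OF p(1)] by blast
      ultimately show ?thesis using PG[OF p(1)] n by blast
    qed
  qed
qed

lemma paracompact_space_of_Lindelof_partition:
  assumes X: "Hausdorff_space X" "regular_space X"
    and op: "\<And>i. i \<in> I \<Longrightarrow> openin X (Q i)"
    and Lin: "\<And>i. i \<in> I \<Longrightarrow> Lindelof_space (subtopology X (Q i))"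
    and disj: "disjoint_family_on Q I" and cover: "(\<Union>i\<in>I. Q i) = topspace X"
  shows "paracompact_space X"
  unfolding paracompact_space_def
proof (intro conjI allI impI X(1))
  fix \<U> assume \<U>: "(\<forall>G\<in>\<U>. openin X G) \<and> \<Union>\<U> = topspace X"
  have "\<exists>\<V>. (\<forall>H\<in>\<V>. openin X H) \<and> \<Union>\<V> = Q i \<and> (\<forall>H\<in>\<V>. \<exists>G\<in>\<U>. H \<subseteq> G) \<and>
    (\<forall>x\<in>Q i. \<exists>N. openin X N \<and> x \<in> N \<and> N \<subseteq> Q i \<and> finite {H \<in> \<V>. H \<inter> N \<noteq> {}})" if i: "i \<in> I" for i
  proof -
    have "Q i \<subseteq> \<Union>\<U>" using op[OF i] \<U> openin_subset by auto
    show ?thesis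
    proof (rule regular_Lindelof_open_refinement[OF X(2) op[OF i] Lin[OF i], of \<U>])
      show "openin X G" if "G \<in> \<U>" for G using that \<U> by blast
      show "Q i \<subseteq> \<Union>\<U>" by fact
    next
      fix \<V> assume "\<And>H. H \<in> \<V> \<Longrightarrow> openin X H" "\<Union>\<V> = Q i" "\<And>H. H \<in> \<V> \<Longrightarrow> \<exists>G\<in>\<U>. H \<subseteq> G"
        "\<And>x. x \<in> Q i \<Longrightarrow> \<exists>N. openin X N \<and> x \<in> N \<and> N \<subseteq> Q i \<and> finite {H \<in> \<V>. H \<inter> N \<noteq> {}}"
      then show ?thesis by (intro exI[of _ \<V>] conjI ballI)
    qed
  qed
  then have "\<forall>i\<in>I. \<exists>\<V>. (\<forall>H\<in>\<V>. openin X H) \<and> \<Union>\<V> = Q i \<and> (\<forall>H\<in>\<V>. \<exists>G\<in>\<U>. H \<subseteq> G) \<and>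
    (\<forall>x\<in>Q i. \<exists>N. openin X N \<and> x \<in> N \<and> N \<subseteq> Q i \<and> finite {H \<in> \<V>. H \<inter> N \<noteq> {}})" by (rule ballI)
  from bchoice[OF this] obtain \<V> where \<V>':
    "\<forall>i\<in>I. (\<forall>H\<in>\<V> i. openin X H) \<and> \<Union>(\<V> i) = Q i \<and> (\<forall>H\<in>\<V> i. \<exists>G\<in>\<U>. H \<subseteq> G) \<and>
      (\<forall>x\<in>Q i. \<exists>N. openin X N \<and> x \<in> N \<and> N \<subseteq> Q i \<and> finite {H \<in> \<V> i. H \<inter> N \<noteq> {}})" ..
  then have \<V>: "\<And>i H. i \<in> I \<Longrightarrow> H \<in> \<V> i \<Longrightarrow> openin X H" "\<And>i. i \<in> I \<Longrightarrow> \<Union>(\<V> i) = Q i"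
    "\<And>i H. i \<in> I \<Longrightarrow> H \<in> \<V> i \<Longrightarrow> \<exists>G\<in>\<U>. H \<subseteq> G"
    "\<And>i x. i \<in> I \<Longrightarrow> x \<in> Q i \<Longrightarrow>
      \<exists>N. openin X N \<and> x \<in> N \<and> N \<subseteq> Q i \<and> finite {H \<in> \<V> i. H \<inter> N \<noteq> {}}"
    by simp_all
  let ?V = "\<Union>i\<in>I. \<V> i"
  have un: "\<Union>?V = topspace X" 
  proof -
    have "\<Union>?V = (\<Union>i\<in>I. \<Union>(\<V> i))" by blast
    then show ?thesis using \<V>(2) cover by simp
  qed
  have "\<exists>N. openin X N \<and> x \<in> N \<and> finite {H \<in> ?V. H \<inter> N \<noteq> {}}" if x: "x \<in> topspace X" for x
  proof -
    obtain i where i: "i \<in> I" "x \<in> Q i" using x cover by blast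
    then obtain N where N: "openin X N" "x \<in> N" "N \<subseteq> Q i" "finite {H \<in> \<V> i. H \<inter> N \<noteq> {}}"
      using \<V>(4) by blast
    have "{H \<in> ?V. H \<inter> N \<noteq> {}} \<subseteq> {H \<in> \<V> i. H \<inter> N \<noteq> {}}"
    proof clarify
      fix j H assume H: "j \<in> I" "H \<in> \<V> j" "H \<inter> N \<noteq> {}"
      then have "H \<subseteq> Q j" using \<V>(2) by blast
      then have "Q j \<inter> Q i \<noteq> {}" using H N by blast
      then have "j = i" using disj H(1) i(1) by (meson disjoint_family_on_def)
      then show "H \<in> \<V> i" using H by simp
    qed
    then show ?thesis using N finite_subset by blast
  qed
  then show "\<exists>\<V>. (\<forall>H\<in>\<V>. openin X H) \<and> \<Union>\<V> = topspace X \<and> (\<forall>H\<in>\<V>. \<exists>G\<in>\<U>. H \<subseteq> G) \<and>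
      locally_finite_in X \<V>"
    using \<V> un by (intro exI[of _ ?V]) (auto simp: locally_finite_in_def)
qed

definition countably_compactly_covered :: "'t topology \<Rightarrow> 't set \<Rightarrow> bool" where
  "countably_compactly_covered X S \<longleftrightarrow>
     (\<exists>\<K>. countable \<K> \<and> (\<forall>K\<in>\<K>. compactin X K) \<and> S \<subseteq> \<Union>\<K>)"

lemma countably_compactly_covered_UN:
  assumes "countable I" "\<And>i. i \<in> I \<Longrightarrow> countably_compactly_covered X (S i)"
  shows "countably_compactly_covered X (\<Union>i\<in>I. S i)"
proof -
  obtain \<K> where \<K>: "\<And>i. i \<in> I \<Longrightarrow> countable (\<K> i) \<and> (\<forall>K\<in>\<K> i. compactin X K) \<and> S i \<subseteq> \<Union>(\<K> i)"
    using assms(2) unfolding countably_compactly_covered_def by metis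
  then show ?thesis
    unfolding countably_compactly_covered_def
    using assms(1) by (intro exI[of _ "\<Union>i\<in>I. \<K> i"]) (auto, blast)
qed

lemma countably_compactly_covered_subset:
  "countably_compactly_covered X T \<Longrightarrow> S \<subseteq> T \<Longrightarrow> countably_compactly_covered X S"
  unfolding countably_compactly_covered_def by (meson subset_trans)

lemma countably_compactly_covered_compactin:
  "compactin X K \<Longrightarrow> countably_compactly_covered X K"
  unfolding countably_compactly_covered_def by (intro exI[of _ "{K}"]) simp

lemma Lindelof_space_closed_countably_compactly_covered:
  assumes "countably_compactly_covered X S" "closedin X S"
  shows "Lindelof_space (subtopology X S)"
proof -
  obtain \<K> where \<K>: "countable \<K>" "\<And>K. K \<in> \<K> \<Longrightarrow> compactin X K" "S \<subseteq> \<Union>\<K>"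
    using assms(1) unfolding countably_compactly_covered_def by blast
  have "Lindelof_space (subtopology X (\<Union>\<K>))"
    using \<K> by (intro Lindelof_space_Union) (auto simp: compactin_subspace intro: compact_imp_Lindelof_space)
  moreover have "closedin (subtopology X (\<Union>\<K>)) S"
    using assms(2) \<K>(3) by (metis closedin_subset_topspace)
  ultimately have "Lindelof_space (subtopology (subtopology X (\<Union>\<K>)) S)"
    by (rule Lindelof_space_closedin_subtopology)
  then show ?thesis using \<K>(3) by (simp add: subtopology_subtopology inf_absorb2)
qed

text \<open>
  The second condition on \<open>R\<close> makes every \<open>R\<close>-invariant set clopen; in particular the orbits \<open>L
  p\<close> and all unions of orbits are clopen, so the parts \<open>Q p\<close> obtained by removing the earlier
  orbits of a well-ordering are clopen too.
\<close>

theorem paracompact_space_if_proper_neighbourhood_relation: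
  assumes H: "Hausdorff_space X" and lc: "locally_compact_space X"
    and sub: "R \<subseteq> topspace X \<times> topspace X"
    and proper: "\<And>K. compactin X K \<Longrightarrow> countably_compactly_covered X (R `` K)"
    and nbhd: "\<And>t. t \<in> topspace X \<Longrightarrow>
      \<exists>N. openin X N \<and> t \<in> N \<and> (\<forall>s\<in>N. (s, t) \<in> R \<and> (t, s) \<in> R)"
  shows "paracompact_space X"
proof -
  have clopen: "openin X S \<and> closedin X S" if S: "S \<subseteq> topspace X" "R `` S \<subseteq> S" for S
  proof
    have "\<exists>N. openin X N \<and> t \<in> N \<and> N \<subseteq> S" if t: "t \<in> S" for t
    proof -
      have "t \<in> topspace X" using t S(1) by blast
      from nbhd[OF this] obtain N where "openin X N" "t \<in> N" "\<forall>s\<in>N. (t, s) \<in> R" by blast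
      moreover from this have "N \<subseteq> S" using S(2) t by blast
      ultimately show ?thesis by blast
    qed
    then show "openin X S" by (subst openin_subopen) blast
    have "\<exists>N. openin X N \<and> t \<in> N \<and> N \<subseteq> topspace X - S" if t: "t \<in> topspace X - S" for t
    proof -
      obtain N where N: "openin X N" "t \<in> N" "\<forall>s\<in>N. (s, t) \<in> R" using nbhd[of t] t by blast
      have "s \<notin> S" if "s \<in> N" for s using S(2) t N(3) that by blast
      then have "N \<subseteq> topspace X - S" using openin_subset[OF N(1)] by blast
      then show ?thesis using N by blast
    qed
    then have "openin X (topspace X - S)" by (subst openin_subopen) blast
    then show "closedin X S" using S(1) by (simp add: closedin_def)
  qed
  define L where "L p = R\<^sup>* `` {p}" for p
  have L_sub: "L p \<subseteq> topspace X" if "p \<in> topspace X" for p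
    unfolding L_def using that by (auto elim!: rtranclE dest!: subsetD[OF sub])
  have L_R: "R `` L p \<subseteq> L p" for p
    by (auto simp: L_def)
  have L_p: "p \<in> L p" for p by (simp add: L_def)
  have L_cov: "countably_compactly_covered X (L p)" if p: "p \<in> topspace X" for p
  proof -
    have "countably_compactly_covered X ((R ^^ n) `` {p})" for n
    proof (induction n)
      case 0
      have "compactin X {p}" using p by simp
      then show ?case using countably_compactly_covered_compactin[of X "{p}"] by simp
    next
      case (Suc n)
      then obtain \<K> where \<K>: "countable \<K>" "\<And>K. K \<in> \<K> \<Longrightarrow> compactin X K" "(R ^^ n) `` {p} \<subseteq> \<Union>\<K>"
        unfolding countably_compactly_covered_def by blast
      have "countably_compactly_covered X (\<Union>K\<in>\<K>. R `` K)"
        using \<K> proper by (intro countably_compactly_covered_UN) auto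
      moreover have "(R ^^ Suc n) `` {p} \<subseteq> (\<Union>K\<in>\<K>. R `` K)" using \<K>(3) by auto
      ultimately show ?case by (rule countably_compactly_covered_subset)
    qed
    then have "countably_compactly_covered X (\<Union>n. (R ^^ n) `` {p})"
      by (intro countably_compactly_covered_UN) auto
    then show ?thesis
      by (rule countably_compactly_covered_subset) (auto simp: L_def rtrancl_power)
  qed
  from Zorn.well_ordering[where ?'a = 'a] obtain r :: "'a rel" where
    r': "Well_order r \<and> Field r = UNIV" ..
  have r: "well_order_on UNIV r" using conjunct1[OF r'] unfolding conjunct2[OF r'] .
  have wf: "wf (r - Id)" using r by (simp add: well_order_on_def)
  define Q where "Q p = L p - (\<Union>q\<in>{q \<in> topspace X. (q, p) \<in> r - Id}. L q)" for p
  have Q_clopen: "openin X (Q p) \<and> closedin X (Q p)" if p: "p \<in> topspace X" for p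
  proof -
    have "(\<Union>q\<in>{q \<in> topspace X. (q, p) \<in> r - Id}. L q) \<subseteq> topspace X"
      using L_sub by blast
    moreover have "R `` (\<Union>q\<in>{q \<in> topspace X. (q, p) \<in> r - Id}. L q) \<subseteq>
        (\<Union>q\<in>{q \<in> topspace X. (q, p) \<in> r - Id}. L q)"
      using L_R by blast
    ultimately show ?thesis
      unfolding Q_def using clopen[OF L_sub[OF p] L_R] clopen
      by (meson openin_diff closedin_diff)
  qed
  show ?thesis
  proof (rule paracompact_space_of_Lindelof_partition[OF H _ , where I = "topspace X" and Q = Q])
    show "regular_space X" using H lc by (simp add: locally_compact_Hausdorff_imp_regular_space)
    show "openin X (Q p)" if "p \<in> topspace X" for p using Q_clopen that by blast
    show "Lindelof_space (subtopology X (Q p))" if "p \<in> topspace X" for p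
      using that Q_clopen L_cov countably_compactly_covered_subset[OF L_cov, of p "Q p"]
      by (intro Lindelof_space_closed_countably_compactly_covered) (auto simp: Q_def)
    show "disjoint_family_on Q (topspace X)"
      unfolding disjoint_family_on_def
    proof (intro ballI impI)
      fix p q assume "p \<in> topspace X" "q \<in> topspace X" "p \<noteq> q"
      moreover have "(p, q) \<in> r \<or> (q, p) \<in> r"
        using r \<open>p \<noteq> q\<close> by (simp add: well_order_on_def linear_order_on_def total_on_def)
      ultimately show "Q p \<inter> Q q = {}" by (auto simp: Q_def)
    qed
    show "(\<Union>p\<in>topspace X. Q p) = topspace X"
    proof
      show "(\<Union>p\<in>topspace X. Q p) \<subseteq> topspace X" using L_sub by (auto simp: Q_def)
      show "topspace X \<subseteq> (\<Union>p\<in>topspace X. Q p)"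
      proof
        fix x assume x: "x \<in> topspace X"
        obtain p where p: "p \<in> {p \<in> topspace X. x \<in> L p}"
          and min: "\<And>q. (q, p) \<in> r - Id \<Longrightarrow> q \<notin> {p \<in> topspace X. x \<in> L p}"
          using wfE_min[OF wf, of x "{p \<in> topspace X. x \<in> L p}"] x L_p by blast
        then have "x \<in> Q p" by (auto simp: Q_def)
        then show "x \<in> (\<Union>p\<in>topspace X. Q p)" using p by blast
      qed
    qed
  qed
qed

definition proper_neighbourhood_relation_on :: "'t topology \<Rightarrow> 't set \<Rightarrow> ('t \<times> 't) set \<Rightarrow> bool" where
  "proper_neighbourhood_relation_on X H R \<longleftrightarrow> R \<subseteq> H \<times> H \<and>
     (\<forall>K. compactin X K \<longrightarrow> (\<exists>K'. compactin X K' \<and> R `` K \<subseteq> K')) \<and>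
     (\<forall>t\<in>H. \<exists>N. openin X N \<and> t \<in> N \<and> (\<forall>s\<in>N. (s, t) \<in> R \<and> (t, s) \<in> R))"

lemma compactin_meets_finitely_many:
  assumes op: "\<And>\<mu>. \<mu> \<in> M \<Longrightarrow> openin X (W \<mu>)" and disj: "disjoint_family_on W M"
    and cover: "(\<Union>\<mu>\<in>M. W \<mu>) = topspace X" and K: "compactin X K"
  shows "finite {\<mu> \<in> M. K \<inter> W \<mu> \<noteq> {}}"
proof -
  have "K \<subseteq> \<Union>(W ` M)" using compactin_subset_topspace[OF K] cover by simp
  then obtain \<F> where \<F>: "finite \<F>" "\<F> \<subseteq> W ` M" "K \<subseteq> \<Union>\<F>"
    using K op unfolding compactin_def by (metis (mono_tags, lifting) imageE)
  obtain M0 where M0: "M0 \<subseteq> M" "finite M0" "\<F> = W ` M0" using finite_subset_image[OF \<F>(1,2)] by blast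
  have "{\<mu> \<in> M. K \<inter> W \<mu> \<noteq> {}} \<subseteq> M0"
  proof clarify
    fix \<mu> s assume \<mu>: "\<mu> \<in> M" and "K \<inter> W \<mu> \<noteq> {}"
    then obtain s where s: "s \<in> K" "s \<in> W \<mu>" by blast
    then obtain \<nu> where \<nu>: "\<nu> \<in> M0" "s \<in> W \<nu>" using \<F>(3) M0(3) by blast
    then have "W \<nu> \<inter> W \<mu> \<noteq> {}" using s by blast
    then have "\<nu> = \<mu>" using disj \<nu>(1) \<mu> M0(1) by (meson disjoint_family_on_def subsetD)
    then show "\<mu> \<in> M0" using \<nu>(1) by simp
  qed
  then show ?thesis using M0(2) finite_subset by blast
qed

theorem paracompact_space_if_countable_local_relations:
  assumes H: "Hausdorff_space X" and lc: "locally_compact_space X"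
    and op: "\<And>\<mu>. \<mu> \<in> M \<Longrightarrow> openin X (W \<mu>)" and disj: "disjoint_family_on W M"
    and cover: "(\<Union>\<mu>\<in>M. W \<mu>) = topspace X"
    and local: "\<And>\<mu>. \<mu> \<in> M \<Longrightarrow> \<exists>\<V>. countable \<V> \<and> \<Union>\<V> = W \<mu> \<and>
      (\<forall>H\<in>\<V>. \<exists>R. proper_neighbourhood_relation_on X H R)"
  shows "paracompact_space X"
proof -
  obtain \<V> where \<V>: "\<And>\<mu>. \<mu> \<in> M \<Longrightarrow> countable (\<V> \<mu>)" "\<And>\<mu>. \<mu> \<in> M \<Longrightarrow> \<Union>(\<V> \<mu>) = W \<mu>"
    "\<And>\<mu> H. \<mu> \<in> M \<Longrightarrow> H \<in> \<V> \<mu> \<Longrightarrow> \<exists>R. proper_neighbourhood_relation_on X H R"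
    using local by metis
  define R where "R H = (SOME R. proper_neighbourhood_relation_on X H R)" for H
  have R: "proper_neighbourhood_relation_on X H (R H)" if "\<mu> \<in> M" "H \<in> \<V> \<mu>" for \<mu> H
    unfolding R_def using \<V>(3)[OF that] by (rule someI_ex)
  note R_sub = R[unfolded proper_neighbourhood_relation_on_def, THEN conjunct1]
    and R_proper = R[unfolded proper_neighbourhood_relation_on_def, THEN conjunct2, THEN conjunct1, rule_format]
    and R_nbhd = R[unfolded proper_neighbourhood_relation_on_def, THEN conjunct2, THEN conjunct2, rule_format]
  define S where "S = (\<Union>\<mu>\<in>M. \<Union>H\<in>\<V> \<mu>. R H)"
  have VW: "H \<subseteq> W \<mu>" if "\<mu> \<in> M" "H \<in> \<V> \<mu>" for H \<mu> using \<V>(2)[OF that(1)] that(2) by blast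
  show ?thesis
  proof (rule paracompact_space_if_proper_neighbourhood_relation[OF H lc, of S])
    show "S \<subseteq> topspace X \<times> topspace X"
      using R_sub VW op[THEN openin_subset] unfolding S_def by blast
    show "countably_compactly_covered X (S `` K)" if K: "compactin X K" for K
    proof -
      let ?F = "{\<mu> \<in> M. K \<inter> W \<mu> \<noteq> {}}"
      have "countably_compactly_covered X (\<Union>\<mu>\<in>?F. \<Union>H\<in>\<V> \<mu>. R H `` K)"
      proof (intro countably_compactly_covered_UN)
        show "countable ?F" using compactin_meets_finitely_many[OF op disj cover K] by (rule countable_finite)
        fix \<mu> assume \<mu>: "\<mu> \<in> ?F"
        then show "countable (\<V> \<mu>)" using \<V>(1) by blast
        fix H assume H: "H \<in> \<V> \<mu>"
        obtain K' where "compactin X K'" "R H `` K \<subseteq> K'" using R_proper[OF _ H K] \<mu> by blast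
        then show "countably_compactly_covered X (R H `` K)"
          by (meson countably_compactly_covered_compactin countably_compactly_covered_subset)
      qed
      moreover have "S `` K \<subseteq> (\<Union>\<mu>\<in>?F. \<Union>H\<in>\<V> \<mu>. R H `` K)"
      proof
        fix t assume "t \<in> S `` K"
        then obtain s \<mu> H where s: "s \<in> K" "\<mu> \<in> M" "H \<in> \<V> \<mu>" "(s, t) \<in> R H" by (auto simp: S_def)
        then have "s \<in> W \<mu>" using R_sub[OF s(2,3)] VW[OF s(2,3)] by blast
        then show "t \<in> (\<Union>\<mu>\<in>?F. \<Union>H\<in>\<V> \<mu>. R H `` K)" using s by blast
      qed
      ultimately show ?thesis by (rule countably_compactly_covered_subset)
    qed
    show "\<exists>N. openin X N \<and> t \<in> N \<and> (\<forall>s\<in>N. (s, t) \<in> S \<and> (t, s) \<in> S)" if "t \<in> topspace X" for t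
    proof -
      obtain \<mu> where \<mu>: "\<mu> \<in> M" "t \<in> W \<mu>" using \<open>t \<in> topspace X\<close> cover by blast
      then obtain H where H: "H \<in> \<V> \<mu>" "t \<in> H" using \<V>(2) by blast
      obtain N where "openin X N" "t \<in> N" "\<forall>s\<in>N. (s, t) \<in> R H \<and> (t, s) \<in> R H"
        using R_nbhd[OF \<mu>(1) H] by blast
      then show ?thesis using \<mu>(1) H(1) unfolding S_def by blast
    qed
  qed
qed

text \<open>
  Properness over \<open>G\<close> says nothing about a compact set that leaves \<open>G\<close>. Its trace on the closure
  of \<open>H\<close>, however, is a compact subset of \<open>G\<close>.
\<close>

lemma proper_neighbourhood_relation_on_restrict:
  assumes H: "openin X H" "X closure_of H \<subseteq> G"
    and proper: "\<And>K. compactin X K \<Longrightarrow> K \<subseteq> G \<Longrightarrow> \<exists>K'. compactin X K' \<and> R `` K \<subseteq> K'"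
    and nbhd: "\<And>t. t \<in> G \<Longrightarrow> \<exists>N. openin X N \<and> t \<in> N \<and> (\<forall>s\<in>N. (s, t) \<in> R \<and> (t, s) \<in> R)"
  shows "proper_neighbourhood_relation_on X H (R \<inter> H \<times> H)"
  unfolding proper_neighbourhood_relation_on_def
proof (intro conjI allI impI ballI)
  have HX: "H \<subseteq> X closure_of H" using closure_of_subset[OF openin_subset[OF H(1)]] .
  show "R \<inter> H \<times> H \<subseteq> H \<times> H" by blast
  show "\<exists>K'. compactin X K' \<and> (R \<inter> H \<times> H) `` K \<subseteq> K'" if "compactin X K" for K
  proof -
    have "compactin X (X closure_of H \<inter> K)" using that closedin_closure_of by (rule closed_Int_compactin[rotated])
    then obtain K' where "compactin X K'" "R `` (X closure_of H \<inter> K) \<subseteq> K'" using proper H(2) by blast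
    then show ?thesis using HX by blast
  qed
  show "\<exists>N. openin X N \<and> t \<in> N \<and> (\<forall>s\<in>N. (s, t) \<in> R \<inter> H \<times> H \<and> (t, s) \<in> R \<inter> H \<times> H)" if t: "t \<in> H" for t
  proof -
    obtain N where "openin X N" "t \<in> N" "\<forall>s\<in>N. (s, t) \<in> R \<and> (t, s) \<in> R" using nbhd[of t] t HX H(2) by blast
    then show ?thesis using H(1) t by (intro exI[of _ "N \<inter> H"]) auto
  qed
qed

section \<open>Families in Banach spaces with the supremum norm\<close>

context banach_space
begin

lemma scale_vzero: "vscale E c (vzero E) = vzero E"
  by (metis scale_scale scale_zero zero_closed mult_zero_right)

lemma norm_le_vdist_add:
  assumes "x \<in> vcarrier E" "y \<in> vcarrier E"
  shows "vnorm E x \<le> vdist E x y + vnorm E y"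
proof -
  have "vadd E (vadd E x (vscale E (-1) y)) y = x"
    using assms by (metis add_assoc add_commute add_neg add_zero scale_closed)
  then show ?thesis
    using norm_triangle[of "vadd E x (vscale E (-1) y)" y] assms
    by (simp add: vdist_eq add_closed scale_closed)
qed

lemma norm_diff_le: "x \<in> vcarrier E \<Longrightarrow> y \<in> vcarrier E \<Longrightarrow> \<bar>vnorm E x - vnorm E y\<bar> \<le> vdist E x y"
  using norm_le_vdist_add[of x y] norm_le_vdist_add[of y x] metric.commute[of x y] by linarith

end

lemma linear_map_vdist:
  assumes "banach_space E" "banach_space F" "linear_map E F T"
    and "\<And>x. x \<in> vcarrier E \<Longrightarrow> vnorm F (T x) = vnorm E x"
    and "x \<in> vcarrier E" "y \<in> vcarrier E"
  shows "vdist F (T x) (T y) = vdist E x y"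
proof -
  interpret E: banach_space E by fact
  interpret F: banach_space F by fact
  have T: "T x \<in> vcarrier F" "T y \<in> vcarrier F"
    "T (vadd E x (vscale E (-1) y)) = vadd F (T x) (vscale F (-1) (T y))"
    using assms(3,5,6) by (simp_all add: linear_map_def E.scale_closed)
  have "vdist F (T x) (T y) = vnorm F (T (vadd E x (vscale E (-1) y)))"
    using T by (simp add: F.vdist_eq)
  then show ?thesis
    using assms(4-6) by (simp add: E.vdist_eq E.add_closed E.scale_closed)
qed

lemma (in banach_algebra) norm_mult_diff:
  assumes "a \<in> vcarrier A" "x \<in> vcarrier A" "y \<in> vcarrier A"
  shows "vdist A (amult A a x) (amult A a y) \<le> vnorm A a * vdist A x y"
proof -
  have "vadd A (amult A a x) (vscale A (-1) (amult A a y)) = amult A a (vadd A x (vscale A (-1) y))"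
    using assms by (simp add: mult_add_right mult_scale_right scale_closed)
  then show ?thesis
    using assms norm_mult[of a "vadd A x (vscale A (-1) y)"]
    by (simp add: vdist_eq mult_closed add_closed scale_closed)
qed

lemma (in banach_algebra) mult_vzero: 
  assumes "x \<in> vcarrier A"
  shows "amult A x (vzero A) = vzero A" "amult A (vzero A) x = vzero A"
  using mult_scale_right[of x "vzero A" 0] mult_scale_left[of "vzero A" x 0] assms
  by (simp_all add: scale_zero zero_closed mult_closed)

definition bounded_family :: "'i set \<Rightarrow> ('i \<Rightarrow> ('a, 'z) nspace_scheme) \<Rightarrow> ('i \<Rightarrow> 'a) \<Rightarrow> bool" where
  "bounded_family I E x \<longleftrightarrow> (\<exists>c. \<forall>i\<in>I. vnorm (E i) (x i) \<le> c)"

text \<open>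
  A common frame for the algebra of a field and for the two modules to which projectivity is
  applied below: families indexed by \<open>I\<close> with pointwise operations and the supremum norm. The
  last assumption, closure under uniform limits, is what gives completeness. As in
  \<^const>\<open>field_algebra\<close>, the inserted 0 only matters for empty \<open>I\<close>.
\<close>

locale sup_normed_family =
  fixes I :: "'i set" and E :: "'i \<Rightarrow> ('a, 'y) nspace_scheme" and F :: "('i \<Rightarrow> 'a, 'z) nspace_scheme"
  assumes fibre: "i \<in> I \<Longrightarrow> banach_space (E i)"
    and subset: "x \<in> vcarrier F \<Longrightarrow> x \<in> (\<Pi>\<^sub>E i\<in>I. vcarrier (E i))"
    and bounded: "x \<in> vcarrier F \<Longrightarrow> bounded_family I E x"
    and vadd_def: "vadd F = (\<lambda>x y. \<lambda>i\<in>I. vadd (E i) (x i) (y i))"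
    and vscale_def: "vscale F = (\<lambda>c x. \<lambda>i\<in>I. vscale (E i) c (x i))"
    and vzero_def: "vzero F = (\<lambda>i\<in>I. vzero (E i))"
    and vnorm_def: "vnorm F = (\<lambda>x. Sup (insert 0 ((\<lambda>i. vnorm (E i) (x i)) ` I)))"
    and zero_mem: "vzero F \<in> vcarrier F"
    and add_mem: "\<lbrakk>x \<in> vcarrier F; y \<in> vcarrier F\<rbrakk> \<Longrightarrow> vadd F x y \<in> vcarrier F"
    and scale_mem: "x \<in> vcarrier F \<Longrightarrow> vscale F c x \<in> vcarrier F"
    and limit_mem: "\<lbrakk>x \<in> (\<Pi>\<^sub>E i\<in>I. vcarrier (E i)); bounded_family I E x;
      \<And>e. e > 0 \<Longrightarrow> \<exists>y\<in>vcarrier F. \<forall>i\<in>I. vdist (E i) (x i) (y i) \<le> e\<rbrakk> \<Longrightarrow> x \<in> vcarrier F"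
begin

lemma mem: "x \<in> vcarrier F \<Longrightarrow> i \<in> I \<Longrightarrow> x i \<in> vcarrier (E i)"
  using subset by blast

lemma norm_le: "x \<in> vcarrier F \<Longrightarrow> i \<in> I \<Longrightarrow> vnorm (E i) (x i) \<le> vnorm F x"
proof -
  assume x: "x \<in> vcarrier F" "i \<in> I"
  obtain c where "\<And>i. i \<in> I \<Longrightarrow> vnorm (E i) (x i) \<le> c"
    using bounded[OF x(1)] unfolding bounded_family_def by blast
  then have "bdd_above (insert 0 ((\<lambda>i. vnorm (E i) (x i)) ` I))"
    by (intro bdd_above_insert[THEN iffD2] bdd_aboveI2[where M = c])
  then show "vnorm (E i) (x i) \<le> vnorm F x"
    unfolding vnorm_def using x by (intro cSup_upper) auto
qed

lemma norm_le_iff: "x \<in> vcarrier F \<Longrightarrow> vnorm F x \<le> c \<longleftrightarrow> 0 \<le> c \<and> (\<forall>i\<in>I. vnorm (E i) (x i) \<le> c)"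
proof -
  assume x: "x \<in> vcarrier F"
  obtain b where "\<And>i. i \<in> I \<Longrightarrow> vnorm (E i) (x i) \<le> b"
    using bounded[OF x(1)] unfolding bounded_family_def by blast
  then have "bdd_above (insert 0 ((\<lambda>i. vnorm (E i) (x i)) ` I))"
    by (intro bdd_above_insert[THEN iffD2] bdd_aboveI2[where M = b])
  then show ?thesis
    unfolding vnorm_def by (subst cSup_le_iff) auto
qed

lemma norm_nonneg: "x \<in> vcarrier F \<Longrightarrow> 0 \<le> vnorm F x"
  using norm_le_iff[of x "vnorm F x"] by simp

lemma mem_eqI: "\<lbrakk>x \<in> vcarrier F; y \<in> vcarrier F; \<And>i. i \<in> I \<Longrightarrow> x i = y i\<rbrakk> \<Longrightarrow> x = y"
  using subset by (metis PiE_ext)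

lemma apply_simps:
  "i \<in> I \<Longrightarrow> vadd F x y i = vadd (E i) (x i) (y i)"
  "i \<in> I \<Longrightarrow> vscale F c x i = vscale (E i) c (x i)"
  "i \<in> I \<Longrightarrow> vzero F i = vzero (E i)"
  by (simp_all add: vadd_def vscale_def vzero_def)

lemma vdist_le_iff:
  assumes "x \<in> vcarrier F" "y \<in> vcarrier F"
  shows "vdist F x y \<le> c \<longleftrightarrow> 0 \<le> c \<and> (\<forall>i\<in>I. vdist (E i) (x i) (y i) \<le> c)"
  using assms norm_le_iff[of "vadd F x (vscale F (-1) y)" c]
  by (simp add: vdist_def add_mem scale_mem apply_simps mem)

sublocale metric: Metric_space "vcarrier F" "vdist F"
proof
  have nonneg: "0 \<le> vdist F x y" for x y
    by (simp add: vdist_def norm_nonneg add_mem scale_mem)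
  then show "0 \<le> vdist F x y" for x y .
  have le_commute: "vdist F y x \<le> vdist F x y" for x y
  proof (cases "x \<in> vcarrier F \<and> y \<in> vcarrier F")
    case True
    have "vdist (E i) (x i) (y i) = vdist (E i) (y i) (x i)" if "i \<in> I" for i
    proof -
      interpret banach_space "E i" by (rule fibre[OF that])
      show ?thesis by (rule metric.commute)
    qed
    then show ?thesis
      using True vdist_le_iff[of x y "vdist F x y"] vdist_le_iff[of y x "vdist F x y"] by simp
  qed (auto simp: vdist_def)
  then show "vdist F x y = vdist F y x" for x y
    by (intro antisym)
  show "(vdist F x y = 0) = (x = y)" if xy: "x \<in> vcarrier F" "y \<in> vcarrier F" for x y
  proof -
    have "vdist F x y = 0 \<longleftrightarrow> (\<forall>i\<in>I. vdist (E i) (x i) (y i) \<le> 0)"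
      using vdist_le_iff[OF xy, of 0] nonneg[of x y] by auto
    also have "\<dots> \<longleftrightarrow> (\<forall>i\<in>I. x i = y i)"
    proof (intro ball_cong refl)
      fix i assume i: "i \<in> I"
      interpret banach_space "E i" by (rule fibre[OF i])
      show "vdist (E i) (x i) (y i) \<le> 0 \<longleftrightarrow> x i = y i"
        using metric.zero[OF mem[OF xy(1) i] mem[OF xy(2) i]] metric.nonneg[of "x i" "y i"] by linarith
    qed
    also have "\<dots> \<longleftrightarrow> x = y" using mem_eqI[OF xy] by blast
    finally show ?thesis .
  qed
  show "vdist F x z \<le> vdist F x y + vdist F y z"
    if xyz: "x \<in> vcarrier F" "y \<in> vcarrier F" "z \<in> vcarrier F" for x y z
  proof -
    have "vdist (E i) (x i) (z i) \<le> vdist F x y + vdist F y z" if i: "i \<in> I" for i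
    proof -
      interpret banach_space "E i" by (rule fibre[OF i])
      have "vdist (E i) (x i) (z i) \<le> vdist (E i) (x i) (y i) + vdist (E i) (y i) (z i)"
        using xyz i mem by (intro metric.triangle)
      also have "\<dots> \<le> vdist F x y + vdist F y z"
        using vdist_le_iff[of x y "vdist F x y"] vdist_le_iff[of y z "vdist F y z"] xyz i
        by (intro add_mono) auto
      finally show ?thesis .
    qed
    then show ?thesis using xyz nonneg by (simp add: vdist_le_iff)
  qed
qed

lemma vdist_fibre_le:
  "x \<in> vcarrier F \<Longrightarrow> y \<in> vcarrier F \<Longrightarrow> i \<in> I \<Longrightarrow> vdist (E i) (x i) (y i) \<le> vdist F x y"
  using vdist_le_iff[of x y "vdist F x y"] by simp

lemma mcomplete: "metric.mcomplete"
  unfolding metric.mcomplete_def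
proof (intro allI impI)
  fix \<sigma> assume \<sigma>: "metric.MCauchy \<sigma>"
  then have \<sigma>F: "\<sigma> n \<in> vcarrier F" for n by (auto simp: metric.MCauchy_def)
  have cauchy: "\<exists>N. \<forall>n\<ge>N. \<forall>m\<ge>N. vdist F (\<sigma> n) (\<sigma> m) < e" if "e > 0" for e
    using \<sigma> that unfolding metric.MCauchy_def by meson
  have lim: "\<exists>l. l \<in> vcarrier (E i) \<and> (\<forall>e>0. \<exists>N. \<forall>n\<ge>N. vdist (E i) (\<sigma> n i) l < e)" if i: "i \<in> I" for i
  proof -
    interpret E: banach_space "E i" by (rule fibre[OF i])
    have "E.metric.MCauchy (\<lambda>n. \<sigma> n i)"
      unfolding E.metric.MCauchy_def
    proof (intro conjI allI impI)
      show "range (\<lambda>n. \<sigma> n i) \<subseteq> vcarrier (E i)" using mem[OF \<sigma>F i] by blast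
      fix e :: real assume "e > 0"
      then obtain N where "\<forall>n\<ge>N. \<forall>m\<ge>N. vdist F (\<sigma> n) (\<sigma> m) < e" using cauchy by blast
      then show "\<exists>N. \<forall>n n'. N \<le> n \<longrightarrow> N \<le> n' \<longrightarrow> vdist (E i) (\<sigma> n i) (\<sigma> n' i) < e"
        using vdist_fibre_le[OF \<sigma>F \<sigma>F i] by (meson le_less_trans)
    qed
    then obtain l where "limitin E.metric.mtopology (\<lambda>n. \<sigma> n i) l sequentially"
      using E.complete by (auto simp: E.metric.mcomplete_def)
    then show ?thesis unfolding E.metric.limit_metric_sequentially by (intro exI[of _ l]) meson
  qed
  then have "\<forall>i\<in>I. \<exists>l. l \<in> vcarrier (E i) \<and> (\<forall>e>0. \<exists>N. \<forall>n\<ge>N. vdist (E i) (\<sigma> n i) l < e)" by blast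
  from bchoice[OF this] obtain l' where l':
    "\<forall>i\<in>I. l' i \<in> vcarrier (E i) \<and> (\<forall>e>0. \<exists>N. \<forall>n\<ge>N. vdist (E i) (\<sigma> n i) (l' i) < e)" ..
  define l where "l = restrict l' I"
  have l: "l i \<in> vcarrier (E i)" "\<And>e. e > 0 \<Longrightarrow> \<exists>N. \<forall>n\<ge>N. vdist (E i) (\<sigma> n i) (l i) < e" if "i \<in> I" for i
    using l' that by (auto simp: l_def)
  have l_PiE: "l \<in> (\<Pi>\<^sub>E i\<in>I. vcarrier (E i))" using l by (auto simp: l_def)
  have uniform: "\<exists>N. \<forall>n\<ge>N. \<forall>i\<in>I. vdist (E i) (l i) (\<sigma> n i) \<le> e" if "e > 0" for e
  proof -
    obtain N where N: "\<forall>n\<ge>N. \<forall>m\<ge>N. vdist F (\<sigma> n) (\<sigma> m) < e / 2" using cauchy[of "e / 2"] \<open>e > 0\<close> by auto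
    have "vdist (E i) (l i) (\<sigma> n i) \<le> e" if n: "n \<ge> N" and i: "i \<in> I" for n i
    proof -
      interpret E: banach_space "E i" by (rule fibre[OF i])
      obtain M where M: "\<forall>m\<ge>M. vdist (E i) (\<sigma> m i) (l i) < e / 2" using l(2)[OF i, of "e / 2"] \<open>e > 0\<close> by auto
      define m where "m = max M N"
      have "vdist (E i) (l i) (\<sigma> n i) \<le> vdist (E i) (l i) (\<sigma> m i) + vdist (E i) (\<sigma> m i) (\<sigma> n i)"
        using l(1) mem[OF \<sigma>F] i by (intro E.metric.triangle)
      moreover have "vdist (E i) (\<sigma> m i) (\<sigma> n i) \<le> vdist F (\<sigma> m) (\<sigma> n)" using \<sigma>F i by (intro vdist_fibre_le)
      moreover have "vdist F (\<sigma> m) (\<sigma> n) < e / 2" using N n by (simp add: m_def)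
      moreover have "vdist (E i) (l i) (\<sigma> m i) < e / 2" using M by (simp add: m_def E.metric.commute)
      ultimately show ?thesis by linarith
    qed
    then show ?thesis by blast
  qed
  have l_bounded: "bounded_family I E l"
  proof -
    obtain N where N: "\<forall>n\<ge>N. \<forall>i\<in>I. vdist (E i) (l i) (\<sigma> n i) \<le> 1" using uniform[of 1] by auto
    have "vnorm (E i) (l i) \<le> 1 + vnorm F (\<sigma> N)" if i: "i \<in> I" for i
      using banach_space.norm_le_vdist_add[OF fibre[OF i] l(1)[OF i] mem[OF \<sigma>F i], of N]
        N norm_le[OF \<sigma>F i, of N] i by force
    then show ?thesis unfolding bounded_family_def by blast
  qed
  have lF: "l \<in> vcarrier F"
  proof (rule limit_mem[OF l_PiE l_bounded])
    fix e :: real assume "e > 0"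
    then show "\<exists>y\<in>vcarrier F. \<forall>i\<in>I. vdist (E i) (l i) (y i) \<le> e"
      using uniform[of e] \<sigma>F by blast
  qed
  have "\<exists>N. \<forall>n\<ge>N. vdist F (\<sigma> n) l < e" if "e > 0" for e
  proof -
    obtain N where N: "\<forall>n\<ge>N. \<forall>i\<in>I. vdist (E i) (l i) (\<sigma> n i) \<le> e / 2"
      using uniform[of "e / 2"] \<open>e > 0\<close> by auto
    have "vdist F l (\<sigma> n) \<le> e / 2" if "n \<ge> N" for n
      unfolding vdist_le_iff[OF lF \<sigma>F] using that N \<open>e > 0\<close> by simp
    then show ?thesis using \<open>e > 0\<close> by (intro exI[of _ N]) (force simp: metric.commute[of _ l])
  qed
  then have "limitin metric.mtopology \<sigma> l sequentially"
    unfolding metric.limit_metric_sequentially using lF \<sigma>F by blast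
  then show "\<exists>x. limitin metric.mtopology \<sigma> x sequentially" by blast
qed

theorem banach_space: "banach_space F"
proof
  fix x y z :: "'i \<Rightarrow> 'a" and c d :: complex
  show "vzero F \<in> vcarrier F" by (rule zero_mem)
  show "metric.mcomplete" by (rule mcomplete)
  assume x: "x \<in> vcarrier F"
  then show "vscale F c x \<in> vcarrier F" by (rule scale_mem)
  note [simp] = add_mem scale_mem zero_mem apply_simps
  show "vadd F x (vzero F) = x"
    using x by (intro mem_eqI) (simp_all add: banach_space.add_zero[OF fibre] mem)
  show "\<exists>y\<in>vcarrier F. vadd F x y = vzero F"
    using x by (intro bexI[of _ "vscale F (-1) x"] mem_eqI) (simp_all add: banach_space.add_neg[OF fibre] mem)
  show "vscale F (c + d) x = vadd F (vscale F c x) (vscale F d x)"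
    using x by (intro mem_eqI) (simp_all add: banach_space.scale_add_left[OF fibre] mem)
  show "vscale F c (vscale F d x) = vscale F (c * d) x"
    using x by (intro mem_eqI) (simp_all add: banach_space.scale_scale[OF fibre] mem)
  show "vscale F 1 x = x"
    using x by (intro mem_eqI) (simp_all add: banach_space.scale_one[OF fibre] mem)
  show "0 \<le> vnorm F x" using x by (rule norm_nonneg)
  show "vnorm F x = 0 \<longleftrightarrow> x = vzero F"
  proof
    assume "vnorm F x = 0"
    then have "vnorm (E i) (x i) = 0" if "i \<in> I" for i
      using norm_le[OF x that] banach_space.norm_nonneg[OF fibre[OF that] mem[OF x that]] by simp
    then show "x = vzero F"
      using x by (intro mem_eqI) (simp_all add: mem banach_space.norm_eq_zero[OF fibre])
  next
    assume "x = vzero F"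
    then have "vnorm F x \<le> 0"
      using x by (simp add: norm_le_iff banach_space.norm_zero[OF fibre])
    then show "vnorm F x = 0" using norm_nonneg[OF x] by simp
  qed
  show "vnorm F (vscale F c x) = cmod c * vnorm F x"
  proof -
    have le: "vnorm F (vscale F c x) \<le> cmod c * vnorm F x" if x: "x \<in> vcarrier F" for c x
      using x norm_le[OF x] norm_nonneg[OF x]
      by (simp add: norm_le_iff banach_space.norm_scale[OF fibre] mem mult_left_mono)
    show ?thesis
    proof (cases "c = 0")
      case True
      then show ?thesis using le[OF x, of c] norm_nonneg[of "vscale F c x"] x by simp
    next
      case False
      have "vscale F (1 / c) (vscale F c x) = x"
        using x False by (intro mem_eqI)
          (simp_all add: banach_space.scale_scale[OF fibre] banach_space.scale_one[OF fibre] mem)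
      then have "vnorm F x \<le> cmod (1 / c) * vnorm F (vscale F c x)"
        using le[of "vscale F c x" "1 / c"] x by simp
      then have "cmod c * vnorm F x \<le> vnorm F (vscale F c x)"
        using False by (simp add: norm_divide field_simps)
      then show ?thesis using le[OF x, of c] by simp
    qed
  qed
  assume y: "y \<in> vcarrier F"
  show "vadd F x y \<in> vcarrier F" using x y by simp
  show "vadd F x y = vadd F y x"
    using x y by (intro mem_eqI) (simp_all add: banach_space.add_commute[OF fibre] mem)
  show "vscale F c (vadd F x y) = vadd F (vscale F c x) (vscale F c y)"
    using x y by (intro mem_eqI) (simp_all add: banach_space.scale_add_right[OF fibre] mem)
  show "vnorm F (vadd F x y) \<le> vnorm F x + vnorm F y"
  proof -
    have "vnorm (E i) (vadd (E i) (x i) (y i)) \<le> vnorm F x + vnorm F y" if i: "i \<in> I" for i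
      using banach_space.norm_triangle[OF fibre[OF i] mem[OF x i] mem[OF y i]] norm_le[OF x i]
        norm_le[OF y i] by linarith
    then show ?thesis using x y norm_nonneg by (simp add: norm_le_iff)
  qed
  assume z: "z \<in> vcarrier F"
  show "vadd F (vadd F x y) z = vadd F x (vadd F y z)"
    using x y z by (intro mem_eqI) (simp_all add: banach_space.add_assoc[OF fibre] mem)
qed

end

section \<open>Bounded functionals\<close>

context banach_space
begin

definition sublinear :: "('a \<Rightarrow> real) \<Rightarrow> bool" where
  "sublinear p \<longleftrightarrow>
     (\<forall>x\<in>vcarrier E. \<forall>y\<in>vcarrier E. p (vadd E x y) \<le> p x + p y) \<and>
     (\<forall>c>0. \<forall>x\<in>vcarrier E. p (vscale E (complex_of_real c) x) \<le> c * p x)"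

lemma sublinear_add:
  "\<lbrakk>sublinear p; x \<in> vcarrier E; y \<in> vcarrier E\<rbrakk> \<Longrightarrow> p (vadd E x y) \<le> p x + p y"
  by (simp add: sublinear_def)

lemma sublinear_scale_le:
  "\<lbrakk>sublinear p; x \<in> vcarrier E; c > 0\<rbrakk> \<Longrightarrow> p (vscale E (complex_of_real c) x) \<le> c * p x"
  by (simp add: sublinear_def)

lemma sublinear_zero: "sublinear p \<Longrightarrow> p (vzero E) = 0"
proof -
  assume p: "sublinear p"
  have "vscale E c (vzero E) = vzero E" for c
    by (metis scale_scale scale_zero zero_closed mult_zero_right)
  then show ?thesis
    using sublinear_scale_le[OF p zero_closed, of 2] sublinear_scale_le[OF p zero_closed, of "1/2"]
    by simp
qed

lemma sublinear_scale:
  assumes p: "sublinear p" and x: "x \<in> vcarrier E" and c: "c \<ge> 0"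
  shows "p (vscale E (complex_of_real c) x) = c * p x"
proof (cases "c = 0")
  case True
  then show ?thesis using sublinear_zero[OF p] x by (simp add: scale_zero)
next
  case False
  then have "c > 0" using c by simp
  have "vscale E (complex_of_real (1 / c)) (vscale E (complex_of_real c) x) = x"
    using x False by (simp add: scale_scale scale_one)
  then have "p x \<le> 1 / c * p (vscale E (complex_of_real c) x)"
    using sublinear_scale_le[OF p scale_closed[OF x], of "1 / c" "complex_of_real c"] \<open>c > 0\<close> by simp
  then have "c * p x \<le> p (vscale E (complex_of_real c) x)"
    using \<open>c > 0\<close> by (simp add: field_simps)
  then show ?thesis using sublinear_scale_le[OF p x \<open>c > 0\<close>] by simp
qed

lemma sublinear_neg_ge:
  assumes p: "sublinear p" and x: "x \<in> vcarrier E"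
  shows "- p (vscale E (-1) x) \<le> p x"
  using sublinear_add[OF p x scale_closed[OF x], of "-1"] sublinear_zero[OF p] add_neg[OF x] by simp

lemma sublinear_norm: "sublinear (vnorm E)"
  by (simp add: sublinear_def norm_triangle norm_scale)

text \<open>
  For sublinear \<open>p\<close> the term under the infimum does not increase with \<open>t\<close>, so this is its limit
  for \<open>t \<rightarrow> \<infinity>\<close>: the functional \<open>p\<close>, made additive in the direction \<open>a\<close>. It is again sublinear, and
  below \<open>p\<close>. A minimal sublinear functional therefore coincides with it for every \<open>a\<close>, that is,
  it is additive.
\<close>

definition directional :: "('a \<Rightarrow> real) \<Rightarrow> 'a \<Rightarrow> 'a \<Rightarrow> real" where
  "directional p a x = (INF t\<in>{0..}. p (vadd E x (vscale E (complex_of_real t) a)) - t * p a)"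

lemma directional_bdd_below:
  assumes p: "sublinear p" and a: "a \<in> vcarrier E" and x: "x \<in> vcarrier E"
  shows "bdd_below ((\<lambda>t. p (vadd E x (vscale E (complex_of_real t) a)) - t * p a) ` {0..})"
proof (rule bdd_belowI2)
  fix t :: real assume "t \<in> {0..}"
  let ?ta = "vscale E (complex_of_real t) a"
  have cl: "?ta \<in> vcarrier E" "vscale E (-1) x \<in> vcarrier E" using a x by (simp_all add: scale_closed)
  have "vadd E (vadd E x ?ta) (vscale E (-1) x) = vadd E ?ta (vadd E x (vscale E (-1) x))"
    using cl x by (simp add: vadd_ac add_closed)
  also have "\<dots> = ?ta" using x cl by (simp add: add_neg add_zero)
  finally have "p ?ta \<le> p (vadd E x ?ta) + p (vscale E (-1) x)"
    using sublinear_add[OF p add_closed[OF x cl(1)] cl(2)] by simp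
  then show "- p (vscale E (-1) x) \<le> p (vadd E x ?ta) - t * p a"
    using sublinear_scale[OF p a] \<open>t \<in> {0..}\<close> by simp
qed

lemma directional_le:
  assumes p: "sublinear p" and a: "a \<in> vcarrier E" and x: "x \<in> vcarrier E" and t: "t \<ge> 0"
  shows "directional p a x \<le> p (vadd E x (vscale E (complex_of_real t) a)) - t * p a"
  unfolding directional_def
  by (rule cINF_lower[OF directional_bdd_below[OF p a x]]) (use t in simp)

lemma directional_greatest:
  assumes "\<And>t. t \<ge> 0 \<Longrightarrow> c \<le> p (vadd E x (vscale E (complex_of_real t) a)) - t * p a"
  shows "c \<le> directional p a x"
  unfolding directional_def by (rule cINF_greatest) (use assms in auto)

lemma sublinear_directional:
  assumes p: "sublinear p" and a: "a \<in> vcarrier E"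
  shows "sublinear (directional p a)"
  unfolding sublinear_def
proof (intro conjI ballI allI impI)
  let ?s = "\<lambda>t. vscale E (complex_of_real t) a"
  have s: "?s t \<in> vcarrier E" for t using a by (rule scale_closed)
  fix x assume x: "x \<in> vcarrier E"
  show "directional p a (vadd E x y) \<le> directional p a x + directional p a y" if y: "y \<in> vcarrier E" for y
  proof -
    have *: "directional p a (vadd E x y) \<le>
        (p (vadd E x (?s t)) - t * p a) + (p (vadd E y (?s u)) - u * p a)" if "t \<ge> 0" "u \<ge> 0" for t u
    proof -
      have "vadd E (vadd E x y) (?s (t + u)) = vadd E (vadd E x (?s t)) (vadd E y (?s u))"
        using x y s a by (simp add: scale_add_left vadd_ac add_closed)
      then have "p (vadd E (vadd E x y) (?s (t + u))) \<le> p (vadd E x (?s t)) + p (vadd E y (?s u))"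
        using sublinear_add[OF p add_closed[OF x s[of t]] add_closed[OF y s[of u]]] by simp
      then show ?thesis
        using directional_le[OF p a add_closed[OF x y], of "t + u"] that by (simp add: algebra_simps)
    qed
    have "directional p a (vadd E x y) - (p (vadd E x (?s t)) - t * p a) \<le> directional p a y" if "t \<ge> 0" for t
      using *[OF that] by (intro directional_greatest) (simp add: algebra_simps)
    then have "directional p a (vadd E x y) - directional p a y \<le> directional p a x"
      by (intro directional_greatest) (simp add: algebra_simps)
    then show ?thesis by simp
  qed
  fix c :: real assume c: "c > 0"
  have "directional p a (vscale E (complex_of_real c) x) / c \<le> directional p a x"
  proof (rule directional_greatest)
    fix t :: real assume t: "t \<ge> 0"
    have "vadd E (vscale E (complex_of_real c) x) (?s (c * t)) = vscale E (complex_of_real c) (vadd E x (?s t))"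
      using x a s by (simp add: scale_add_right scale_scale)
    then have "p (vadd E (vscale E (complex_of_real c) x) (?s (c * t))) \<le> c * p (vadd E x (?s t))"
      using sublinear_scale_le[OF p add_closed[OF x s] c] by simp
    then have "directional p a (vscale E (complex_of_real c) x) \<le> c * (p (vadd E x (?s t)) - t * p a)"
      using directional_le[OF p a scale_closed[OF x], of "c * t" "complex_of_real c"] c t
      by (simp add: algebra_simps)
    then show "directional p a (vscale E (complex_of_real c) x) / c \<le> p (vadd E x (?s t)) - t * p a"
      using c by (simp add: field_simps)
  qed
  then show "directional p a (vscale E (complex_of_real c) x) \<le> c * directional p a x"
    using c by (simp add: field_simps)
qed

lemma directional_le_self:
  assumes "sublinear p" "a \<in> vcarrier E" "x \<in> vcarrier E"
  shows "directional p a x \<le> p x"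
  using directional_le[OF assms, of 0] assms by (simp add: scale_zero add_zero)

text \<open>
  By Zorn's lemma: the pointwise infimum of a chain of sublinear functionals is sublinear, and it
  is finite, since a sublinear functional below \<open>p\<close> is at least \<open>- p (- x)\<close> at \<open>x\<close>.
\<close>

lemma exists_minimal_sublinear:
  assumes p: "sublinear p"
  shows "\<exists>q. sublinear q \<and> (\<forall>x\<in>vcarrier E. q x \<le> p x) \<and>
    (\<forall>r. sublinear r \<longrightarrow> (\<forall>x\<in>vcarrier E. r x \<le> q x) \<longrightarrow> (\<forall>x\<in>vcarrier E. r x = q x))"
proof -
  define A where "A = {q \<in> extensional (vcarrier E). sublinear q \<and> (\<forall>x\<in>vcarrier E. q x \<le> p x)}"
  define P where "P q r \<longleftrightarrow> (\<forall>x\<in>vcarrier E. r x \<le> q x)" for q r :: "'a \<Rightarrow> real"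
  have sub_cong: "sublinear r" if "sublinear q" "\<And>x. x \<in> vcarrier E \<Longrightarrow> r x = q x" for q r
    using that by (simp add: sublinear_def add_closed scale_closed)
  have "partial_order_on A (relation_of P A)"
  proof (rule partial_order_on_relation_ofI)
    show "P q q" for q by (simp add: P_def)
    show "P q s" if "P q r" "P r s" for q r s using that by (force simp: P_def)
    show "q = r" if "q \<in> A" "r \<in> A" "P q r" "P r q" for q r
    proof (rule extensionalityI)
      show "q \<in> extensional (vcarrier E)" "r \<in> extensional (vcarrier E)" using that by (auto simp: A_def)
      show "q x = r x" if "x \<in> vcarrier E" for x
        using \<open>P q r\<close> \<open>P r q\<close> that by (auto simp: P_def intro: antisym)
    qed
  qed
  moreover have "\<exists>u\<in>A. \<forall>q\<in>C. P q u" if C: "C \<in> Chains (relation_of P A)" for C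
  proof (cases "C = {}")
    case True
    have "restrict p (vcarrier E) \<in> A"
      using p by (auto simp: A_def intro: sub_cong)
    then show ?thesis using True by blast
  next
    case False
    have CA: "q \<in> A" if "q \<in> C" for q using C that by (auto simp: Chains_def relation_of_def)
    have lin: "P q r \<or> P r q" if "q \<in> C" "r \<in> C" for q r
      using C that by (auto simp: Chains_def relation_of_def)
    define u where "u = restrict (\<lambda>x. INF q\<in>C. q x) (vcarrier E)"
    have low: "- p (vscale E (-1) x) \<le> q x" if "q \<in> C" "x \<in> vcarrier E" for q x
    proof -
      have q: "sublinear q" "q (vscale E (-1) x) \<le> p (vscale E (-1) x)"
        using CA[OF that(1)] scale_closed[OF that(2)] by (auto simp: A_def)
      then show ?thesis using sublinear_neg_ge[OF q(1) that(2)] by linarith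
    qed
    have u_le: "u x \<le> q x" if "q \<in> C" "x \<in> vcarrier E" for q x
      using that low by (auto simp: u_def intro!: cINF_lower bdd_belowI2)
    have u_ge: "c \<le> u x" if "\<And>q. q \<in> C \<Longrightarrow> c \<le> q x" "x \<in> vcarrier E" for c x
      using that False by (auto simp: u_def intro!: cINF_greatest)
    have "sublinear u"
      unfolding sublinear_def
    proof (intro conjI ballI allI impI)
      fix x assume x: "x \<in> vcarrier E"
      show "u (vadd E x y) \<le> u x + u y" if y: "y \<in> vcarrier E" for y
      proof -
        have *: "u (vadd E x y) \<le> q x + r y" if qr: "q \<in> C" "r \<in> C" for q r
        proof -
          obtain s where s: "s \<in> C" "s x \<le> q x" "s y \<le> r y"
            using lin[OF qr] qr x y unfolding P_def by blast
          have "u (vadd E x y) \<le> s (vadd E x y)" using u_le[OF s(1)] x y by (simp add: add_closed)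
          also have "\<dots> \<le> s x + s y" using CA[OF s(1)] x y by (auto simp: A_def intro: sublinear_add)
          finally show ?thesis using s by linarith
        qed
        have "u (vadd E x y) - q x \<le> u y" if "q \<in> C" for q
          using *[OF that] y by (intro u_ge) (auto simp: algebra_simps)
        then have "u (vadd E x y) - u y \<le> u x"
          using x by (intro u_ge) (auto simp: algebra_simps)
        then show ?thesis by simp
      qed
      fix c :: real assume c: "c > 0"
      have "u (vscale E (complex_of_real c) x) / c \<le> u x"
      proof (rule u_ge[OF _ x])
        fix q assume q: "q \<in> C"
        have "u (vscale E (complex_of_real c) x) \<le> q (vscale E (complex_of_real c) x)"
          using u_le[OF q scale_closed[OF x]] .
        also have "\<dots> \<le> c * q x" using CA[OF q] x c by (auto simp: A_def intro: sublinear_scale_le)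
        finally show "u (vscale E (complex_of_real c) x) / c \<le> q x" using c by (simp add: field_simps)
      qed
      then show "u (vscale E (complex_of_real c) x) \<le> c * u x" using c by (simp add: field_simps)
    qed
    moreover have "u x \<le> p x" if x: "x \<in> vcarrier E" for x
    proof -
      obtain q where q: "q \<in> C" using False by blast
      show ?thesis using u_le[OF q x] CA[OF q] x by (force simp: A_def)
    qed
    ultimately have "u \<in> A" by (simp add: A_def u_def)
    moreover have "\<forall>q\<in>C. P q u" using u_le by (simp add: P_def)
    ultimately show ?thesis by blast
  qed
  ultimately obtain q where q: "q \<in> A" "\<forall>r\<in>A. P q r \<longrightarrow> r = q"
    using predicate_Zorn[of A P] by auto
  have q_sub: "sublinear q" and q_le: "\<And>x. x \<in> vcarrier E \<Longrightarrow> q x \<le> p x" using q(1) by (auto simp: A_def)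
  show ?thesis
  proof (intro exI[of _ q] conjI allI impI)
    show "sublinear q" "\<forall>x\<in>vcarrier E. q x \<le> p x" using q_sub q_le by auto
    fix r assume r: "sublinear r" "\<forall>x\<in>vcarrier E. r x \<le> q x"
    have "restrict r (vcarrier E) \<in> A"
      using r q_le by (auto simp: A_def intro: sub_cong[OF r(1)] order_trans)
    moreover have "P q (restrict r (vcarrier E))" using r(2) by (simp add: P_def)
    ultimately have "restrict r (vcarrier E) = q" using q(2) by blast
    then show "\<forall>x\<in>vcarrier E. r x = q x" by (metis restrict_apply')
  qed
qed

text \<open>
  Start from the norm made additive in the direction \<open>x0\<close>, whose value at \<open>- x0\<close> is at most \<open>-
  \<parallel>x0\<parallel>\<close>. A minimal sublinear functional \<open>q\<close> below it is real linear with \<open>q (- x0) < 0\<close>, and \<open>x \<mapsto>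
  q x - \<i> q (\<i> x)\<close> is its complex linear extension. The factor 2 comes from estimating real and
  imaginary part separately.
\<close>

theorem exists_bounded_functional_nonzero:
  assumes x0: "x0 \<in> vcarrier E" "x0 \<noteq> vzero E"
  obtains f :: "'a \<Rightarrow> complex" where
    "\<And>x y. \<lbrakk>x \<in> vcarrier E; y \<in> vcarrier E\<rbrakk> \<Longrightarrow> f (vadd E x y) = f x + f y"
    "\<And>c x. x \<in> vcarrier E \<Longrightarrow> f (vscale E c x) = c * f x"
    "\<And>x. x \<in> vcarrier E \<Longrightarrow> cmod (f x) \<le> 2 * vnorm E x"
    "f x0 \<noteq> 0"
proof -
  define p where "p = directional (vnorm E) x0"
  have p: "sublinear p" unfolding p_def by (rule sublinear_directional[OF sublinear_norm x0(1)])
  from exists_minimal_sublinear[OF p] obtain q where q': "sublinear q \<and> (\<forall>x\<in>vcarrier E. q x \<le> p x) \<and>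
    (\<forall>r. sublinear r \<longrightarrow> (\<forall>x\<in>vcarrier E. r x \<le> q x) \<longrightarrow> (\<forall>x\<in>vcarrier E. r x = q x))" ..
  then have q: "sublinear q" and qp: "\<And>x. x \<in> vcarrier E \<Longrightarrow> q x \<le> p x"
    and min: "\<And>r. sublinear r \<Longrightarrow> \<forall>x\<in>vcarrier E. r x \<le> q x \<Longrightarrow> \<forall>x\<in>vcarrier E. r x = q x"
    by simp_all
  have q_norm: "q x \<le> vnorm E x" if "x \<in> vcarrier E" for x
    using qp[OF that] directional_le_self[OF sublinear_norm x0(1) that] unfolding p_def by linarith
  have q_add: "q (vadd E x a) = q x + q a" if x: "x \<in> vcarrier E" and a: "a \<in> vcarrier E" for x a
  proof -
    have "directional q a x = q x"
      using min[OF sublinear_directional[OF q a]] directional_le_self[OF q a] x by simp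
    then have "q x \<le> q (vadd E x a) - q a"
      using directional_le[OF q a x, of 1] a by (simp add: scale_one)
    then show ?thesis using sublinear_add[OF q x a] by linarith
  qed
  have q_neg: "q (vscale E (-1) x) = - q x" if x: "x \<in> vcarrier E" for x
    using q_add[OF x scale_closed[OF x], of "-1"] add_neg[OF x] sublinear_zero[OF q] by simp
  have q_scale: "q (vscale E (complex_of_real c) x) = c * q x" if x: "x \<in> vcarrier E" for c x
  proof (cases "c \<ge> 0")
    case True
    then show ?thesis by (rule sublinear_scale[OF q x])
  next
    case False
    have "vscale E (complex_of_real c) x = vscale E (-1) (vscale E (complex_of_real (- c)) x)"
      using x by (simp add: scale_scale)
    then show ?thesis
      using q_neg[OF scale_closed[OF x], of "complex_of_real (- c)"] sublinear_scale[OF q x, of "- c"] False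
      by simp
  qed
  have q_abs: "\<bar>q x\<bar> \<le> vnorm E x" if x: "x \<in> vcarrier E" for x
    using q_norm[OF x] q_norm[OF scale_closed[OF x], of "-1"] q_neg[OF x] x by (simp add: norm_scale)
  have "q (vscale E (-1) x0) \<le> - vnorm E x0"
  proof -
    have "vadd E (vscale E (-1) x0) x0 = vzero E"
      using x0(1) add_neg add_commute scale_closed by metis
    then have "p (vscale E (-1) x0) \<le> - vnorm E x0"
      using directional_le[OF sublinear_norm x0(1) scale_closed[OF x0(1)], of 1 "-1"] x0(1)
      by (simp add: p_def scale_one norm_zero)
    then show ?thesis using qp[OF scale_closed[OF x0(1)], of "-1"] by linarith
  qed
  moreover have "vnorm E x0 > 0" using norm_nonneg[OF x0(1)] norm_eq_zero[OF x0(1)] x0(2) by linarith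
  ultimately have q_x0: "q x0 \<noteq> 0" using q_neg[OF x0(1)] by simp
  define f where "f x = Complex (q x) (- q (vscale E \<i> x))" for x
  show thesis
  proof
    fix x assume x: "x \<in> vcarrier E"
    show "f (vadd E x y) = f x + f y" if y: "y \<in> vcarrier E" for y
      using x y by (simp add: f_def q_add scale_add_right scale_closed complex_eq_iff)
    show "f (vscale E c x) = c * f x" for c
    proof -
      have q_c: "q (vscale E d x) = Re d * q x + Im d * q (vscale E \<i> x)" for d
      proof -
        have "vscale E d x = vadd E (vscale E (complex_of_real (Re d)) x)
            (vscale E (complex_of_real (Im d)) (vscale E \<i> x))"
          using x by (simp add: scale_scale scale_add_left[symmetric]) (metis complex_eq mult.commute)
        then show ?thesis using x by (simp add: q_add q_scale scale_closed)
      qed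
      have "vscale E \<i> (vscale E c x) = vscale E (\<i> * c) x" using x by (simp add: scale_scale)
      then show ?thesis using q_c[of c] q_c[of "\<i> * c"] by (simp add: f_def complex_eq_iff algebra_simps)
    qed
    have "cmod (f x) \<le> \<bar>q x\<bar> + \<bar>q (vscale E \<i> x)\<bar>"
      using cmod_le[of "f x"] by (simp add: f_def)
    then show "cmod (f x) \<le> 2 * vnorm E x"
      using q_abs[OF x] q_abs[OF scale_closed[OF x], of \<i>] x by (simp add: norm_scale)
  next
    show "f x0 \<noteq> 0" using q_x0 by (simp add: f_def complex_eq_iff)
  qed
qed

end

section \<open>The algebra of a continuous field\<close>

context continuous_field
begin

abbreviation B :: "('t \<Rightarrow> 'a) nalgebra" where "B \<equiv> field_algebra U"
abbreviation T :: "'t set" where "T \<equiv> topspace (base U)"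

lemma section_mem: "x \<in> sections U \<Longrightarrow> t \<in> T \<Longrightarrow> x t \<in> vcarrier (fibre U t)"
  using sections_subset by blast

lemma fibre_banach: "t \<in> T \<Longrightarrow> banach_space (fibre U t)"
  using fibre_algebra banach_algebra.axioms(1) by blast

lemma field_algebra_simps:
  "vadd B = sec_add U" "vzero B = sec_zero U"
  "vscale B = sec_scale U" "amult B = sec_mult U"
  by (simp_all add: field_algebra_def)

lemma mem_field_algebra_iff:
  "x \<in> vcarrier B \<longleftrightarrow>
    x \<in> sections U \<and> vanishes_at_infinity (base U) (\<lambda>t. vnorm (fibre U t) (x t))"
  by (simp add: field_algebra_def)

lemma vanishes_at_infinity_norm_iff:
  assumes "x \<in> sections U"
  shows "vanishes_at_infinity (base U) (\<lambda>t. vnorm (fibre U t) (x t)) \<longleftrightarrow>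
    (\<forall>e>0. \<exists>K. compactin (base U) K \<and> (\<forall>t\<in>T - K. vnorm (fibre U t) (x t) < e))"
proof -
  have "\<bar>vnorm (fibre U t) (x t)\<bar> = vnorm (fibre U t) (x t)" if "t \<in> T" for t
    using banach_space.norm_nonneg[OF fibre_banach section_mem] that assms by simp
  then show ?thesis by (simp add: vanishes_at_infinity_def)
qed

lemma field_algebraI:
  assumes "x \<in> sections U"
    and "\<And>e. e > 0 \<Longrightarrow> \<exists>K. compactin (base U) K \<and> (\<forall>t\<in>T - K. vnorm (fibre U t) (x t) < e)"
  shows "x \<in> vcarrier B"
  using assms by (simp add: mem_field_algebra_iff vanishes_at_infinity_norm_iff)

lemma field_algebraD:
  assumes "x \<in> vcarrier B"
  shows "x \<in> sections U"
    and "e > 0 \<Longrightarrow> \<exists>K. compactin (base U) K \<and> (\<forall>t\<in>T - K. vnorm (fibre U t) (x t) < e)"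
proof -
  show x: "x \<in> sections U" using assms by (simp add: mem_field_algebra_iff)
  show "\<exists>K. compactin (base U) K \<and> (\<forall>t\<in>T - K. vnorm (fibre U t) (x t) < e)" if "e > 0"
    using assms that unfolding mem_field_algebra_iff vanishes_at_infinity_norm_iff[OF x] by blast
qed

text \<open>
  The norm is continuous, hence bounded on the compact set off which it is less than 1.
\<close>

lemma bounded_section:
  assumes x: "x \<in> vcarrier B"
  shows "bounded_family T (fibre U) x"
proof -
  obtain K where K: "compactin (base U) K" "\<forall>t\<in>T - K. vnorm (fibre U t) (x t) < 1"
    using field_algebraD(2)[OF x, of 1] by auto
  have "compactin euclideanreal ((\<lambda>t. vnorm (fibre U t) (x t)) ` K)"
    by (rule image_compactin[OF K(1) norm_continuous[OF field_algebraD(1)[OF x]]])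
  then have "bdd_above ((\<lambda>t. vnorm (fibre U t) (x t)) ` K)"
    by (simp add: compact_imp_bounded bounded_imp_bdd_above)
  then obtain c where c: "\<And>t. t \<in> K \<Longrightarrow> vnorm (fibre U t) (x t) \<le> c"
    by (auto simp: bdd_above_def)
  have "vnorm (fibre U t) (x t) \<le> max c 1" if "t \<in> T" for t
    using c[of t] K(2) that by (cases "t \<in> K") (auto simp: le_max_iff_disj intro: less_imp_le)
  then show ?thesis unfolding bounded_family_def by blast
qed

sublocale algebra: sup_normed_family "T" "fibre U" "B"
proof (rule sup_normed_family.intro)
  show "banach_space (fibre U t)" if "t \<in> T" for t using that by (rule fibre_banach)
  show "x \<in> fibre_prod T (fibre U)" if "x \<in> vcarrier B" for x
    using field_algebraD(1)[OF that] sections_subset by blast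
  show "bounded_family T (fibre U) x" if "x \<in> vcarrier B" for x
    using that by (rule bounded_section)
  show "vadd B = (\<lambda>x y. \<lambda>i\<in>T. vadd (fibre U i) (x i) (y i))"
    "vscale B = (\<lambda>c x. \<lambda>i\<in>T. vscale (fibre U i) c (x i))"
    "vzero B = (\<lambda>i\<in>T. vzero (fibre U i))"
    by (simp_all add: fun_eq_iff field_algebra_simps sec_add_def sec_scale_def sec_zero_def)
  show "vnorm B =
      (\<lambda>x. Sup (insert 0 ((\<lambda>i. vnorm (fibre U i) (x i)) ` T)))"
    by (simp add: field_algebra_def)
  have "vnorm (fibre U t) (vzero (fibre U t)) = 0" if "t \<in> T" for t
    using banach_space.norm_zero[OF fibre_banach[OF that]] .
  then show "vzero B \<in> vcarrier B"
    using zero_section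
    by (intro field_algebraI) (auto simp: field_algebra_simps sec_zero_def intro!: exI[of _ "{}"])
  show "vadd B x y \<in> vcarrier B"
    if x: "x \<in> vcarrier B" and y: "y \<in> vcarrier B" for x y
    unfolding field_algebra_simps
  proof (rule field_algebraI)
    show "sec_add U x y \<in> sections U" using x y by (intro add_section field_algebraD)
    fix e :: real assume "e > 0"
    then obtain K L where KL: "compactin (base U) K" "compactin (base U) L"
      "\<forall>t\<in>T - K. vnorm (fibre U t) (x t) < e / 2"
      "\<forall>t\<in>T - L. vnorm (fibre U t) (y t) < e / 2"
      using field_algebraD(2)[OF x, of "e / 2"] field_algebraD(2)[OF y, of "e / 2"] by auto
    have "vnorm (fibre U t) (sec_add U x y t) < e" if t: "t \<in> T - (K \<union> L)" for t
    proof -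
      have "vnorm (fibre U t) (sec_add U x y t) \<le> vnorm (fibre U t) (x t) + vnorm (fibre U t) (y t)"
        using banach_space.norm_triangle[OF fibre_banach section_mem section_mem] x y t
        by (simp add: sec_add_def field_algebraD)
      moreover have "vnorm (fibre U t) (x t) < e / 2" "vnorm (fibre U t) (y t) < e / 2"
        using KL t by auto
      ultimately show ?thesis by linarith
    qed
    then show "\<exists>K. compactin (base U) K \<and>
        (\<forall>t\<in>T - K. vnorm (fibre U t) (sec_add U x y t) < e)"
      using compactin_Un[OF KL(1,2)] by blast
  qed
  show "vscale B c x \<in> vcarrier B"
    if x: "x \<in> vcarrier B" for c x
    unfolding field_algebra_simps
  proof (rule field_algebraI)
    show "sec_scale U c x \<in> sections U" using x by (intro scale_section field_algebraD)
    fix e :: real assume "e > 0"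
    have pos: "e / (cmod c + 1) > 0" using \<open>e > 0\<close> by (simp add: add_nonneg_pos)
    obtain K where K: "compactin (base U) K"
      "\<forall>t\<in>T - K. vnorm (fibre U t) (x t) < e / (cmod c + 1)"
      using field_algebraD(2)[OF x pos] by auto
    have "vnorm (fibre U t) (sec_scale U c x t) < e" if t: "t \<in> T - K" for t
    proof -
      have n: "0 \<le> vnorm (fibre U t) (x t)"
        using banach_space.norm_nonneg[OF fibre_banach section_mem] x t by (simp add: field_algebraD)
      have "vnorm (fibre U t) (sec_scale U c x t) = cmod c * vnorm (fibre U t) (x t)"
        using banach_space.norm_scale[OF fibre_banach section_mem] x t
        by (simp add: sec_scale_def field_algebraD)
      also have "\<dots> \<le> (cmod c + 1) * vnorm (fibre U t) (x t)" using n by (simp add: mult_right_mono)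
      also have "\<dots> < e" using K(2) t by (simp add: pos_less_divide_eq add_nonneg_pos mult.commute)
      finally show ?thesis .
    qed
    then show "\<exists>K. compactin (base U) K \<and>
        (\<forall>t\<in>T - K. vnorm (fibre U t) (sec_scale U c x t) < e)"
      using K(1) by blast
  qed
  show "x \<in> vcarrier B"
    if x: "x \<in> fibre_prod T (fibre U)" and "bounded_family T (fibre U) x"
      and lim: "\<And>e. e > 0 \<Longrightarrow> \<exists>y\<in>vcarrier B.
        \<forall>i\<in>T. vdist (fibre U i) (x i) (y i) \<le> e" for x
  proof (rule field_algebraI)
    have "locally_approximable (base U) (fibre U) (sections U) x"
      unfolding locally_approximable_def
    proof (intro ballI allI impI)
      fix t and e :: real assume "t \<in> T" "e > 0"
      then show "\<exists>x'\<in>sections U. \<exists>N. openin (base U) N \<and> t \<in> N \<and> (\<forall>s\<in>N. vdist (fibre U s) (x s) (x' s) \<le> e)"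
        using lim[of e] field_algebraD(1) openin_topspace by blast
    qed
    then show "x \<in> sections U" by (rule sections_closed[OF x])
    fix e :: real assume "e > 0"
    obtain y where y: "y \<in> vcarrier B"
      "\<forall>i\<in>T. vdist (fibre U i) (x i) (y i) \<le> e / 2" using lim[of "e / 2"] \<open>e > 0\<close> by auto
    obtain K where K: "compactin (base U) K" "\<forall>t\<in>T - K. vnorm (fibre U t) (y t) < e / 2"
      using field_algebraD(2)[OF y(1), of "e / 2"] \<open>e > 0\<close> by auto
    have "vnorm (fibre U t) (x t) < e" if t: "t \<in> T - K" for t
    proof -
      have "vnorm (fibre U t) (x t) \<le> vdist (fibre U t) (x t) (y t) + vnorm (fibre U t) (y t)"
        using x t section_mem[OF field_algebraD(1)[OF y(1)]]
        by (intro banach_space.norm_le_vdist_add fibre_banach) auto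
      moreover have "vdist (fibre U t) (x t) (y t) \<le> e / 2" using y(2) t by simp
      moreover have "vnorm (fibre U t) (y t) < e / 2" using K(2) t by simp
      ultimately show ?thesis by linarith
    qed
    then show "\<exists>K. compactin (base U) K \<and> (\<forall>t\<in>T - K. vnorm (fibre U t) (x t) < e)"
      using K(1) by blast
  qed
qed

lemma field_algebra_mult_apply:
  "t \<in> T \<Longrightarrow> amult B x y t = amult (fibre U t) (x t) (y t)"
  by (simp add: field_algebra_simps sec_mult_def)

lemma field_algebra_norm_mult_le:
  assumes "x \<in> vcarrier B" "t \<in> T" "a \<in> vcarrier (fibre U t)"
  shows "vnorm (fibre U t) (amult (fibre U t) (x t) a) \<le> vnorm B x * vnorm (fibre U t) a"
proof -
  interpret banach_algebra "fibre U t" by (rule fibre_algebra[OF assms(2)])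
  have "vnorm (fibre U t) (amult (fibre U t) (x t) a) \<le> vnorm (fibre U t) (x t) * vnorm (fibre U t) a"
    by (rule norm_mult[OF algebra.mem[OF assms(1,2)] assms(3)])
  also have "\<dots> \<le> vnorm B x * vnorm (fibre U t) a"
    using assms by (intro mult_right_mono algebra.norm_le norm_nonneg)
  finally show ?thesis .
qed

lemma field_algebra_mult_closed:
  assumes x: "x \<in> vcarrier B" and y: "y \<in> vcarrier B"
  shows "amult B x y \<in> vcarrier B"
  unfolding field_algebra_simps
proof (rule field_algebraI)
  show "sec_mult U x y \<in> sections U" using x y by (intro mult_section field_algebraD)
  fix e :: real assume "e > 0"
  let ?c = "vnorm B x + 1"
  have c: "?c > 0" using algebra.norm_nonneg[OF x] by simp
  then have pos: "e / ?c > 0" using \<open>e > 0\<close> by simp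
  obtain K where K: "compactin (base U) K"
    "\<forall>t\<in>T - K. vnorm (fibre U t) (y t) < e / ?c"
    using field_algebraD(2)[OF y pos] by auto
  have "vnorm (fibre U t) (sec_mult U x y t) < e" if t: "t \<in> T - K" for t
  proof -
    have n: "0 \<le> vnorm (fibre U t) (y t)"
      using banach_space.norm_nonneg[OF fibre_banach algebra.mem[OF y]] t by simp
    have "vnorm (fibre U t) (sec_mult U x y t) \<le> vnorm B x * vnorm (fibre U t) (y t)"
      using field_algebra_norm_mult_le[OF x _ algebra.mem[OF y]] t by (simp add: sec_mult_def)
    also have "\<dots> \<le> ?c * vnorm (fibre U t) (y t)" using n by (simp add: mult_right_mono)
    also have "\<dots> < e" using K(2) t c by (simp add: pos_less_divide_eq mult.commute)
    finally show ?thesis .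
  qed
  then show "\<exists>K. compactin (base U) K \<and>
      (\<forall>t\<in>T - K. vnorm (fibre U t) (sec_mult U x y t) < e)"
    using K(1) by blast
qed

theorem banach_algebra_field_algebra: "banach_algebra B"
proof (intro banach_algebra.intro algebra.banach_space banach_algebra_axioms.intro)
  note [simp] = field_algebra_mult_closed algebra.add_mem algebra.scale_mem algebra.apply_simps
    field_algebra_mult_apply algebra.mem
  fix x y z c assume x: "x \<in> vcarrier B" and y: "y \<in> vcarrier B"
  show "amult B x y \<in> vcarrier B" using x y by simp
  show "amult B (vscale B c x) y =
      vscale B c (amult B x y)"
    "amult B x (vscale B c y) =
      vscale B c (amult B x y)"
    using x y by (intro algebra.mem_eqI; simp add: banach_algebra.mult_scale_left[OF fibre_algebra]
      banach_algebra.mult_scale_right[OF fibre_algebra])+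
  show "vnorm B (amult B x y) \<le> vnorm B x * vnorm B y"
  proof -
    have "vnorm (fibre U t) (amult (fibre U t) (x t) (y t)) \<le> vnorm B x * vnorm B y"
      if t: "t \<in> T" for t
      using field_algebra_norm_mult_le[OF x t algebra.mem[OF y t]]
        mult_left_mono[OF algebra.norm_le[OF y t] algebra.norm_nonneg[OF x]] by linarith
    then show ?thesis
      using x y by (subst algebra.norm_le_iff) (auto intro!: mult_nonneg_nonneg algebra.norm_nonneg)
  qed
  assume z: "z \<in> vcarrier B"
  show "amult B (amult B x y) z =
      amult B x (amult B y z)"
    using x y z by (intro algebra.mem_eqI) (simp_all add: banach_algebra.mult_assoc[OF fibre_algebra])
  show "amult B (vadd B x y) z =
      vadd B (amult B x z) (amult B y z)"
    using x y z by (intro algebra.mem_eqI) (simp_all add: banach_algebra.mult_add_left[OF fibre_algebra])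
  show "amult B x (vadd B y z) =
      vadd B (amult B x y) (amult B x z)"
    using x y z by (intro algebra.mem_eqI) (simp_all add: banach_algebra.mult_add_right[OF fibre_algebra])
qed

end

section \<open>Sections over a trivialized open set\<close>

lemma exists_bump_function:
  assumes H: "Hausdorff_space X" and lc: "locally_compact_space X" and G: "openin X G"
    and K: "compactin X K" "K \<subseteq> G"
  obtains g :: "'t \<Rightarrow> real" and C where "continuous_map X euclideanreal g" "compactin X C" "C \<subseteq> G"
    "\<And>t. t \<in> topspace X - C \<Longrightarrow> g t = 0" "\<And>t. t \<in> K \<Longrightarrow> g t = 1"
proof -
  have "locally_compact_space (subtopology X G)" "Hausdorff_space (subtopology X G)"
    using locally_compact_space_open_subset[OF _ lc G] H by (auto simp: Hausdorff_space_subtopology)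
  moreover have "compactin (subtopology X G) K" using K by (simp add: compactin_subtopology)
  ultimately obtain O' C where OC: "openin (subtopology X G) O'" "compactin (subtopology X G) C" "K \<subseteq> O'" "O' \<subseteq> C"
    using locally_compact_space_compact_closed_compact[of "subtopology X G"] by blast
  have O': "openin X O'" using OC(1) G openin_open_subtopology by blast
  have C: "compactin X C" "C \<subseteq> G" using OC(2) by (auto simp: compactin_subtopology)
  have "completely_regular_space X"
    using H lc locally_compact_regular_imp_completely_regular_space by blast
  moreover have "closedin X (topspace X - O')" "disjnt K (topspace X - O')"
    using O' OC(3) by (auto simp: disjnt_def)
  ultimately obtain g where g: "continuous_map X euclideanreal g" "g ` (topspace X - O') \<subseteq> {0}" "g ` K \<subseteq> {1}"
    using Urysohn_completely_regular_compact_closed_alt[of X K "topspace X - O'" 0 1] K(1) by metis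
  show thesis
  proof (rule that[OF g(1) C])
    show "g t = 0" if "t \<in> topspace X - C" for t using that g(2) OC(4) by blast
    show "g t = 1" if "t \<in> K" for t using that g(3) by blast
  qed
qed

text \<open>
  A trivialization over an open set \<open>G\<close>, formulated with the sections of the whole field rather
  than with those of the field induced on \<open>G\<close>: these are the sections on which \<^const>\<open>field_algebra\<close>
  is built.
\<close>

locale trivialized_field = continuous_field U for U :: "('t, 'a) alg_field" +
  fixes G :: "'t set" and A :: "'c nalgebra" and \<phi> :: "'t \<Rightarrow> 'a \<Rightarrow> 'c"
  assumes open_G: "openin (base U) G"
    and model: "banach_algebra A"
    and iso: "t \<in> G \<Longrightarrow> isometric_algebra_iso (fibre U t) A (\<phi> t)"
    and trivialization_continuous: "x \<in> sections U \<Longrightarrow>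
      continuous_map (subtopology (base U) G) (vtopology A) (\<lambda>t. \<phi> t (x t))"
begin

sublocale model: banach_algebra A by (rule model)

lemma G_subset: "t \<in> G \<Longrightarrow> t \<in> T"
  using open_G openin_subset by blast

definition \<phi>inv :: "'t \<Rightarrow> 'c \<Rightarrow> 'a" where
  "\<phi>inv t = inv_into (vcarrier (fibre U t)) (\<phi> t)"

lemma bij: "t \<in> G \<Longrightarrow> bij_betw (\<phi> t) (vcarrier (fibre U t)) (vcarrier A)"
  using iso by (simp add: isometric_algebra_iso_def)

lemma \<phi>_mem: "t \<in> G \<Longrightarrow> a \<in> vcarrier (fibre U t) \<Longrightarrow> \<phi> t a \<in> vcarrier A"
  using bij by (auto simp: bij_betw_def)

lemma \<phi>_linear: "t \<in> G \<Longrightarrow> linear_map (fibre U t) A (\<phi> t)"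
  using iso by (simp add: isometric_algebra_iso_def)

lemma \<phi>_hom:
  assumes "t \<in> G" "a \<in> vcarrier (fibre U t)" "b \<in> vcarrier (fibre U t)"
  shows "\<phi> t (vadd (fibre U t) a b) = vadd A (\<phi> t a) (\<phi> t b)"
    "\<phi> t (amult (fibre U t) a b) = amult A (\<phi> t a) (\<phi> t b)"
  using iso[OF assms(1)] assms(2,3) by (simp_all add: isometric_algebra_iso_def linear_map_def)

lemma \<phi>_scale: "t \<in> G \<Longrightarrow> a \<in> vcarrier (fibre U t) \<Longrightarrow> \<phi> t (vscale (fibre U t) c a) = vscale A c (\<phi> t a)"
  and \<phi>_norm: "t \<in> G \<Longrightarrow> a \<in> vcarrier (fibre U t) \<Longrightarrow> vnorm A (\<phi> t a) = vnorm (fibre U t) a"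
  using iso by (simp_all add: isometric_algebra_iso_def linear_map_def)

lemma \<phi>_dist:
  assumes "t \<in> G" "a \<in> vcarrier (fibre U t)" "b \<in> vcarrier (fibre U t)"
  shows "vdist A (\<phi> t a) (\<phi> t b) = vdist (fibre U t) a b"
  using \<phi>_norm[OF assms(1)] assms
  by (intro linear_map_vdist fibre_banach G_subset model.banach_space_axioms \<phi>_linear)

lemma \<phi>inv_mem: "t \<in> G \<Longrightarrow> x \<in> vcarrier A \<Longrightarrow> \<phi>inv t x \<in> vcarrier (fibre U t)"
  unfolding \<phi>inv_def using bij by (metis bij_betw_imp_surj_on inv_into_into)

lemma \<phi>_\<phi>inv: "t \<in> G \<Longrightarrow> x \<in> vcarrier A \<Longrightarrow> \<phi> t (\<phi>inv t x) = x"
  unfolding \<phi>inv_def using bij by (metis bij_betw_imp_surj_on f_inv_into_f)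

lemma \<phi>inv_\<phi>: "t \<in> G \<Longrightarrow> a \<in> vcarrier (fibre U t) \<Longrightarrow> \<phi>inv t (\<phi> t a) = a"
  unfolding \<phi>inv_def using bij by (metis bij_betw_imp_inj_on inv_into_f_f)

lemma \<phi>_eqD: "\<lbrakk>t \<in> G; a \<in> vcarrier (fibre U t); b \<in> vcarrier (fibre U t); \<phi> t a = \<phi> t b\<rbrakk> \<Longrightarrow> a = b"
  using \<phi>inv_\<phi> by metis

lemma \<phi>inv_mult:
  assumes t: "t \<in> G" and x: "x \<in> vcarrier A" and y: "y \<in> vcarrier A"
  shows "\<phi>inv t (amult A x y) = amult (fibre U t) (\<phi>inv t x) (\<phi>inv t y)"
proof (rule \<phi>_eqD[OF t])
  interpret F: banach_algebra "fibre U t" by (rule fibre_algebra[OF G_subset[OF t]])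
  show "\<phi>inv t (amult A x y) \<in> vcarrier (fibre U t)"
    "amult (fibre U t) (\<phi>inv t x) (\<phi>inv t y) \<in> vcarrier (fibre U t)"
    using assms by (simp_all add: \<phi>inv_mem model.mult_closed F.mult_closed)
  show "\<phi> t (\<phi>inv t (amult A x y)) = \<phi> t (amult (fibre U t) (\<phi>inv t x) (\<phi>inv t y))"
    using assms by (simp add: \<phi>inv_mem \<phi>_\<phi>inv \<phi>_hom model.mult_closed)
qed

lemma \<phi>inv_add:
  assumes t: "t \<in> G" and x: "x \<in> vcarrier A" and y: "y \<in> vcarrier A"
  shows "\<phi>inv t (vadd A x y) = vadd (fibre U t) (\<phi>inv t x) (\<phi>inv t y)"
proof (rule \<phi>_eqD[OF t])
  interpret F: banach_algebra "fibre U t" by (rule fibre_algebra[OF G_subset[OF t]])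
  show "\<phi>inv t (vadd A x y) \<in> vcarrier (fibre U t)"
    "vadd (fibre U t) (\<phi>inv t x) (\<phi>inv t y) \<in> vcarrier (fibre U t)"
    using assms by (simp_all add: \<phi>inv_mem model.add_closed F.add_closed)
  show "\<phi> t (\<phi>inv t (vadd A x y)) = \<phi> t (vadd (fibre U t) (\<phi>inv t x) (\<phi>inv t y))"
    using assms by (simp add: \<phi>inv_mem \<phi>_\<phi>inv \<phi>_hom model.add_closed)
qed

lemma \<phi>inv_scale:
  assumes t: "t \<in> G" and x: "x \<in> vcarrier A"
  shows "\<phi>inv t (vscale A c x) = vscale (fibre U t) c (\<phi>inv t x)"
proof (rule \<phi>_eqD[OF t])
  interpret F: banach_algebra "fibre U t" by (rule fibre_algebra[OF G_subset[OF t]])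
  show "\<phi>inv t (vscale A c x) \<in> vcarrier (fibre U t)"
    "vscale (fibre U t) c (\<phi>inv t x) \<in> vcarrier (fibre U t)"
    using assms by (simp_all add: \<phi>inv_mem model.scale_closed F.scale_closed)
  show "\<phi> t (\<phi>inv t (vscale A c x)) = \<phi> t (vscale (fibre U t) c (\<phi>inv t x))"
    using assms by (simp add: \<phi>inv_mem \<phi>_\<phi>inv \<phi>_scale model.scale_closed)
qed

lemma \<phi>inv_norm: "t \<in> G \<Longrightarrow> x \<in> vcarrier A \<Longrightarrow> vnorm (fibre U t) (\<phi>inv t x) = vnorm A x"
  using \<phi>_norm[OF _ \<phi>inv_mem, of t x] by (simp add: \<phi>_\<phi>inv)

lemma \<phi>inv_dist:
  assumes "t \<in> G" "x \<in> vcarrier A" "y \<in> vcarrier A"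
  shows "vdist (fibre U t) (\<phi>inv t x) (\<phi>inv t y) = vdist A x y"
  using \<phi>_dist[OF assms(1) \<phi>inv_mem \<phi>inv_mem] assms by (simp add: \<phi>_\<phi>inv)

lemma section_close:
  assumes x: "x \<in> sections U" and t: "t \<in> G" and e: "e > 0"
  obtains N where "openin (base U) N" "t \<in> N" "N \<subseteq> G"
    "\<And>s. s \<in> N \<Longrightarrow> vdist A (\<phi> t (x t)) (\<phi> s (x s)) < e"
proof -
  let ?f = "\<lambda>t. \<phi> t (x t)" and ?S = "subtopology (base U) G"
  have f: "?f s \<in> vcarrier A" if "s \<in> G" for s
    using section_mem[OF x G_subset[OF that]] that by (rule \<phi>_mem[rotated])
  define N where "N = {s \<in> topspace ?S. ?f s \<in> model.metric.mball (?f t) e}"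
  have "openin ?S N"
    unfolding N_def using trivialization_continuous[OF x] model.metric.openin_mball
    by (rule openin_continuous_map_preimage)
  then have 1: "openin (base U) N" "N \<subseteq> G" using open_G openin_open_subtopology by blast+
  have 2: "t \<in> N" using t e f[OF t] G_subset[OF t] by (simp add: N_def)
  show thesis by (rule that[OF 1(1) 2 1(2)]) (simp add: N_def)
qed

definition bump :: "('t \<Rightarrow> real) \<Rightarrow> bool" where
  "bump g \<longleftrightarrow> continuous_map (base U) euclideanreal g \<and>
     (\<exists>K. compactin (base U) K \<and> K \<subseteq> G \<and> (\<forall>t\<in>T - K. g t = 0))"

lemma exists_bump:
  assumes "compactin (base U) K" "K \<subseteq> G"
  obtains g where "bump g" "\<And>t. t \<in> K \<Longrightarrow> g t = 1"
proof -
  obtain g C where "continuous_map (base U) euclideanreal g" "compactin (base U) C" "C \<subseteq> G"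
    "\<And>t. t \<in> T - C \<Longrightarrow> g t = 0" "\<And>t. t \<in> K \<Longrightarrow> g t = 1"
    using exists_bump_function[OF Hausdorff locally_compact open_G assms] by metis
  then show thesis by (intro that[of g]) (auto simp: bump_def)
qed

lemma bump_mult: 
  assumes "bump f" "bump g"
  shows "bump (\<lambda>t. f t * g t)"
proof -
  obtain K where "compactin (base U) K" "K \<subseteq> G" "\<forall>t\<in>T - K. g t = 0"
    using assms(2) unfolding bump_def by blast
  then have "\<exists>K. compactin (base U) K \<and> K \<subseteq> G \<and> (\<forall>t\<in>T - K. f t * g t = 0)"
    by (intro exI[of _ K]) simp
  moreover have "continuous_map (base U) euclideanreal (\<lambda>t. f t * g t)"
    using assms by (intro continuous_map_real_mult) (auto simp: bump_def)
  ultimately show ?thesis unfolding bump_def by blast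
qed

text \<open>
  The section \<open>g x\<close>, constant with value \<open>x\<close> in the trivialization up to the factor \<open>g\<close>.
\<close>

definition bump_section :: "('t \<Rightarrow> real) \<Rightarrow> 'c \<Rightarrow> 't \<Rightarrow> 'a" where
  "bump_section g x = (\<lambda>t\<in>T.
     if t \<in> G then vscale (fibre U t) (complex_of_real (g t)) (\<phi>inv t x) else vzero (fibre U t))"

lemma bump_section_apply:
  "t \<in> G \<Longrightarrow> bump_section g x t = vscale (fibre U t) (complex_of_real (g t)) (\<phi>inv t x)"
  using G_subset by (simp add: bump_section_def)

lemma bump_section_fibre:
  assumes "x \<in> vcarrier A" "t \<in> T"
  shows "bump_section g x t \<in> vcarrier (fibre U t)"
proof -
  interpret F: banach_space "fibre U t" by (rule fibre_banach[OF assms(2)])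
  show ?thesis using assms by (simp add: bump_section_def \<phi>inv_mem F.scale_closed F.zero_closed)
qed

lemma bump_section_outside:
  assumes "x \<in> vcarrier A" "t \<in> T" "g t = 0"
  shows "bump_section g x t = vzero (fibre U t)"
proof -
  interpret F: banach_space "fibre U t" by (rule fibre_banach[OF assms(2)])
  show ?thesis using assms by (simp add: bump_section_def \<phi>inv_mem F.scale_zero)
qed

lemma fibre_dense:
  assumes t: "t \<in> T" and a: "a \<in> vcarrier (fibre U t)" and e: "e > 0"
  obtains x where "x \<in> sections U" "vdist (fibre U t) a (x t) < e"
proof -
  interpret F: banach_space "fibre U t" by (rule fibre_banach[OF t])
  have "a \<in> F.metric.mtopology closure_of ((\<lambda>x. x t) ` sections U)"
    using sections_dense[OF t] a by simp
  then have "\<exists>y\<in>(\<lambda>x. x t) ` sections U. y \<in> F.metric.mball a e"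
    using e unfolding F.metric.metric_closure_of by blast
  then show thesis using that by auto
qed

text \<open>
  A trivialization only has to send sections to continuous maps, so that a family which is
  continuous in it is a section has to be derived. Choose a section that is close at the point
  \<open>t\<close>; as the isomorphisms are isometric, and both families are continuous in the trivialization,
  it is close near \<open>t\<close>.
\<close>

lemma bump_section_approximable:
  assumes g: "bump g" and x: "x \<in> vcarrier A" and t: "t \<in> G" and e: "e > 0"
  shows "\<exists>y\<in>sections U. \<exists>N. openin (base U) N \<and> t \<in> N \<and>
    (\<forall>s\<in>N. vdist (fibre U s) (bump_section g x s) (y s) \<le> e)"
proof -
  have e3: "e / 3 > 0" using e by simp
  note tX = G_subset[OF t]
  obtain y where y: "y \<in> sections U" "vdist (fibre U t) (bump_section g x t) (y t) < e / 3"
    using fibre_dense[OF tX bump_section_fibre[OF x tX] e3] by blast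
  obtain N where N: "openin (base U) N" "t \<in> N" "N \<subseteq> G"
    "\<And>s. s \<in> N \<Longrightarrow> vdist A (\<phi> t (y t)) (\<phi> s (y s)) < e / 3"
    using section_close[OF y(1) t e3] by blast
  define c where "c = vnorm A x + 1"
  have c: "c > 0" using model.norm_nonneg[OF x] by (simp add: c_def)
  define M where "M = {s \<in> T. g s \<in> ball (g t) (e / 3 / c)}"
  have M: "openin (base U) M" "t \<in> M"
    using g openin_continuous_map_preimage[of "base U" euclideanreal g "ball (g t) (e / 3 / c)"] e c tX
    by (auto simp: M_def bump_def)
  have "vdist (fibre U s) (bump_section g x s) (y s) \<le> e" if s: "s \<in> N \<inter> M" for s
  proof -
    have sG: "s \<in> G" and sX: "s \<in> T" using s N(3) G_subset by auto
    have b: "\<phi> r (bump_section g x r) = vscale A (complex_of_real (g r)) x" if "r \<in> G" for r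
      using that x by (simp add: bump_section_apply \<phi>_scale \<phi>inv_mem \<phi>_\<phi>inv)
    have mem: "\<phi> r (bump_section g x r) \<in> vcarrier A" "\<phi> r (y r) \<in> vcarrier A" if "r \<in> G" for r
      using that x by (simp_all add: \<phi>_mem bump_section_fibre section_mem[OF y(1)] G_subset)
    have "vdist A (\<phi> s (bump_section g x s)) (\<phi> t (bump_section g x t)) \<le> e / 3"
    proof -
      have "vadd A (vscale A (complex_of_real (g s)) x) (vscale A (-1) (vscale A (complex_of_real (g t)) x)) =
          vscale A (complex_of_real (g s - g t)) x"
        using x by (simp add: model.scale_scale model.scale_add_left[symmetric])
      then have "vdist A (\<phi> s (bump_section g x s)) (\<phi> t (bump_section g x t)) = \<bar>g s - g t\<bar> * vnorm A x"
        using x sG t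
        by (simp add: b model.vdist_eq model.scale_closed model.norm_scale flip: of_real_diff)
      also have "\<dots> \<le> (e / 3 / c) * c"
        using s model.norm_nonneg[OF x] c e
        by (intro mult_mono) (auto simp: M_def c_def dist_real_def abs_minus_commute)
      finally show ?thesis using c by simp
    qed
    moreover have "vdist A (\<phi> t (bump_section g x t)) (\<phi> t (y t)) < e / 3"
      using y(2) \<phi>_dist[OF t bump_section_fibre[OF x tX] section_mem[OF y(1) tX]] by simp
    moreover have "vdist A (\<phi> t (y t)) (\<phi> s (y s)) < e / 3" using N(4) s by blast
    moreover have "vdist A (\<phi> s (bump_section g x s)) (\<phi> s (y s)) \<le>
        vdist A (\<phi> s (bump_section g x s)) (\<phi> t (bump_section g x t)) +
        (vdist A (\<phi> t (bump_section g x t)) (\<phi> t (y t)) + vdist A (\<phi> t (y t)) (\<phi> s (y s)))"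
      using mem sG t
      by (meson add_left_mono model.metric.triangle order_trans)
    ultimately show ?thesis
      using \<phi>_dist[OF sG bump_section_fibre[OF x sX] section_mem[OF y(1) sX]] by simp
  qed
  then show ?thesis
    using y(1) N(1,2) M by (intro bexI[of _ y] exI[of _ "N \<inter> M"]) (auto intro: openin_Int)
qed

lemma bump_section_mem:
  assumes g: "bump g" and x: "x \<in> vcarrier A"
  shows "bump_section g x \<in> vcarrier B"
proof (rule field_algebraI)
  obtain K where K: "compactin (base U) K" "K \<subseteq> G" "\<forall>t\<in>T - K. g t = 0"
    using g unfolding bump_def by blast
  have out: "bump_section g x t = vzero (fibre U t)" if "t \<in> T - K" for t
    using that K(3) by (intro bump_section_outside[OF x]) auto
  show "\<exists>K. compactin (base U) K \<and> (\<forall>t\<in>T - K. vnorm (fibre U t) (bump_section g x t) < e)"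
    if "e > 0" for e
    using K(1) out \<open>e > 0\<close> by (intro exI[of _ K]) (auto simp: banach_space.norm_zero[OF fibre_banach])
  show "bump_section g x \<in> sections U"
  proof (rule sections_closed)
    show "bump_section g x \<in> fibre_prod T (fibre U)"
      using bump_section_fibre[OF x] by (auto simp: bump_section_def)
    show "locally_approximable (base U) (fibre U) (sections U) (bump_section g x)"
      unfolding locally_approximable_def
    proof (intro ballI allI impI)
      fix t and e :: real assume t: "t \<in> T" and e: "e > 0"
      show "\<exists>x'\<in>sections U. \<exists>N. openin (base U) N \<and> t \<in> N \<and>
          (\<forall>s\<in>N. vdist (fibre U s) (bump_section g x s) (x' s) \<le> e)"
      proof (cases "t \<in> G")
        case True
        then show ?thesis using bump_section_approximable[OF g x _ e] by blast
      next
        case False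
        have "openin (base U) (T - K)"
          using compactin_imp_closedin[OF Hausdorff K(1)] by (simp add: closedin_def)
        moreover have "vdist (fibre U s) (bump_section g x s) (sec_zero U s) \<le> e"
          if s: "s \<in> T - K" for s
        proof -
          interpret F: banach_space "fibre U s" using fibre_banach s by blast
          show ?thesis using out[OF s] s e by (simp add: sec_zero_def F.zero_closed)
        qed
        ultimately show ?thesis
          using False K(2) t zero_section
          by (intro bexI[of _ "sec_zero U"] exI[of _ "T - K"]) auto
      qed
    qed
  qed
qed

lemma bump_section_mult:
  assumes "x \<in> vcarrier A" "y \<in> vcarrier A"
  shows "amult B (bump_section f y) (bump_section g x) =
    bump_section (\<lambda>t. f t * g t) (amult A y x)"
proof
  fix t
  show "amult B (bump_section f y) (bump_section g x) t =
    bump_section (\<lambda>t. f t * g t) (amult A y x) t"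
  proof (cases "t \<in> T")
    case True
    interpret F: banach_algebra "fibre U t" by (rule fibre_algebra[OF True])
    show ?thesis
    proof (cases "t \<in> G")
      case tG: True
      then show ?thesis
        using assms True
        by (simp add: field_algebra_mult_apply bump_section_apply F.mult_scale_left F.mult_scale_right
            F.scale_closed F.mult_closed F.scale_scale \<phi>inv_mem \<phi>inv_mult mult.commute)
    next
      case False
      then show ?thesis
        using True by (simp add: field_algebra_mult_apply bump_section_def F.mult_vzero F.zero_closed)
    qed
  qed (simp add: field_algebra_simps sec_mult_def bump_section_def)
qed

end

section \<open>Nonzero products in the fibres\<close>

lemma left_projective_section:
  fixes B :: "('b, 'u) nalgebra_scheme" and Y :: "'y nspace"
  assumes B: "banach_algebra B" and proj: "left_projective B"
    and Y: "left_banach_module B Y act" and \<theta>: "left_module_morphism B Y act B (amult B) \<theta>"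
    and \<psi>: "banach_morphism B Y \<psi>" "\<forall>p\<in>vcarrier B. \<theta> (\<psi> p) = p"
  shows "\<exists>\<rho>. left_module_morphism B B (amult B) Y act \<rho> \<and> (\<forall>p\<in>vcarrier B. \<theta> (\<rho> p) = p)"
proof -
  have "\<theta> ` vcarrier Y = vcarrier B"
  proof
    show "\<theta> ` vcarrier Y \<subseteq> vcarrier B"
      using \<theta> by (auto simp: left_module_morphism_def banach_morphism_def linear_map_def)
    show "vcarrier B \<subseteq> \<theta> ` vcarrier Y"
      using \<psi> by (force simp: banach_morphism_def linear_map_def image_iff)
  qed
  then show ?thesis
    using left_projective_wrt[OF B proj, where ?'y = 'y] Y \<theta> \<psi>
    unfolding projective_left_module_wrt_def by blast
qed

definition sup_space :: "'i set \<Rightarrow> ('i \<Rightarrow> ('a, 'z) nspace_scheme) \<Rightarrow> ('i \<Rightarrow> 'a) set \<Rightarrow> ('i \<Rightarrow> 'a) nspace" where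
  "sup_space I E C =
     \<lparr>vcarrier = C,
      vadd = (\<lambda>x y. \<lambda>i\<in>I. vadd (E i) (x i) (y i)),
      vzero = (\<lambda>i\<in>I. vzero (E i)),
      vscale = (\<lambda>c x. \<lambda>i\<in>I. vscale (E i) c (x i)),
      vnorm = (\<lambda>x. Sup (insert 0 ((\<lambda>i. vnorm (E i) (x i)) ` I)))\<rparr>"

lemma sup_space_carrier [simp]: "vcarrier (sup_space I E C) = C"
  by (simp add: sup_space_def)

lemma sup_normed_family_sup_space:
  assumes "\<And>i. i \<in> I \<Longrightarrow> banach_space (E i)"
    and "\<And>x. x \<in> C \<Longrightarrow> x \<in> (\<Pi>\<^sub>E i\<in>I. vcarrier (E i)) \<and> bounded_family I E x"
    and "(\<lambda>i\<in>I. vzero (E i)) \<in> C"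
    and "\<And>x y. \<lbrakk>x \<in> C; y \<in> C\<rbrakk> \<Longrightarrow> (\<lambda>i\<in>I. vadd (E i) (x i) (y i)) \<in> C"
    and "\<And>c x. x \<in> C \<Longrightarrow> (\<lambda>i\<in>I. vscale (E i) c (x i)) \<in> C"
    and "\<And>x. \<lbrakk>x \<in> (\<Pi>\<^sub>E i\<in>I. vcarrier (E i)); bounded_family I E x;
      \<And>e. e > 0 \<Longrightarrow> \<exists>y\<in>C. \<forall>i\<in>I. vdist (E i) (x i) (y i) \<le> e\<rbrakk> \<Longrightarrow> x \<in> C"
  shows "sup_normed_family I E (sup_space I E C)"
  using assms by (intro sup_normed_family.intro) (simp_all add: sup_space_def)

context trivialized_field
begin

text \<open>
  Suppose that the multiplication of \<open>A\<close> is zero. For a functional \<open>f\<close> on the fibre at \<open>s0\<close>, the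
  bounded bilinear map \<open>(b, c) \<mapsto> f (b s0) c(s0)\<close> vanishes when \<open>b\<close> or \<open>c\<close> is a product. Therefore
  \<open>b \<cdot> (c, z) = (b c, f (b s0) c(s0))\<close> defines a Banach module on the sum of \<open>B\<close> and the fibre at
  \<open>s0\<close>, and the projection to \<open>B\<close> has the linear right inverse \<open>c \<mapsto> (c, 0)\<close>. A module right
  inverse \<open>\<rho>\<close> is impossible: for a bump section \<open>a\<close> with \<open>f (a s0) \<noteq> 0\<close> one has \<open>a a = 0\<close>, while
  the second component of \<open>a \<cdot> \<rho> a = \<rho> (a a)\<close> is \<open>f (a s0) a(s0) \<noteq> 0\<close>.
\<close>

lemma exists_nonzero_product:
  assumes proj: "left_projective B" and s0: "s0 \<in> G" and x: "x \<in> vcarrier A" "x \<noteq> vzero A"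
  shows "\<exists>x\<in>vcarrier A. \<exists>y\<in>vcarrier A. amult A y x \<noteq> vzero A"
proof (rule ccontr)
  assume "\<not> ?thesis"
  then have zero: "amult A y x = vzero A" if "x \<in> vcarrier A" "y \<in> vcarrier A" for x y
    using that by blast
  have s0T: "s0 \<in> T" using s0 by (rule G_subset)
  interpret S: banach_algebra "fibre U s0" by (rule fibre_algebra[OF s0T])
  have \<phi>0: "\<phi> s0 (vzero (fibre U s0)) = vzero A"
    using \<phi>_scale[OF s0 S.zero_closed, of 0] \<phi>_mem[OF s0 S.zero_closed]
    by (simp add: S.scale_zero S.zero_closed model.scale_zero)
  have zero': "amult (fibre U s0) a b = vzero (fibre U s0)"
    if "a \<in> vcarrier (fibre U s0)" "b \<in> vcarrier (fibre U s0)" for a b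
    using that s0 by (intro \<phi>_eqD[OF s0]) (simp_all add: S.mult_closed S.zero_closed \<phi>_hom \<phi>0 zero \<phi>_mem)
  have xs: "\<phi>inv s0 x \<in> vcarrier (fibre U s0)" using s0 x(1) by (rule \<phi>inv_mem)
  have xs0: "\<phi>inv s0 x \<noteq> vzero (fibre U s0)" using \<phi>_\<phi>inv[OF s0 x(1)] \<phi>0 x(2) by metis
  obtain f where f: "\<And>x y. \<lbrakk>x \<in> vcarrier (fibre U s0); y \<in> vcarrier (fibre U s0)\<rbrakk> \<Longrightarrow>
      f (vadd (fibre U s0) x y) = f x + f y"
    "\<And>c x. x \<in> vcarrier (fibre U s0) \<Longrightarrow> f (vscale (fibre U s0) c x) = c * f x"
    "\<And>x. x \<in> vcarrier (fibre U s0) \<Longrightarrow> cmod (f x) \<le> 2 * vnorm (fibre U s0) x"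
    "f (\<phi>inv s0 x) \<noteq> 0"
    using S.exists_bounded_functional_nonzero[OF xs xs0] by metis
  have f0: "f (vzero (fibre U s0)) = 0"
    using f(2)[OF S.zero_closed, of 0] by (simp add: S.scale_zero S.zero_closed)

  \<comment> \<open>The index \<open>None\<close> carries the additional component in the fibre at \<open>s0\<close>.\<close>
  define I where "I = insert None (Some ` T)"
  define E where "E i = (case i of None \<Rightarrow> fibre U s0 | Some t \<Rightarrow> fibre U t)" for i
  define r where "r y = (\<lambda>t\<in>T. y (Some t))" for y :: "'t option \<Rightarrow> 'a"
  define C where "C = {y \<in> (\<Pi>\<^sub>E i\<in>I. vcarrier (E i)). r y \<in> vcarrier B}"
  define Y where "Y = sup_space I E C"
  define act where "act b y = (\<lambda>i\<in>I. case i of None \<Rightarrow> vscale (fibre U s0) (f (b s0)) (y (Some s0))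
    | Some t \<Rightarrow> amult (fibre U t) (b t) (y (Some t)))" for b y
  have E: "E None = fibre U s0" "\<And>t. E (Some t) = fibre U t" by (simp_all add: E_def)
  have I: "None \<in> I" "\<And>t. Some t \<in> I \<longleftrightarrow> t \<in> T" by (auto simp: I_def)
  have ball_I: "(\<forall>i\<in>I. P i) \<longleftrightarrow> P None \<and> (\<forall>t\<in>T. P (Some t))" for P by (auto simp: I_def)
  have E_banach: "banach_space (E i)" if "i \<in> I" for i
    using that fibre_banach s0T by (auto simp: I_def E)
  have r_apply: "r y t = y (Some t)" if "t \<in> T" for y t using that by (simp add: r_def)
  have r_ops: "r (\<lambda>i\<in>I. vadd (E i) (x i) (y i)) = vadd B (r x) (r y)"
    "r (\<lambda>i\<in>I. vscale (E i) c (x i)) = vscale B c (r x)"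
    "r (\<lambda>i\<in>I. vzero (E i)) = vzero B" for x y c
    by (auto simp: r_def field_algebra_simps sec_add_def sec_scale_def sec_zero_def I E)
  have CD: "y \<in> (\<Pi>\<^sub>E i\<in>I. vcarrier (E i))" "r y \<in> vcarrier B" if "y \<in> C" for y
    using that by (auto simp: C_def)
  have C_fibre: "y None \<in> vcarrier (fibre U s0)" "t \<in> T \<Longrightarrow> y (Some t) \<in> vcarrier (fibre U t)"
    if "y \<in> C" for y t
    using CD(1)[OF that] I E by (metis PiE_mem)+
  have C_bounded: "bounded_family I E y" if y: "y \<in> C" for y
  proof -
    obtain c where c: "\<And>t. t \<in> T \<Longrightarrow> vnorm (fibre U t) (r y t) \<le> c"
      using bounded_section[OF CD(2)[OF y]] unfolding bounded_family_def by blast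
    then have "\<forall>i\<in>I. vnorm (E i) (y i) \<le> max c (vnorm (fibre U s0) (y None))"
      unfolding ball_I E by (auto simp: r_apply le_max_iff_disj)
    then show ?thesis unfolding bounded_family_def by blast
  qed
  have fam: "sup_normed_family I E Y"
    unfolding Y_def
  proof (rule sup_normed_family_sup_space)
    show "x \<in> (\<Pi>\<^sub>E i\<in>I. vcarrier (E i)) \<and> bounded_family I E x" if "x \<in> C" for x
      using CD(1) C_bounded that by blast
    show "(\<lambda>i\<in>I. vzero (E i)) \<in> C"
      using banach_space.zero_closed[OF E_banach] by (auto simp: C_def r_ops algebra.zero_mem)
    show "(\<lambda>i\<in>I. vadd (E i) (x i) (y i)) \<in> C" if "x \<in> C" "y \<in> C" for x y
      using that by (auto simp: C_def r_ops algebra.add_mem intro!: banach_space.add_closed[OF E_banach] intro: PiE_mem)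
    show "(\<lambda>i\<in>I. vscale (E i) c (x i)) \<in> C" if "x \<in> C" for x c
      using that by (auto simp: C_def r_ops algebra.scale_mem intro!: banach_space.scale_closed[OF E_banach] intro: PiE_mem)
    show "x \<in> C" if x: "x \<in> (\<Pi>\<^sub>E i\<in>I. vcarrier (E i))" and b: "bounded_family I E x"
      and lim: "\<And>e. e > 0 \<Longrightarrow> \<exists>y\<in>C. \<forall>i\<in>I. vdist (E i) (x i) (y i) \<le> e" for x
    proof -
      have "r x \<in> vcarrier B"
      proof (rule algebra.limit_mem)
        show "r x \<in> fibre_prod T (fibre U)" using PiE_mem[OF x] I(2) E(2) by (fastforce simp: r_def)
        show "bounded_family T (fibre U) (r x)"
          using b unfolding bounded_family_def ball_I by (auto simp: r_apply E)
        show "\<exists>y\<in>vcarrier B. \<forall>i\<in>T. vdist (fibre U i) (r x i) (y i) \<le> e" if e: "e > 0" for e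
        proof -
          obtain y where "y \<in> C" "\<forall>i\<in>I. vdist (E i) (x i) (y i) \<le> e" using lim[OF e] by blast
          then show ?thesis using CD(2) unfolding ball_I by (intro bexI[of _ "r y"]) (auto simp: r_apply E)
        qed
      qed
      then show ?thesis using x by (simp add: C_def)
    qed
  qed (rule E_banach)
  interpret Y: sup_normed_family I E Y by (rule fam)
  have Y_carrier: "vcarrier Y = C" by (simp add: Y_def)
  have Y_eqI: "x = y" if "x \<in> C" "y \<in> C" "x None = y None" "\<And>t. t \<in> T \<Longrightarrow> x (Some t) = y (Some t)" for x y
    using that Y.mem_eqI[of x y] by (auto simp: Y_carrier I_def)
  have act_apply: "act b y None = vscale (fibre U s0) (f (b s0)) (y (Some s0))"
    "t \<in> T \<Longrightarrow> act b y (Some t) = amult (fibre U t) (b t) (y (Some t))" for b y t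
    by (simp_all add: act_def I)
  have r_act: "r (act b y) = amult B b (r y)" for b y
    by (auto simp: r_def field_algebra_simps sec_mult_def act_apply)
  have act_C: "act b y \<in> C" if b: "b \<in> vcarrier B" and y: "y \<in> C" for b y
  proof -
    have "act b y i \<in> vcarrier (E i)" if "i \<in> I" for i
      using that banach_algebra.mult_closed[OF fibre_algebra algebra.mem[OF b] C_fibre(2)[OF y]]
        S.scale_closed[OF C_fibre(2)[OF y s0T]] by (auto simp: I_def E act_apply)
    moreover have "act b y \<in> extensional I" by (simp add: act_def)
    ultimately show ?thesis
      using field_algebra_mult_closed[OF b CD(2)[OF y]] by (auto simp: C_def r_act PiE_iff)
  qed
  note simps = act_apply act_C algebra.mem algebra.add_mem algebra.scale_mem algebra.apply_simps
    field_algebra_mult_apply field_algebra_mult_closed C_fibre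
    Y.add_mem[unfolded Y_carrier] Y.scale_mem[unfolded Y_carrier]
    Y.apply_simps(1,2)[OF I(1), unfolded E] Y.apply_simps(1,2)[OF I(2)[THEN iffD2], unfolded E]
    s0T f(1,2) S.mult_closed S.scale_closed S.add_closed
  have mod: "left_banach_module B Y act"
  proof (intro left_banach_module.intro Y.banach_space left_banach_module_axioms.intro; unfold Y_carrier)
    fix a b x y c assume a: "a \<in> vcarrier B" and y: "y \<in> C"
    show "act a y \<in> C" using a y by (rule act_C)
    show "act (vscale B c a) y = vscale Y c (act a y)"
      using a y by (intro Y_eqI)
        (simp_all add: simps S.scale_scale banach_algebra.mult_scale_left[OF fibre_algebra])
    show "act a (vscale Y c y) = vscale Y c (act a y)"
      using a y by (intro Y_eqI)
        (simp_all add: simps S.scale_scale mult.commute banach_algebra.mult_scale_right[OF fibre_algebra])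
    show "act a (vadd Y x y) = vadd Y (act a x) (act a y)" if "x \<in> C"
      using a y that by (intro Y_eqI)
        (simp_all add: simps S.scale_add_right banach_algebra.mult_add_right[OF fibre_algebra])
    assume b: "b \<in> vcarrier B"
    show "act (vadd B a b) y = vadd Y (act a y) (act b y)"
      using a b y by (intro Y_eqI)
        (simp_all add: simps S.scale_add_left banach_algebra.mult_add_left[OF fibre_algebra])
    show "act (amult B a b) y = act a (act b y)"
      using a b y by (intro Y_eqI)
        (simp_all add: simps zero' f0 S.scale_zero S.scale_vzero banach_algebra.mult_assoc[OF fibre_algebra])
  next
    have "vnorm Y (act a y) \<le> 2 * vnorm B a * vnorm Y y" if a: "a \<in> vcarrier B" and y: "y \<in> C" for a y
    proof -
      have yn: "vnorm (fibre U t) (y (Some t)) \<le> vnorm Y y" if "t \<in> T" for t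
        using Y.norm_le[of y "Some t"] y that by (simp add: Y_carrier I E)
      have n: "0 \<le> vnorm B a" "0 \<le> vnorm Y y"
        using algebra.norm_nonneg[OF a] Y.norm_nonneg[of y] y by (auto simp: Y_carrier)
      have "vnorm (fibre U s0) (act a y None) = cmod (f (a s0)) * vnorm (fibre U s0) (y (Some s0))"
        using a y by (simp add: simps S.norm_scale)
      also have "\<dots> \<le> (2 * vnorm B a) * vnorm Y y"
        using a y n f(3)[OF algebra.mem[OF a s0T]] algebra.norm_le[OF a s0T] yn[OF s0T]
        by (intro mult_mono) (auto simp: simps intro: S.norm_nonneg)
      finally have 1: "vnorm (fibre U s0) (act a y None) \<le> 2 * vnorm B a * vnorm Y y" .
      have 2: "vnorm (fibre U t) (act a y (Some t)) \<le> 2 * vnorm B a * vnorm Y y" if t: "t \<in> T" for t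
      proof -
        have "vnorm (fibre U t) (act a y (Some t)) \<le> vnorm B a * vnorm (fibre U t) (y (Some t))"
          using field_algebra_norm_mult_le[OF a t] y t by (simp add: simps)
        also have "\<dots> \<le> vnorm B a * vnorm Y y" using yn[OF t] n by (intro mult_left_mono)
        also have "\<dots> \<le> 2 * vnorm B a * vnorm Y y" using n by simp
        finally show ?thesis .
      qed
      show ?thesis
        using a y n 1 2 by (subst Y.norm_le_iff) (auto simp: Y_carrier act_C ball_I E)
    qed
    then show "\<exists>K. \<forall>a\<in>vcarrier B. \<forall>y\<in>C. vnorm Y (act a y) \<le> K * vnorm B a * vnorm Y y" by blast
  qed
  have r_Y: "r (vadd Y x y) = vadd B (r x) (r y)" "r (vscale Y c x) = vscale B c (r x)" for x y c
    by (simp_all add: Y_def sup_space_def r_ops)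
  have r_mor: "left_module_morphism B Y act B (amult B) r"
    unfolding left_module_morphism_def banach_morphism_def linear_map_def Y_carrier
  proof (intro conjI ballI allI exI)
    show "vnorm B (r y) \<le> 1 * vnorm Y y" if y: "y \<in> C" for y
    proof -
      have "vnorm (fibre U t) (r y t) \<le> vnorm Y y" if "t \<in> T" for t
        using Y.norm_le[of y "Some t"] y that by (simp add: Y_carrier r_apply I E)
      then show ?thesis
        using Y.norm_nonneg[of y] y by (simp add: algebra.norm_le_iff[OF CD(2)[OF y]] Y_carrier)
    qed
  qed (simp_all add: r_Y CD r_act)
  define \<psi> where "\<psi> b = (\<lambda>i\<in>I. case i of None \<Rightarrow> vzero (fibre U s0) | Some t \<Rightarrow> b t)" for b
  have \<psi>_apply: "\<psi> b None = vzero (fibre U s0)" "t \<in> T \<Longrightarrow> \<psi> b (Some t) = b t" for b t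
    by (simp_all add: \<psi>_def I)
  have r_\<psi>: "r (\<psi> b) = b" if "b \<in> vcarrier B" for b
    using algebra.subset[OF that] by (auto simp: r_def \<psi>_apply PiE_def extensional_def)
  have \<psi>_C: "\<psi> b \<in> C" if b: "b \<in> vcarrier B" for b
  proof -
    have "\<psi> b i \<in> vcarrier (E i)" if "i \<in> I" for i
      using that algebra.mem[OF b] S.zero_closed by (auto simp: I_def E \<psi>_apply)
    moreover have "\<psi> b \<in> extensional I" by (simp add: \<psi>_def)
    ultimately show ?thesis using b by (auto simp: C_def r_\<psi> PiE_iff)
  qed
  have \<psi>_mor: "banach_morphism B Y \<psi>"
    unfolding banach_morphism_def linear_map_def Y_carrier
  proof (intro conjI ballI allI exI)
    show "vnorm Y (\<psi> b) \<le> 1 * vnorm B b" if b: "b \<in> vcarrier B" for b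
      using algebra.norm_le[OF b] algebra.norm_nonneg[OF b] \<psi>_C[OF b]
      by (subst Y.norm_le_iff) (auto simp: Y_carrier ball_I E \<psi>_apply S.norm_zero)
    show "\<psi> (vadd B a b) = vadd Y (\<psi> a) (\<psi> b)" if "a \<in> vcarrier B" "b \<in> vcarrier B" for a b
      using that by (intro Y_eqI) (simp_all add: simps \<psi>_C \<psi>_apply S.add_zero S.zero_closed)
    show "\<psi> (vscale B c b) = vscale Y c (\<psi> b)" if "b \<in> vcarrier B" for b c
      using that by (intro Y_eqI) (simp_all add: simps \<psi>_C \<psi>_apply S.scale_vzero)
  qed (rule \<psi>_C)
  obtain \<rho> where \<rho>: "left_module_morphism B B (amult B) Y act \<rho>" "\<And>p. p \<in> vcarrier B \<Longrightarrow> r (\<rho> p) = p"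
    using left_projective_section[OF banach_algebra_field_algebra proj mod r_mor \<psi>_mor] r_\<psi> by blast
  obtain g where g: "bump g" "g s0 = 1"
    using exists_bump[of "{s0}"] s0 s0T by (metis compactin_sing empty_subsetI insert_subset singletonI)
  define a where "a = bump_section g x"
  have a: "a \<in> vcarrier B" unfolding a_def by (rule bump_section_mem[OF g(1) x(1)])
  have a_s0: "a s0 = \<phi>inv s0 x" using g(2) xs by (simp add: a_def bump_section_apply[OF s0] S.scale_one)
  \<comment> \<open>The zero section is written as \<open>0 a\<close>, so that linearity of \<open>\<rho>\<close> applies to it directly.\<close>
  have "amult B a a = bump_section (\<lambda>t. g t * g t) (vzero A)"
    unfolding a_def using x(1) by (simp add: bump_section_mult zero)
  also have "\<dots> = vscale B 0 a"
  proof (rule algebra.mem_eqI)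
    show "bump_section (\<lambda>t. g t * g t) (vzero A) \<in> vcarrier B"
      using g(1) by (intro bump_section_mem bump_mult model.zero_closed)
    fix t assume t: "t \<in> T"
    interpret F: banach_space "fibre U t" by (rule fibre_banach[OF t])
    have "\<phi>inv t (vzero A) = vzero (fibre U t)" if "t \<in> G"
      using \<phi>inv_scale[OF that model.zero_closed, of 0] \<phi>inv_mem[OF that model.zero_closed]
      by (simp add: model.scale_zero model.zero_closed F.scale_zero)
    then show "bump_section (\<lambda>t. g t * g t) (vzero A) t = vscale B 0 a t"
      using t a by (simp add: simps F.scale_zero bump_section_def F.scale_vzero)
  qed (use a in \<open>simp add: algebra.scale_mem\<close>)
  finally have aa: "amult B a a = vscale B 0 a" .
  have \<rho>a: "\<rho> a \<in> C" "\<rho> (amult B a a) = act a (\<rho> a)" "\<rho> (vscale B 0 a) = vscale Y 0 (\<rho> a)"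
    using \<rho>(1) a by (auto simp: left_module_morphism_def banach_morphism_def linear_map_def Y_carrier)
  have "act a (\<rho> a) None = vscale Y 0 (\<rho> a) None" using \<rho>a(2,3) aa by simp
  then have "vscale (fibre U s0) (f (\<phi>inv s0 x)) (\<rho> a (Some s0)) = vzero (fibre U s0)"
    using \<rho>a(1) by (simp add: simps a_s0 S.scale_zero)
  moreover have "\<rho> a (Some s0) = \<phi>inv s0 x" using \<rho>(2)[OF a] r_apply[OF s0T, of "\<rho> a"] a_s0 by simp
  ultimately have "cmod (f (\<phi>inv s0 x)) * vnorm (fibre U s0) (\<phi>inv s0 x) = 0"
    using S.norm_scale[OF xs] S.norm_zero by metis
  then show False using f(4) xs0 S.norm_eq_zero[OF xs] by simp
qed

end

section \<open>The module of kernels\<close>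

context trivialized_field
begin

text \<open>
  Kernels \<open>y(s, t)\<close> take their values in the fibre at \<open>s\<close>; then \<open>B\<close> acts by pointwise
  multiplication, and no trivialization enters the action. Off the diagonal they are defined over
  \<open>G\<close> only; the whole diagonal is included, for the diagonal of a kernel has to be an arbitrary
  element of \<open>B\<close>.
\<close>

definition pairs :: "('t \<times> 't) set" where
  "pairs = {(s, t). s \<in> T \<and> t \<in> T \<and> (s = t \<or> s \<in> G \<and> t \<in> G)}"

definition pair_fibre :: "'t \<times> 't \<Rightarrow> 'a nalgebra" where
  "pair_fibre p = fibre U (fst p)"

definition diagonal :: "('t \<times> 't \<Rightarrow> 'a) \<Rightarrow> 't \<Rightarrow> 'a" where
  "diagonal y = (\<lambda>t\<in>T. y (t, t))"

text \<open>
  Continuity at the diagonal in each variable. Comparing with the value at \<open>(s, s)\<close> in the first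
  case keeps both values in the fibre at \<open>s\<close>. The condition compares only values with the same
  first variable, so that the action of \<open>B\<close> preserves it.
\<close>

definition near_diagonal :: "('t \<times> 't \<Rightarrow> 'a) \<Rightarrow> bool" where
  "near_diagonal y \<longleftrightarrow> (\<forall>t\<in>G. \<forall>e>0. \<exists>N. openin (base U) N \<and> t \<in> N \<and> N \<subseteq> G \<and>
     (\<forall>s\<in>N. vdist (fibre U s) (y (s, t)) (y (s, s)) \<le> e \<and>
            vdist (fibre U t) (y (t, s)) (y (t, t)) \<le> e))"

definition vanishes_right :: "('t \<times> 't \<Rightarrow> 'a) \<Rightarrow> bool" where
  "vanishes_right y \<longleftrightarrow> (\<forall>e>0. \<exists>K. compactin (base U) K \<and>
     (\<forall>s t. (s, t) \<in> pairs \<longrightarrow> t \<notin> K \<longrightarrow> vnorm (fibre U s) (y (s, t)) \<le> e))"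

definition kernels :: "('t \<times> 't \<Rightarrow> 'a) set" where
  "kernels = {y \<in> (\<Pi>\<^sub>E p\<in>pairs. vcarrier (pair_fibre p)). bounded_family pairs pair_fibre y \<and>
     diagonal y \<in> vcarrier B \<and> near_diagonal y \<and> vanishes_right y}"

definition kernel_space :: "('t \<times> 't \<Rightarrow> 'a) nspace" where
  "kernel_space = sup_space pairs pair_fibre kernels"

definition kernel_act :: "('t \<Rightarrow> 'a) \<Rightarrow> ('t \<times> 't \<Rightarrow> 'a) \<Rightarrow> 't \<times> 't \<Rightarrow> 'a" where
  "kernel_act b y = (\<lambda>p\<in>pairs. amult (pair_fibre p) (b (fst p)) (y p))"

lemma pairs_iff: "(s, t) \<in> pairs \<longleftrightarrow> s \<in> T \<and> t \<in> T \<and> (s = t \<or> s \<in> G \<and> t \<in> G)"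
  by (simp add: pairs_def)

lemma pairs_diag: "t \<in> T \<Longrightarrow> (t, t) \<in> pairs"
  by (simp add: pairs_iff)

lemma pairs_G: "s \<in> G \<Longrightarrow> t \<in> G \<Longrightarrow> (s, t) \<in> pairs"
  by (simp add: pairs_iff G_subset)

lemma pairs_fst: "p \<in> pairs \<Longrightarrow> fst p \<in> T"
  by (auto simp: pairs_def)

lemma pair_fibre_algebra: "p \<in> pairs \<Longrightarrow> banach_algebra (pair_fibre p)"
  using fibre_algebra by (auto simp: pairs_def pair_fibre_def)

lemma pair_fibre_banach: "p \<in> pairs \<Longrightarrow> banach_space (pair_fibre p)"
  using pair_fibre_algebra banach_algebra.axioms(1) by blast

lemma near_diagonalD:
  assumes "near_diagonal y" "t \<in> G" "e > 0"
  obtains N where "openin (base U) N" "t \<in> N" "N \<subseteq> G"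
    "\<And>s. s \<in> N \<Longrightarrow> vdist (fibre U s) (y (s, t)) (y (s, s)) \<le> e"
    "\<And>s. s \<in> N \<Longrightarrow> vdist (fibre U t) (y (t, s)) (y (t, t)) \<le> e"
  using assms unfolding near_diagonal_def by meson

text \<open>
  This domination principle and the next one treat sums, scalar multiples, module multiples and
  uniform limits alike. The error \<open>e\<close> is needed for limits, where \<open>x\<close> and \<open>y\<close> depend on it.
\<close>

lemma near_diagonal_dominated:
  assumes "\<And>e. e > 0 \<Longrightarrow> \<exists>x y. near_diagonal x \<and> near_diagonal y \<and> (\<exists>c>0. \<forall>s t t'.
      (s, t) \<in> pairs \<longrightarrow> (s, t') \<in> pairs \<longrightarrow>
      vdist (fibre U s) (z (s, t)) (z (s, t')) \<le>
        c * (vdist (fibre U s) (x (s, t)) (x (s, t')) + vdist (fibre U s) (y (s, t)) (y (s, t'))) + e)"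
  shows "near_diagonal z"
  unfolding near_diagonal_def
proof (intro ballI allI impI)
  fix t and e :: real assume t: "t \<in> G" and e: "e > 0"
  then obtain x y c where x: "near_diagonal x" and y: "near_diagonal y" and c: "c > 0"
    and z: "\<And>s t t'. (s, t) \<in> pairs \<Longrightarrow> (s, t') \<in> pairs \<Longrightarrow> vdist (fibre U s) (z (s, t)) (z (s, t')) \<le>
      c * (vdist (fibre U s) (x (s, t)) (x (s, t')) + vdist (fibre U s) (y (s, t)) (y (s, t'))) + e / 2"
    using assms[of "e / 2"] by (metis half_gt_zero)
  define d where "d = e / 4 / c"
  have d: "d > 0" using e c by (simp add: d_def)
  obtain N where N: "openin (base U) N" "t \<in> N" "N \<subseteq> G"
    "\<And>s. s \<in> N \<Longrightarrow> vdist (fibre U s) (x (s, t)) (x (s, s)) \<le> d"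
    "\<And>s. s \<in> N \<Longrightarrow> vdist (fibre U t) (x (t, s)) (x (t, t)) \<le> d"
    using near_diagonalD[OF x t d] by metis
  obtain M where M: "openin (base U) M" "t \<in> M" "M \<subseteq> G"
    "\<And>s. s \<in> M \<Longrightarrow> vdist (fibre U s) (y (s, t)) (y (s, s)) \<le> d"
    "\<And>s. s \<in> M \<Longrightarrow> vdist (fibre U t) (y (t, s)) (y (t, t)) \<le> d"
    using near_diagonalD[OF y t d] by metis
  have small: "c * (p + q) + e / 2 \<le> e" if "p \<le> d" "q \<le> d" for p q
  proof -
    have "c * (p + q) \<le> c * (2 * d)" using that c by (intro mult_left_mono) auto
    also have "\<dots> = e / 2" using c by (simp add: d_def)
    finally show ?thesis by simp
  qed
  have "vdist (fibre U s) (z (s, t)) (z (s, s)) \<le> e \<and> vdist (fibre U t) (z (t, s)) (z (t, t)) \<le> e"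
    if s: "s \<in> N \<inter> M" for s
  proof -
    have sG: "s \<in> G" using s N(3) by blast
    have "vdist (fibre U s) (z (s, t)) (z (s, s)) \<le> e"
      using order_trans[OF z[OF pairs_G[OF sG t] pairs_G[OF sG sG]] small] N(4) M(4) s by blast
    moreover have "vdist (fibre U t) (z (t, s)) (z (t, t)) \<le> e"
      using order_trans[OF z[OF pairs_G[OF t sG] pairs_G[OF t t]] small] N(5) M(5) s by blast
    ultimately show ?thesis ..
  qed
  then show "\<exists>N. openin (base U) N \<and> t \<in> N \<and> N \<subseteq> G \<and>
     (\<forall>s\<in>N. vdist (fibre U s) (z (s, t)) (z (s, s)) \<le> e \<and> vdist (fibre U t) (z (t, s)) (z (t, t)) \<le> e)"
    using N(1-3) M(1-3) by (intro exI[of _ "N \<inter> M"]) (auto intro: openin_Int)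
qed

lemma vanishes_right_dominated:
  assumes "\<And>e. e > 0 \<Longrightarrow> \<exists>x y. vanishes_right x \<and> vanishes_right y \<and> (\<exists>c>0. \<forall>s t.
      (s, t) \<in> pairs \<longrightarrow> vnorm (fibre U s) (z (s, t)) \<le>
        c * (vnorm (fibre U s) (x (s, t)) + vnorm (fibre U s) (y (s, t))) + e)"
  shows "vanishes_right z"
  unfolding vanishes_right_def
proof (intro allI impI)
  fix e :: real assume e: "e > 0"
  then obtain x y c where x: "vanishes_right x" and y: "vanishes_right y" and c: "c > 0"
    and z: "\<And>s t. (s, t) \<in> pairs \<Longrightarrow> vnorm (fibre U s) (z (s, t)) \<le>
      c * (vnorm (fibre U s) (x (s, t)) + vnorm (fibre U s) (y (s, t))) + e / 2"
    using assms[of "e / 2"] by (metis half_gt_zero)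
  define d where "d = e / 4 / c"
  have d: "d > 0" using e c by (simp add: d_def)
  obtain K where K: "compactin (base U) K"
    "\<And>s t. (s, t) \<in> pairs \<Longrightarrow> t \<notin> K \<Longrightarrow> vnorm (fibre U s) (x (s, t)) \<le> d"
    using x d unfolding vanishes_right_def by meson
  obtain L where L: "compactin (base U) L"
    "\<And>s t. (s, t) \<in> pairs \<Longrightarrow> t \<notin> L \<Longrightarrow> vnorm (fibre U s) (y (s, t)) \<le> d"
    using y d unfolding vanishes_right_def by meson
  have "vnorm (fibre U s) (z (s, t)) \<le> e" if st: "(s, t) \<in> pairs" "t \<notin> K \<union> L" for s t
  proof -
    have "c * (vnorm (fibre U s) (x (s, t)) + vnorm (fibre U s) (y (s, t))) \<le> c * (d + d)"
      using K(2)[OF st(1)] L(2)[OF st(1)] st(2) c by (intro mult_left_mono add_mono) auto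
    also have "\<dots> = e / 2" using c by (simp add: d_def)
    finally show ?thesis using z[OF st(1)] by linarith
  qed
  then show "\<exists>K. compactin (base U) K \<and> (\<forall>s t. (s, t) \<in> pairs \<longrightarrow> t \<notin> K \<longrightarrow> vnorm (fibre U s) (z (s, t)) \<le> e)"
    using compactin_Un[OF K(1) L(1)] by blast
qed

lemma kernelsD:
  assumes "y \<in> kernels"
  shows "y \<in> (\<Pi>\<^sub>E p\<in>pairs. vcarrier (pair_fibre p))" "bounded_family pairs pair_fibre y"
    "diagonal y \<in> vcarrier B" "near_diagonal y" "vanishes_right y"
  using assms by (simp_all add: kernels_def)

lemma kernel_fibre:
  "y \<in> (\<Pi>\<^sub>E p\<in>pairs. vcarrier (pair_fibre p)) \<Longrightarrow> (s, t) \<in> pairs \<Longrightarrow> y (s, t) \<in> vcarrier (fibre U s)"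
  by (auto simp: pair_fibre_def dest!: PiE_mem)

lemma diagonal_ops:
  "diagonal (\<lambda>p\<in>pairs. vadd (pair_fibre p) (x p) (y p)) = vadd B (diagonal x) (diagonal y)"
  "diagonal (\<lambda>p\<in>pairs. vscale (pair_fibre p) c (x p)) = vscale B c (diagonal x)"
  "diagonal (\<lambda>p\<in>pairs. vzero (pair_fibre p)) = vzero B"
  "diagonal (kernel_act b y) = amult B b (diagonal y)"
  by (auto simp: diagonal_def field_algebra_simps sec_add_def sec_scale_def sec_zero_def sec_mult_def
      pair_fibre_def pairs_diag kernel_act_def)

lemma kernel_zero: "(\<lambda>p\<in>pairs. vzero (pair_fibre p)) \<in> kernels"
proof -
  let ?z = "\<lambda>p\<in>pairs. vzero (pair_fibre p)"
  have n: "vnorm (fibre U s) (?z (s, t)) = 0" if "(s, t) \<in> pairs" for s t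
    using that banach_space.norm_zero[OF fibre_banach[of s]] by (auto simp: pair_fibre_def pairs_iff)
  have "bounded_family pairs pair_fibre ?z"
    unfolding bounded_family_def using n by (intro exI[of _ 0]) (auto simp: pair_fibre_def)
  moreover have "vanishes_right ?z"
    unfolding vanishes_right_def using n by (intro allI impI exI[of _ "{}"]) auto
  moreover have "near_diagonal ?z"
    unfolding near_diagonal_def
  proof (intro ballI allI impI)
    fix t and e :: real assume t: "t \<in> G" and e: "e > 0"
    have "vdist (fibre U s) (vzero (fibre U s)) (vzero (fibre U s)) \<le> e" if "s \<in> G" for s
    proof -
      interpret F: banach_space "fibre U s" by (rule fibre_banach[OF G_subset[OF that]])
      show ?thesis using e by (simp add: F.zero_closed)
    qed
    then show "\<exists>N. openin (base U) N \<and> t \<in> N \<and> N \<subseteq> G \<and>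
       (\<forall>s\<in>N. vdist (fibre U s) (?z (s, t)) (?z (s, s)) \<le> e \<and> vdist (fibre U t) (?z (t, s)) (?z (t, t)) \<le> e)"
      using t open_G by (intro exI[of _ G]) (auto simp: pairs_G pair_fibre_def)
  qed
  moreover have "?z \<in> (\<Pi>\<^sub>E p\<in>pairs. vcarrier (pair_fibre p))"
    by (auto intro!: banach_space.zero_closed[OF pair_fibre_banach])
  ultimately show ?thesis by (simp add: kernels_def diagonal_ops algebra.zero_mem)
qed

lemma kernel_add:
  assumes x: "x \<in> kernels" and y: "y \<in> kernels"
  shows "(\<lambda>p\<in>pairs. vadd (pair_fibre p) (x p) (y p)) \<in> kernels"
proof -
  let ?z = "\<lambda>p\<in>pairs. vadd (pair_fibre p) (x p) (y p)"
  note xf = kernel_fibre[OF kernelsD(1)[OF x]] and yf = kernel_fibre[OF kernelsD(1)[OF y]]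
  have n: "vnorm (pair_fibre p) (?z p) \<le> vnorm (pair_fibre p) (x p) + vnorm (pair_fibre p) (y p)" if "p \<in> pairs" for p
    using that PiE_mem[OF kernelsD(1)[OF x]] PiE_mem[OF kernelsD(1)[OF y]]
    by (simp add: banach_space.norm_triangle[OF pair_fibre_banach])
  obtain c d where "\<forall>p\<in>pairs. vnorm (pair_fibre p) (x p) \<le> c" "\<forall>p\<in>pairs. vnorm (pair_fibre p) (y p) \<le> d"
    using kernelsD(2)[OF x] kernelsD(2)[OF y] unfolding bounded_family_def by blast
  then have "\<forall>p\<in>pairs. vnorm (pair_fibre p) (?z p) \<le> c + d" using n by force
  then have "bounded_family pairs pair_fibre ?z" unfolding bounded_family_def by blast
  moreover have "near_diagonal ?z"
  proof (rule near_diagonal_dominated)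
    fix e :: real assume e: "e > 0"
    have "vdist (fibre U s) (?z (s, t)) (?z (s, t')) \<le>
        vdist (fibre U s) (x (s, t)) (x (s, t')) + vdist (fibre U s) (y (s, t)) (y (s, t'))"
      if "(s, t) \<in> pairs" "(s, t') \<in> pairs" for s t t'
      using that xf yf banach_space.vdist_add[OF fibre_banach[of s]] by (auto simp: pair_fibre_def pairs_iff)
    then show "\<exists>x y. near_diagonal x \<and> near_diagonal y \<and> (\<exists>c>0. \<forall>s t t'.
      (s, t) \<in> pairs \<longrightarrow> (s, t') \<in> pairs \<longrightarrow> vdist (fibre U s) (?z (s, t)) (?z (s, t')) \<le>
        c * (vdist (fibre U s) (x (s, t)) (x (s, t')) + vdist (fibre U s) (y (s, t)) (y (s, t'))) + e)"
      using kernelsD(4)[OF x] kernelsD(4)[OF y] e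
      by (intro exI[of _ x] exI[of _ y] conjI exI[of _ 1]) (force simp del: restrict_apply)+
  qed
  moreover have "vanishes_right ?z"
  proof (rule vanishes_right_dominated)
    fix e :: real assume e: "e > 0"
    show "\<exists>x y. vanishes_right x \<and> vanishes_right y \<and> (\<exists>c>0. \<forall>s t.
      (s, t) \<in> pairs \<longrightarrow> vnorm (fibre U s) (?z (s, t)) \<le>
        c * (vnorm (fibre U s) (x (s, t)) + vnorm (fibre U s) (y (s, t))) + e)"
      using kernelsD(5)[OF x] kernelsD(5)[OF y] e n[unfolded pair_fibre_def]
      by (intro exI[of _ x] exI[of _ y] conjI exI[of _ 1]) (force simp del: restrict_apply simp: pair_fibre_def)+
  qed
  moreover have "?z \<in> (\<Pi>\<^sub>E p\<in>pairs. vcarrier (pair_fibre p))"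
    using PiE_mem[OF kernelsD(1)[OF x]] PiE_mem[OF kernelsD(1)[OF y]]
    by (auto intro!: banach_space.add_closed[OF pair_fibre_banach])
  ultimately show ?thesis
    using algebra.add_mem[OF kernelsD(3)[OF x] kernelsD(3)[OF y]] by (simp add: kernels_def diagonal_ops)
qed

text \<open>
  Applied to scalar multiples and to the action of \<open>B\<close>, both of which multiply each fibre by an
  operator of norm at most \<open>c\<close> that depends on the first variable only.
\<close>

lemma kernel_image:
  assumes y: "y \<in> kernels" and c: "c > 0"
    and mem: "\<And>p. p \<in> pairs \<Longrightarrow> z p \<in> vcarrier (pair_fibre p)" and ext: "z \<in> extensional pairs"
    and norm: "\<And>p. p \<in> pairs \<Longrightarrow> vnorm (pair_fibre p) (z p) \<le> c * vnorm (pair_fibre p) (y p)"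
    and dist: "\<And>s t t'. (s, t) \<in> pairs \<Longrightarrow> (s, t') \<in> pairs \<Longrightarrow>
      vdist (fibre U s) (z (s, t)) (z (s, t')) \<le> c * vdist (fibre U s) (y (s, t)) (y (s, t'))"
    and diag: "diagonal z \<in> vcarrier B"
  shows "z \<in> kernels"
proof -
  obtain d where d: "\<forall>p\<in>pairs. vnorm (pair_fibre p) (y p) \<le> d"
    using kernelsD(2)[OF y] unfolding bounded_family_def by blast
  have "vnorm (pair_fibre p) (z p) \<le> c * d" if "p \<in> pairs" for p
    using norm[OF that] d that c by (meson mult_left_mono order_trans less_imp_le)
  then have "bounded_family pairs pair_fibre z" unfolding bounded_family_def by blast
  moreover have "near_diagonal z"
  proof (rule near_diagonal_dominated)
    fix e :: real assume e: "e > 0"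
    have "vdist (fibre U s) (z (s, t)) (z (s, t')) \<le>
        c * (vdist (fibre U s) (y (s, t)) (y (s, t')) + vdist (fibre U s) (y (s, t)) (y (s, t'))) + e"
      if st: "(s, t) \<in> pairs" "(s, t') \<in> pairs" for s t t'
    proof -
      interpret F: banach_space "fibre U s" using fibre_banach st by (auto simp: pairs_iff)
      have "0 \<le> c * vdist (fibre U s) (y (s, t)) (y (s, t'))" using c F.metric.nonneg by simp
      then show ?thesis using dist[OF st] e unfolding distrib_left by linarith
    qed
    then show "\<exists>x y. near_diagonal x \<and> near_diagonal y \<and> (\<exists>c>0. \<forall>s t t'.
      (s, t) \<in> pairs \<longrightarrow> (s, t') \<in> pairs \<longrightarrow> vdist (fibre U s) (z (s, t)) (z (s, t')) \<le>
        c * (vdist (fibre U s) (x (s, t)) (x (s, t')) + vdist (fibre U s) (y (s, t)) (y (s, t'))) + e)"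
      using kernelsD(4)[OF y] c by blast
  qed
  moreover have "vanishes_right z"
  proof (rule vanishes_right_dominated)
    fix e :: real assume e: "e > 0"
    have "vnorm (fibre U s) (z (s, t)) \<le>
        c * (vnorm (fibre U s) (y (s, t)) + vnorm (fibre U s) (y (s, t))) + e" if st: "(s, t) \<in> pairs" for s t
    proof -
      have "0 \<le> vnorm (fibre U s) (y (s, t))"
        using st kernel_fibre[OF kernelsD(1)[OF y] st]
        by (auto simp: pairs_iff intro: banach_space.norm_nonneg[OF fibre_banach])
      then have "0 \<le> c * vnorm (fibre U s) (y (s, t))" using c by simp
      then show ?thesis using norm[OF st] e unfolding distrib_left pair_fibre_def fst_conv by linarith
    qed
    then show "\<exists>x y. vanishes_right x \<and> vanishes_right y \<and> (\<exists>c>0. \<forall>s t.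
      (s, t) \<in> pairs \<longrightarrow> vnorm (fibre U s) (z (s, t)) \<le>
        c * (vnorm (fibre U s) (x (s, t)) + vnorm (fibre U s) (y (s, t))) + e)"
      using kernelsD(5)[OF y] c by blast
  qed
  moreover have "z \<in> (\<Pi>\<^sub>E p\<in>pairs. vcarrier (pair_fibre p))"
    using mem ext by (simp add: PiE_iff)
  ultimately show ?thesis using diag by (simp add: kernels_def)
qed

lemma kernel_scale:
  assumes x: "x \<in> kernels"
  shows "(\<lambda>p\<in>pairs. vscale (pair_fibre p) c (x p)) \<in> kernels" (is "?z \<in> _")
proof (rule kernel_image[OF x])
  show "cmod c + 1 > 0" by (simp add: add_nonneg_pos)
  note xp = PiE_mem[OF kernelsD(1)[OF x]] and xf = kernel_fibre[OF kernelsD(1)[OF x]]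
  show "?z p \<in> vcarrier (pair_fibre p)" if "p \<in> pairs" for p
    using that xp by (simp add: banach_space.scale_closed[OF pair_fibre_banach])
  show "?z \<in> extensional pairs" by simp
  show "vnorm (pair_fibre p) (?z p) \<le> (cmod c + 1) * vnorm (pair_fibre p) (x p)" if p: "p \<in> pairs" for p
    using p xp[OF p] banach_space.norm_nonneg[OF pair_fibre_banach[OF p] xp[OF p]]
    by (simp add: banach_space.norm_scale[OF pair_fibre_banach] mult_right_mono)
  show "vdist (fibre U s) (?z (s, t)) (?z (s, t')) \<le> (cmod c + 1) * vdist (fibre U s) (x (s, t)) (x (s, t'))"
    if st: "(s, t) \<in> pairs" "(s, t') \<in> pairs" for s t t'
  proof -
    interpret F: banach_space "fibre U s" using fibre_banach st by (auto simp: pairs_iff)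
    show ?thesis using st F.vdist_scale[OF xf[OF st(1)] xf[OF st(2)]] F.metric.nonneg
      by (simp add: pair_fibre_def mult_right_mono)
  qed
  show "diagonal ?z \<in> vcarrier B" using algebra.scale_mem[OF kernelsD(3)[OF x]] by (simp add: diagonal_ops)
qed

lemma kernel_act_mem:
  assumes b: "b \<in> vcarrier B" and x: "x \<in> kernels"
  shows "kernel_act b x \<in> kernels"
proof (rule kernel_image[OF x])
  have nb: "0 \<le> vnorm B b" using algebra.norm_nonneg[OF b] .
  then show "vnorm B b + 1 > 0" by simp
  note xp = PiE_mem[OF kernelsD(1)[OF x]] and xf = kernel_fibre[OF kernelsD(1)[OF x]]
  have bf: "b (fst p) \<in> vcarrier (pair_fibre p)" if "p \<in> pairs" for p
    using algebra.mem[OF b pairs_fst[OF that]] by (simp add: pair_fibre_def)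
  show "kernel_act b x p \<in> vcarrier (pair_fibre p)" if "p \<in> pairs" for p
    using that xp bf by (simp add: kernel_act_def banach_algebra.mult_closed[OF pair_fibre_algebra])
  show "kernel_act b x \<in> extensional pairs" by (simp add: kernel_act_def)
  show "vnorm (pair_fibre p) (kernel_act b x p) \<le> (vnorm B b + 1) * vnorm (pair_fibre p) (x p)" if p: "p \<in> pairs" for p
  proof -
    have "vnorm (pair_fibre p) (kernel_act b x p) \<le> vnorm B b * vnorm (pair_fibre p) (x p)"
      using field_algebra_norm_mult_le[OF b pairs_fst[OF p], of "x p"] xp[OF p] p
      by (simp add: kernel_act_def pair_fibre_def)
    then show ?thesis
      using banach_space.norm_nonneg[OF pair_fibre_banach[OF p] xp[OF p]] by (simp add: distrib_right)
  qed
  show "vdist (fibre U s) (kernel_act b x (s, t)) (kernel_act b x (s, t')) \<le>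
      (vnorm B b + 1) * vdist (fibre U s) (x (s, t)) (x (s, t'))"
    if st: "(s, t) \<in> pairs" "(s, t') \<in> pairs" for s t t'
  proof -
    have sT: "s \<in> T" using st by (simp add: pairs_iff)
    interpret F: banach_algebra "fibre U s" by (rule fibre_algebra[OF sT])
    have "vdist (fibre U s) (kernel_act b x (s, t)) (kernel_act b x (s, t')) \<le>
        vnorm (fibre U s) (b s) * vdist (fibre U s) (x (s, t)) (x (s, t'))"
      using st F.norm_mult_diff[OF algebra.mem[OF b sT] xf[OF st(1)] xf[OF st(2)]]
      by (simp add: kernel_act_def pair_fibre_def)
    also have "\<dots> \<le> (vnorm B b + 1) * vdist (fibre U s) (x (s, t)) (x (s, t'))"
      using algebra.norm_le[OF b sT] F.metric.nonneg by (intro mult_right_mono) auto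
    finally show ?thesis .
  qed
  show "diagonal (kernel_act b x) \<in> vcarrier B"
    using field_algebra_mult_closed[OF b kernelsD(3)[OF x]] by (simp add: diagonal_ops)
qed

lemma kernel_limit:
  assumes x: "x \<in> (\<Pi>\<^sub>E p\<in>pairs. vcarrier (pair_fibre p))" and bd: "bounded_family pairs pair_fibre x"
    and lim: "\<And>e. e > 0 \<Longrightarrow> \<exists>y\<in>kernels. \<forall>p\<in>pairs. vdist (pair_fibre p) (x p) (y p) \<le> e"
  shows "x \<in> kernels"
proof -
  note xf = kernel_fibre[OF x]
  have lim': "\<exists>y\<in>kernels. \<forall>s t. (s, t) \<in> pairs \<longrightarrow> vdist (fibre U s) (x (s, t)) (y (s, t)) \<le> e" if "e > 0" for e
    using lim[OF that] by (fastforce simp: pair_fibre_def)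
  have "diagonal x \<in> vcarrier B"
  proof (rule algebra.limit_mem)
    show "diagonal x \<in> fibre_prod T (fibre U)" using xf pairs_diag by (auto simp: diagonal_def)
    show "bounded_family T (fibre U) (diagonal x)"
      using bd pairs_diag unfolding bounded_family_def by (fastforce simp: diagonal_def pair_fibre_def)
    show "\<exists>y\<in>vcarrier B. \<forall>i\<in>T. vdist (fibre U i) (diagonal x i) (y i) \<le> e" if e: "e > 0" for e
    proof -
      obtain y where "y \<in> kernels" "\<forall>s t. (s, t) \<in> pairs \<longrightarrow> vdist (fibre U s) (x (s, t)) (y (s, t)) \<le> e"
        using lim'[OF e] by blast
      then show ?thesis
        using kernelsD(3) pairs_diag by (intro bexI[of _ "diagonal y"]) (auto simp: diagonal_def)
    qed
  qed
  moreover have "near_diagonal x"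
  proof (rule near_diagonal_dominated)
    fix e :: real assume e: "e > 0"
    obtain y where y: "y \<in> kernels" "\<And>s t. (s, t) \<in> pairs \<Longrightarrow> vdist (fibre U s) (x (s, t)) (y (s, t)) \<le> e / 2"
      using lim'[of "e / 2"] e by auto
    have "vdist (fibre U s) (x (s, t)) (x (s, t')) \<le>
        1 * (vdist (fibre U s) (y (s, t)) (y (s, t')) + vdist (fibre U s) (y (s, t)) (y (s, t'))) + e"
      if st: "(s, t) \<in> pairs" "(s, t') \<in> pairs" for s t t'
    proof -
      interpret F: banach_space "fibre U s" using fibre_banach st by (auto simp: pairs_iff)
      note mem = xf[OF st(1)] xf[OF st(2)] kernel_fibre[OF kernelsD(1)[OF y(1)] st(1)]
        kernel_fibre[OF kernelsD(1)[OF y(1)] st(2)]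
      have "vdist (fibre U s) (x (s, t)) (x (s, t')) \<le> e / 2 + (vdist (fibre U s) (y (s, t)) (y (s, t')) + e / 2)"
        using F.metric.triangle[OF mem(1,3,2)] F.metric.triangle[OF mem(3,4,2)] y(2)[OF st(1)]
          y(2)[OF st(2)] unfolding F.metric.commute[of "y (s, t')" "x (s, t')"]
        by linarith
      then show ?thesis
        using F.metric.nonneg[of "y (s, t)" "y (s, t')"] unfolding mult_1_left by linarith
    qed
    then show "\<exists>x' y. near_diagonal x' \<and> near_diagonal y \<and> (\<exists>c>0. \<forall>s t t'.
      (s, t) \<in> pairs \<longrightarrow> (s, t') \<in> pairs \<longrightarrow> vdist (fibre U s) (x (s, t)) (x (s, t')) \<le>
        c * (vdist (fibre U s) (x' (s, t)) (x' (s, t')) + vdist (fibre U s) (y (s, t)) (y (s, t'))) + e)"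
      using kernelsD(4)[OF y(1)] zero_less_one by blast
  qed
  moreover have "vanishes_right x"
  proof (rule vanishes_right_dominated)
    fix e :: real assume e: "e > 0"
    obtain y where y: "y \<in> kernels" "\<And>s t. (s, t) \<in> pairs \<Longrightarrow> vdist (fibre U s) (x (s, t)) (y (s, t)) \<le> e"
      using lim'[of "e"] e by auto
    have "vnorm (fibre U s) (x (s, t)) \<le>
        1 * (vnorm (fibre U s) (y (s, t)) + vnorm (fibre U s) (y (s, t))) + e" if st: "(s, t) \<in> pairs" for s t
    proof -
      interpret F: banach_space "fibre U s" using fibre_banach st by (auto simp: pairs_iff)
      show ?thesis
        using F.norm_le_vdist_add[OF xf[OF st] kernel_fibre[OF kernelsD(1)[OF y(1)] st]] y(2)[OF st]
          F.norm_nonneg[OF kernel_fibre[OF kernelsD(1)[OF y(1)] st]] unfolding mult_1_left by linarith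
    qed
    then show "\<exists>x' y. vanishes_right x' \<and> vanishes_right y \<and> (\<exists>c>0. \<forall>s t.
      (s, t) \<in> pairs \<longrightarrow> vnorm (fibre U s) (x (s, t)) \<le>
        c * (vnorm (fibre U s) (x' (s, t)) + vnorm (fibre U s) (y (s, t))) + e)"
      using kernelsD(5)[OF y(1)] zero_less_one by blast
  qed
  ultimately show ?thesis using x bd by (simp add: kernels_def)
qed

sublocale kernel: sup_normed_family pairs pair_fibre kernel_space
  unfolding kernel_space_def
proof (rule sup_normed_family_sup_space)
  show "x \<in> (\<Pi>\<^sub>E p\<in>pairs. vcarrier (pair_fibre p)) \<and> bounded_family pairs pair_fibre x" if "x \<in> kernels" for x
    using kernelsD[OF that] by blast
qed (fact pair_fibre_banach kernel_zero kernel_add kernel_scale kernel_limit)+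

lemma kernel_carrier: "vcarrier kernel_space = kernels"
  by (simp add: kernel_space_def)

lemma kernel_act_apply: "p \<in> pairs \<Longrightarrow> kernel_act b y p = amult (pair_fibre p) (b (fst p)) (y p)"
  by (simp add: kernel_act_def)

lemma kernel_module: "left_banach_module B kernel_space kernel_act"
proof (intro left_banach_module.intro kernel.banach_space left_banach_module_axioms.intro; unfold kernel_carrier)
  have mem: "b (fst p) \<in> vcarrier (pair_fibre p)" if "b \<in> vcarrier B" "p \<in> pairs" for b p
    using algebra.mem[OF that(1) pairs_fst[OF that(2)]] by (simp add: pair_fibre_def)
  have B_apply: "vadd B a b (fst p) = vadd (pair_fibre p) (a (fst p)) (b (fst p))"
    "vscale B c a (fst p) = vscale (pair_fibre p) c (a (fst p))"
    "amult B a b (fst p) = amult (pair_fibre p) (a (fst p)) (b (fst p))" if "p \<in> pairs" for a b c p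
    using pairs_fst[OF that] by (simp_all add: pair_fibre_def algebra.apply_simps field_algebra_mult_apply)
  note mems = algebra.add_mem algebra.scale_mem field_algebra_mult_closed
  note simps = kernel_act_mem kernel.add_mem[unfolded kernel_carrier]
    kernel.scale_mem[unfolded kernel_carrier] kernel_carrier kernel_act_apply kernel.apply_simps mem B_apply
    kernel.mem[unfolded kernel_carrier]
  fix a b x y c assume a: "a \<in> vcarrier B" and y: "y \<in> kernels"
  show "kernel_act a y \<in> kernels" using a y by (rule kernel_act_mem)
  show "kernel_act (vscale B c a) y = vscale kernel_space c (kernel_act a y)"
    using a y by (intro kernel.mem_eqI)
      (simp_all add: simps mems banach_algebra.mult_scale_left[OF pair_fibre_algebra])
  show "kernel_act a (vscale kernel_space c y) = vscale kernel_space c (kernel_act a y)"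
    using a y by (intro kernel.mem_eqI)
      (simp_all add: simps mems banach_algebra.mult_scale_right[OF pair_fibre_algebra])
  show "kernel_act a (vadd kernel_space x y) = vadd kernel_space (kernel_act a x) (kernel_act a y)" if "x \<in> kernels"
    using a y that by (intro kernel.mem_eqI)
      (simp_all add: simps mems banach_algebra.mult_add_right[OF pair_fibre_algebra])
  assume b: "b \<in> vcarrier B"
  show "kernel_act (vadd B a b) y = vadd kernel_space (kernel_act a y) (kernel_act b y)"
    using a b y by (intro kernel.mem_eqI)
      (simp_all add: simps mems banach_algebra.mult_add_left[OF pair_fibre_algebra])
  show "kernel_act (amult B a b) y = kernel_act a (kernel_act b y)"
    using a b y by (intro kernel.mem_eqI)
      (simp_all add: simps mems banach_algebra.mult_assoc[OF pair_fibre_algebra])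
next
  have "vnorm kernel_space (kernel_act a y) \<le> 1 * vnorm B a * vnorm kernel_space y"
    if a: "a \<in> vcarrier B" and y: "y \<in> kernels" for a y
  proof -
    have "vnorm (pair_fibre p) (kernel_act a y p) \<le> vnorm B a * vnorm kernel_space y" if p: "p \<in> pairs" for p
    proof -
      have "vnorm (pair_fibre p) (kernel_act a y p) \<le> vnorm B a * vnorm (pair_fibre p) (y p)"
        using field_algebra_norm_mult_le[OF a pairs_fst[OF p], of "y p"] PiE_mem[OF kernelsD(1)[OF y] p] p
        by (simp add: kernel_act_def pair_fibre_def)
      also have "\<dots> \<le> vnorm B a * vnorm kernel_space y"
        using y p by (intro mult_left_mono kernel.norm_le algebra.norm_nonneg[OF a]) (simp_all add: kernel_carrier)
      finally show ?thesis .
    qed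
    then show ?thesis
      using y kernel_act_mem[OF a y] algebra.norm_nonneg[OF a] kernel.norm_nonneg[of y]
      by (subst kernel.norm_le_iff) (simp_all add: kernel_carrier)
  qed
  then show "\<exists>K. \<forall>a\<in>vcarrier B. \<forall>y\<in>kernels. vnorm kernel_space (kernel_act a y) \<le> K * vnorm B a * vnorm kernel_space y"
    by blast
qed

lemma diagonal_morphism: "left_module_morphism B kernel_space kernel_act B (amult B) diagonal"
  unfolding left_module_morphism_def banach_morphism_def linear_map_def kernel_carrier
proof (intro conjI ballI allI exI)
  show "diagonal (vadd kernel_space x y) = vadd B (diagonal x) (diagonal y)"
    "diagonal (vscale kernel_space c x) = vscale B c (diagonal x)" for x y c
    by (simp_all add: kernel_space_def sup_space_def diagonal_ops)
  show "vnorm B (diagonal y) \<le> 1 * vnorm kernel_space y" if y: "y \<in> kernels" for y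
  proof -
    have "vnorm (fibre U t) (diagonal y t) \<le> vnorm kernel_space y" if "t \<in> T" for t
      using kernel.norm_le[of y "(t, t)"] y that
      by (simp add: kernel_carrier diagonal_def pairs_diag) (simp add: pair_fibre_def)
    then show ?thesis
      using kernel.norm_nonneg[of y] y by (simp add: algebra.norm_le_iff[OF kernelsD(3)[OF y]] kernel_carrier)
  qed
qed (simp_all add: kernelsD diagonal_ops)

text \<open>
  The kernel of \<open>1 \<otimes> c\<close>. It gives the linear right inverse of the restriction to the diagonal.
\<close>

definition constant_kernel :: "('t \<Rightarrow> 'a) \<Rightarrow> 't \<times> 't \<Rightarrow> 'a" where
  "constant_kernel c = (\<lambda>(s, t)\<in>pairs. if s = t then c t else \<phi>inv s (\<phi> t (c t)))"

lemma constant_kernel_diag: "t \<in> T \<Longrightarrow> constant_kernel c (t, t) = c t"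
  by (simp add: constant_kernel_def pairs_diag)

lemma constant_kernel_G:
  assumes "c \<in> vcarrier B" "s \<in> G" "t \<in> G"
  shows "constant_kernel c (s, t) = \<phi>inv s (\<phi> t (c t))"
  using assms \<phi>inv_\<phi>[OF assms(2)] algebra.mem[OF assms(1) G_subset]
  by (auto simp: constant_kernel_def pairs_G)

lemma pairs_cases:
  assumes "(s, t) \<in> pairs"
  obtains "s = t" "t \<in> T" | "s \<in> G" "t \<in> G"
  using assms by (auto simp: pairs_iff)

lemma constant_kernel_fibre:
  assumes c: "c \<in> vcarrier B" and st: "(s, t) \<in> pairs"
  shows "constant_kernel c (s, t) \<in> vcarrier (fibre U s)"
    and "vnorm (fibre U s) (constant_kernel c (s, t)) = vnorm (fibre U t) (c t)"
  using st
proof (atomize (full), cases rule: pairs_cases)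
  case 1
  then show "constant_kernel c (s, t) \<in> vcarrier (fibre U s) \<and>
      vnorm (fibre U s) (constant_kernel c (s, t)) = vnorm (fibre U t) (c t)"
    using algebra.mem[OF c] by (simp add: constant_kernel_diag)
next
  case 2
  then show "constant_kernel c (s, t) \<in> vcarrier (fibre U s) \<and>
      vnorm (fibre U s) (constant_kernel c (s, t)) = vnorm (fibre U t) (c t)"
    using algebra.mem[OF c G_subset] by (simp add: constant_kernel_G[OF c] \<phi>_mem \<phi>inv_mem \<phi>inv_norm \<phi>_norm)
qed

lemma diagonal_constant_kernel:
  assumes "c \<in> vcarrier B"
  shows "diagonal (constant_kernel c) = c"
  using algebra.subset[OF assms] by (auto simp: diagonal_def constant_kernel_diag PiE_def extensional_def)

lemma constant_kernel_mem:
  assumes c: "c \<in> vcarrier B"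
  shows "constant_kernel c \<in> kernels"
proof -
  have norm: "vnorm (pair_fibre p) (constant_kernel c p) \<le> vnorm B c" if "p \<in> pairs" for p
    using that algebra.norm_le[OF c]
    by (cases p) (auto simp: pair_fibre_def pairs_iff constant_kernel_fibre[OF c])
  have "constant_kernel c \<in> (\<Pi>\<^sub>E p\<in>pairs. vcarrier (pair_fibre p))"
    using constant_kernel_fibre(1)[OF c] by (auto simp: PiE_iff pair_fibre_def) (auto simp: constant_kernel_def)
  moreover have "bounded_family pairs pair_fibre (constant_kernel c)"
    using norm unfolding bounded_family_def by blast
  moreover have "vanishes_right (constant_kernel c)"
    unfolding vanishes_right_def
  proof (intro allI impI)
    fix e :: real assume "e > 0"
    then obtain K where K: "compactin (base U) K" "\<forall>t\<in>T - K. vnorm (fibre U t) (c t) < e"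
      using field_algebraD(2)[OF c] by blast
    then show "\<exists>K. compactin (base U) K \<and>
        (\<forall>s t. (s, t) \<in> pairs \<longrightarrow> t \<notin> K \<longrightarrow> vnorm (fibre U s) (constant_kernel c (s, t)) \<le> e)"
      by (intro exI[of _ K]) (auto simp: constant_kernel_fibre[OF c] pairs_iff intro: less_imp_le)
  qed
  moreover have "near_diagonal (constant_kernel c)"
    unfolding near_diagonal_def
  proof (intro ballI allI impI)
    fix t and e :: real assume t: "t \<in> G" and e: "e > 0"
    obtain N where N: "openin (base U) N" "t \<in> N" "N \<subseteq> G"
      "\<And>s. s \<in> N \<Longrightarrow> vdist A (\<phi> t (c t)) (\<phi> s (c s)) < e"
      using section_close[OF field_algebraD(1)[OF c] t e] by metis
    have mem: "\<phi> r (c r) \<in> vcarrier A" if "r \<in> G" for r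
      using algebra.mem[OF c G_subset[OF that]] that by (simp add: \<phi>_mem)
    have "vdist (fibre U s) (constant_kernel c (s, t)) (constant_kernel c (s, s)) \<le> e \<and>
        vdist (fibre U t) (constant_kernel c (t, s)) (constant_kernel c (t, t)) \<le> e" if s: "s \<in> N" for s
    proof -
      have sG: "s \<in> G" using s N(3) by blast
      show ?thesis
        using N(4)[OF s] sG t model.metric.commute[of "\<phi> t (c t)" "\<phi> s (c s)"]
        by (simp add: constant_kernel_G[OF c] \<phi>inv_dist mem)
    qed
    then show "\<exists>N. openin (base U) N \<and> t \<in> N \<and> N \<subseteq> G \<and>
      (\<forall>s\<in>N. vdist (fibre U s) (constant_kernel c (s, t)) (constant_kernel c (s, s)) \<le> e \<and>
        vdist (fibre U t) (constant_kernel c (t, s)) (constant_kernel c (t, t)) \<le> e)"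
      using N(1-3) by blast
  qed
  ultimately show ?thesis using c by (simp add: kernels_def diagonal_constant_kernel)
qed

lemma constant_kernel_morphism: "banach_morphism B kernel_space constant_kernel"
  unfolding banach_morphism_def linear_map_def kernel_carrier
proof (intro conjI ballI allI exI)
  note simps = algebra.apply_simps kernel.apply_simps kernel_carrier constant_kernel_mem
    algebra.add_mem algebra.scale_mem kernel.add_mem[unfolded kernel_carrier] kernel.scale_mem[unfolded kernel_carrier]
  fix a assume a: "a \<in> vcarrier B"
  show "constant_kernel (vadd B a b) = vadd kernel_space (constant_kernel a) (constant_kernel b)"
    if b: "b \<in> vcarrier B" for b
  proof (rule kernel.mem_eqI)
    fix p assume "p \<in> pairs"
    moreover obtain s t where "p = (s, t)" by (cases p)
    ultimately have p: "p = (s, t)" "(s, t) \<in> pairs" by simp_all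
    from p(2) show "constant_kernel (vadd B a b) p =
        vadd kernel_space (constant_kernel a) (constant_kernel b) p"
    proof (cases rule: pairs_cases)
      case 1
      then show ?thesis
        using p by (simp add: simps constant_kernel_diag) (simp add: pair_fibre_def)
    next
      case 2
      then show ?thesis
        using p a b algebra.mem[OF a G_subset[OF 2(2)]] algebra.mem[OF b G_subset[OF 2(2)]]
        by (simp add: simps constant_kernel_G G_subset \<phi>_hom \<phi>inv_add \<phi>_mem) (simp add: pair_fibre_def)
    qed
  qed (use a b in \<open>simp_all add: simps\<close>)
  show "constant_kernel (vscale B c a) = vscale kernel_space c (constant_kernel a)" for c
  proof (rule kernel.mem_eqI)
    fix p assume "p \<in> pairs"
    moreover obtain s t where "p = (s, t)" by (cases p)
    ultimately have p: "p = (s, t)" "(s, t) \<in> pairs" by simp_all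
    from p(2) show "constant_kernel (vscale B c a) p = vscale kernel_space c (constant_kernel a) p"
    proof (cases rule: pairs_cases)
      case 1
      then show ?thesis
        using p by (simp add: simps constant_kernel_diag) (simp add: pair_fibre_def)
    next
      case 2
      then show ?thesis
        using p a algebra.mem[OF a G_subset[OF 2(2)]]
        by (simp add: simps constant_kernel_G G_subset \<phi>_scale \<phi>inv_scale \<phi>_mem) (simp add: pair_fibre_def)
    qed
  qed (use a in \<open>simp_all add: simps\<close>)
  have "vnorm (pair_fibre p) (constant_kernel a p) \<le> vnorm B a" if "p \<in> pairs" for p
    using that algebra.norm_le[OF a]
    by (cases p) (auto simp: pair_fibre_def pairs_iff constant_kernel_fibre[OF a])
  then show "vnorm kernel_space (constant_kernel a) \<le> 1 * vnorm B a"
    using algebra.norm_nonneg[OF a] constant_kernel_mem[OF a]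
    by (subst kernel.norm_le_iff) (simp_all add: kernel_carrier)
qed (rule constant_kernel_mem)

lemma exists_kernel_section:
  assumes "left_projective B"
  shows "\<exists>\<rho>. left_module_morphism B B (amult B) kernel_space kernel_act \<rho> \<and>
    (\<forall>b\<in>vcarrier B. diagonal (\<rho> b) = b)"
  using left_projective_section[OF banach_algebra_field_algebra assms kernel_module diagonal_morphism
      constant_kernel_morphism] diagonal_constant_kernel by blast

end

section \<open>The relation defined by a module section\<close>

context trivialized_field
begin

text \<open>
  Both \<open>(g y) \<cdot> \<rho>(f x)\<close> and \<open>(f y) \<cdot> \<rho>(g x)\<close> are equal to \<open>\<rho>(f g y x)\<close>. At \<open>s\<close>, where \<open>f\<close> and \<open>g\<close>
  are 1, the factors \<open>g y\<close> and \<open>f y\<close> coincide.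
\<close>

lemma module_section_multiplier_unique:
  assumes \<rho>: "left_module_morphism B B (amult B) kernel_space kernel_act \<rho>"
    and x: "x \<in> vcarrier A" and y: "y \<in> vcarrier A"
    and f: "bump f" "f s = 1" and g: "bump g" "g s = 1" and s: "s \<in> G" and t: "t \<in> G"
  shows "amult (fibre U s) (\<phi>inv s y) (\<rho> (bump_section f x) (s, t)) =
    amult (fibre U s) (\<phi>inv s y) (\<rho> (bump_section g x) (s, t))"
proof -
  interpret F: banach_algebra "fibre U s" by (rule fibre_algebra[OF G_subset[OF s]])
  have swap: "kernel_act (bump_section g y) (\<rho> (bump_section f x)) =
      \<rho> (bump_section (\<lambda>t. g t * f t) (amult A y x))" if "bump f" "bump g" for f g
  proof -
    have "\<rho> (amult B (bump_section g y) (bump_section f x)) = kernel_act (bump_section g y) (\<rho> (bump_section f x))"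
      using \<rho> bump_section_mem[OF that(1) x] bump_section_mem[OF that(2) y]
      by (simp add: left_module_morphism_def)
    then show ?thesis unfolding bump_section_mult[OF x y] ..
  qed
  have "kernel_act (bump_section g y) (\<rho> (bump_section f x)) (s, t) =
      kernel_act (bump_section f y) (\<rho> (bump_section g x)) (s, t)"
    using swap[OF f(1) g(1)] swap[OF g(1) f(1)] by (simp add: mult.commute)
  then show ?thesis
    using s t f(2) g(2) y
    by (simp add: kernel_act_apply pairs_G pair_fibre_def bump_section_apply F.scale_one \<phi>inv_mem)
qed

text \<open>
  The relation is \<open>\<parallel>\<Phi>(s, t)\<parallel> \<ge> \<parallel>y x\<parallel> / 2\<close> for \<open>\<Phi>(s, t) = y \<cdot> \<rho>(g x)(s, t)\<close>. Over a compact set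
  \<open>K\<close> one bump function \<open>g\<close> computes all \<open>\<Phi>(s, t)\<close> with \<open>s \<in> K\<close>, so the uniform decay of the
  kernel \<open>\<rho>(g x)\<close> bounds the image of \<open>K\<close>; near \<open>t\<close>, its continuity at the diagonal keeps \<open>\<Phi>\<close>
  close to the diagonal values of norm \<open>\<parallel>y x\<parallel>\<close>.
\<close>

theorem exists_proper_neighbourhood_relation:
  assumes proj: "left_projective B"
    and nonzero: "\<And>t. t \<in> G \<Longrightarrow> vcarrier (fibre U t) \<noteq> {vzero (fibre U t)}"
  shows "\<exists>R \<subseteq> G \<times> G.
    (\<forall>K. compactin (base U) K \<longrightarrow> K \<subseteq> G \<longrightarrow> (\<exists>K'. compactin (base U) K' \<and> R `` K \<subseteq> K')) \<and>
    (\<forall>t\<in>G. \<exists>N. openin (base U) N \<and> t \<in> N \<and> N \<subseteq> G \<and> (\<forall>s\<in>N. (s, t) \<in> R \<and> (t, s) \<in> R))"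
proof (cases "G = {}")
  case True
  then show ?thesis by (intro exI[of _ "{}"]) auto
next
  case False
  then obtain s0 where s0: "s0 \<in> G" by blast
  interpret S: banach_space "fibre U s0" by (rule fibre_banach[OF G_subset[OF s0]])
  obtain a where a: "a \<in> vcarrier (fibre U s0)" "a \<noteq> vzero (fibre U s0)"
    using nonzero[OF s0] S.zero_closed by blast
  have "vnorm A (\<phi> s0 a) \<noteq> 0" using \<phi>_norm[OF s0 a(1)] S.norm_eq_zero[OF a(1)] a(2) by simp
  then have "\<phi> s0 a \<noteq> vzero A" using model.norm_zero by metis
  then obtain x y where x: "x \<in> vcarrier A" and y: "y \<in> vcarrier A" and xy: "amult A y x \<noteq> vzero A"
    using exists_nonzero_product[OF proj s0 \<phi>_mem[OF s0 a(1)]] by blast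
  define \<eta> where "\<eta> = vnorm A (amult A y x) / 2"
  have \<eta>: "\<eta> > 0"
    using xy model.norm_nonneg[OF model.mult_closed[OF y x]] model.norm_eq_zero[OF model.mult_closed[OF y x]]
    by (simp add: \<eta>_def)
  define c where "c = vnorm A y + 1"
  have c: "0 < c" "vnorm A y \<le> c" using model.norm_nonneg[OF y] by (simp_all add: c_def)
  obtain \<rho> where \<rho>: "left_module_morphism B B (amult B) kernel_space kernel_act \<rho>"
    and diag: "\<And>b. b \<in> vcarrier B \<Longrightarrow> diagonal (\<rho> b) = b"
    using exists_kernel_section[OF proj] by blast
  have \<rho>_mem: "\<rho> b \<in> kernels" if "b \<in> vcarrier B" for b
    using \<rho> that by (simp add: left_module_morphism_def banach_morphism_def linear_map_def kernel_carrier)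
  have \<rho>_fibre: "\<rho> b (s, t) \<in> vcarrier (fibre U s)" if "b \<in> vcarrier B" "s \<in> G" "t \<in> G" for b s t
    using kernel_fibre[OF kernelsD(1)[OF \<rho>_mem[OF that(1)]] pairs_G[OF that(2,3)]] .
  have \<rho>_diag: "\<rho> b (t, t) = b t" if "b \<in> vcarrier B" "t \<in> G" for b t
    using fun_cong[OF diag[OF that(1)], of t] G_subset[OF that(2)] by (simp add: diagonal_def)
  have "\<exists>g. bump g \<and> g s = 1" if "s \<in> G" for s
    using exists_bump[of "{s}"] that G_subset[OF that]
    by (metis compactin_sing empty_subsetI insert_subset singletonI)
  then obtain \<gamma> where \<gamma>: "\<And>s. s \<in> G \<Longrightarrow> bump (\<gamma> s)" "\<And>s. s \<in> G \<Longrightarrow> \<gamma> s s = 1" by metis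
  define \<Phi> where "\<Phi> s t = amult (fibre U s) (\<phi>inv s y) (\<rho> (bump_section (\<gamma> s) x) (s, t))" for s t
  have \<Phi>: "\<Phi> s t = amult (fibre U s) (\<phi>inv s y) (\<rho> (bump_section g x) (s, t))"
    if "bump g" "g s = 1" "s \<in> G" "t \<in> G" for g s t
    unfolding \<Phi>_def by (rule module_section_multiplier_unique[OF \<rho> x y \<gamma>(1,2)[OF that(3)] that(1,2) that(3,4)])
  define R where "R = {(s, t). s \<in> G \<and> t \<in> G \<and> \<eta> \<le> vnorm (fibre U s) (\<Phi> s t)}"
  have "\<exists>K'. compactin (base U) K' \<and> R `` K \<subseteq> K'" if K: "compactin (base U) K" "K \<subseteq> G" for K
  proof -
    obtain g where g: "bump g" "\<And>t. t \<in> K \<Longrightarrow> g t = 1" using exists_bump[OF K] by blast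
    define w where "w = \<rho> (bump_section g x)"
    have b: "bump_section g x \<in> vcarrier B" using g(1) x by (rule bump_section_mem)
    define e where "e = \<eta> / 2 / c"
    have e: "e > 0" using \<eta> c by (simp add: e_def)
    obtain K' where K': "compactin (base U) K'"
      "\<And>s t. (s, t) \<in> pairs \<Longrightarrow> t \<notin> K' \<Longrightarrow> vnorm (fibre U s) (w (s, t)) \<le> e"
      using kernelsD(5)[OF \<rho>_mem[OF b]] e unfolding vanishes_right_def w_def by meson
    have "t \<in> K'" if s: "s \<in> K" and st: "(s, t) \<in> R" for s t
    proof (rule ccontr)
      assume t: "t \<notin> K'"
      have G: "s \<in> G" "t \<in> G" and big: "\<eta> \<le> vnorm (fibre U s) (\<Phi> s t)" using st by (auto simp: R_def)
      interpret F: banach_algebra "fibre U s" by (rule fibre_algebra[OF G_subset[OF G(1)]])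
      have w_mem: "w (s, t) \<in> vcarrier (fibre U s)" unfolding w_def by (rule \<rho>_fibre[OF b G])
      have "vnorm (fibre U s) (\<Phi> s t) \<le> vnorm A y * vnorm (fibre U s) (w (s, t))"
        using F.norm_mult[OF \<phi>inv_mem[OF G(1) y] w_mem] \<Phi>[OF g(1) g(2)[OF s] G] G(1) y
        by (simp add: w_def \<phi>inv_norm)
      also have "\<dots> \<le> c * e"
        using K'(2)[OF pairs_G[OF G] t] c F.norm_nonneg[OF w_mem] by (intro mult_mono) auto
      also have "\<dots> = \<eta> / 2" using c by (simp add: e_def)
      finally show False using big \<eta> by simp
    qed
    then show ?thesis using K'(1) by blast
  qed
  moreover have "\<exists>N. openin (base U) N \<and> t \<in> N \<and> N \<subseteq> G \<and> (\<forall>s\<in>N. (s, t) \<in> R \<and> (t, s) \<in> R)"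
    if t: "t \<in> G" for t
  proof -
    have "locally_compact_space (subtopology (base U) G)"
      using locally_compact_space_open_subset[OF _ locally_compact open_G] Hausdorff by blast
    moreover have "t \<in> topspace (subtopology (base U) G)" using t G_subset by simp
    ultimately obtain O' C where OC: "openin (subtopology (base U) G) O'"
      "compactin (subtopology (base U) G) C" "t \<in> O'" "O' \<subseteq> C"
      unfolding locally_compact_space_def by blast
    have O': "openin (base U) O'" "O' \<subseteq> G" using OC(1) open_G openin_open_subtopology by blast+
    have C: "compactin (base U) C" "C \<subseteq> G" using OC(2) by (auto simp: compactin_subtopology)
    obtain g where g: "bump g" "\<And>t. t \<in> C \<Longrightarrow> g t = 1" using exists_bump[OF C] by blast
    define w where "w = \<rho> (bump_section g x)"
    have b: "bump_section g x \<in> vcarrier B" using g(1) x by (rule bump_section_mem)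
    define e where "e = \<eta> / c"
    have e: "e > 0" using \<eta> c by (simp add: e_def)
    obtain N where N: "openin (base U) N" "t \<in> N" "N \<subseteq> G"
      "\<And>s. s \<in> N \<Longrightarrow> vdist (fibre U s) (w (s, t)) (w (s, s)) \<le> e"
      "\<And>s. s \<in> N \<Longrightarrow> vdist (fibre U t) (w (t, s)) (w (t, t)) \<le> e"
      using near_diagonalD[OF kernelsD(4)[OF \<rho>_mem[OF b]] t e] unfolding w_def by metis
    have R: "(r, s) \<in> R" if r: "r \<in> C" and s: "s \<in> G" and d: "vdist (fibre U r) (w (r, s)) (w (r, r)) \<le> e" for r s
    proof -
      have G: "r \<in> G" using r C(2) by blast
      interpret F: banach_algebra "fibre U r" by (rule fibre_algebra[OF G_subset[OF G]])
      let ?y = "\<phi>inv r y"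
      have y': "?y \<in> vcarrier (fibre U r)" using G y by (rule \<phi>inv_mem)
      have w_mem: "w (r, s) \<in> vcarrier (fibre U r)" "w (r, r) \<in> vcarrier (fibre U r)"
        unfolding w_def using \<rho>_fibre[OF b G] G s by auto
      have "w (r, r) = \<phi>inv r x"
        unfolding w_def using \<rho>_diag[OF b G] g(2)[OF r] G x by (simp add: bump_section_apply F.scale_one \<phi>inv_mem)
      then have "vnorm (fibre U r) (amult (fibre U r) ?y (w (r, r))) = 2 * \<eta>"
        using G x y by (simp add: \<eta>_def \<phi>inv_norm model.mult_closed flip: \<phi>inv_mult)
      moreover have "vdist (fibre U r) (amult (fibre U r) ?y (w (r, s))) (amult (fibre U r) ?y (w (r, r))) \<le> \<eta>"
      proof -
        have "vdist (fibre U r) (amult (fibre U r) ?y (w (r, s))) (amult (fibre U r) ?y (w (r, r))) \<le>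
            vnorm A y * vdist (fibre U r) (w (r, s)) (w (r, r))"
          using F.norm_mult_diff[OF y' w_mem] G y by (simp add: \<phi>inv_norm)
        also have "\<dots> \<le> c * e"
          using d c F.metric.nonneg by (intro mult_mono) auto
        also have "\<dots> = \<eta>" using c by (simp add: e_def)
        finally show ?thesis .
      qed
      ultimately have "\<eta> \<le> vnorm (fibre U r) (amult (fibre U r) ?y (w (r, s)))"
        using F.norm_diff_le[OF F.mult_closed[OF y' w_mem(1)] F.mult_closed[OF y' w_mem(2)]] by linarith
      then show ?thesis
        using \<Phi>[OF g(1) g(2)[OF r] G s] G s by (simp add: R_def w_def)
    qed
    have "(s, t) \<in> R \<and> (t, s) \<in> R" if s: "s \<in> N \<inter> O'" for s
      using R[of s t] R[of t s] N(4)[of s] N(5)[of s] s t OC(3,4) N(3) by blast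
    then show ?thesis
      using N(1-3) O' OC(3) by (intro exI[of _ "N \<inter> O'"]) (auto intro: openin_Int)
  qed
  moreover have "R \<subseteq> G \<times> G" by (auto simp: R_def)
  ultimately show ?thesis by blast
qed

end

section \<open>Opposite fields\<close>

lemma opposite_simps [simp]:
  "vcarrier (opposite A) = vcarrier A" "vadd (opposite A) = vadd A" "vzero (opposite A) = vzero A"
  "vscale (opposite A) = vscale A" "vnorm (opposite A) = vnorm A" "amult (opposite A) x y = amult A y x"
  by (simp_all add: opposite_def)

lemma vdist_opposite [simp]: "vdist (opposite A) = vdist A"
  by (intro ext) (simp add: vdist_def)

lemma banach_algebra_opposite:
  assumes "banach_algebra A"
  shows "banach_algebra (opposite A)"
proof -
  interpret banach_algebra A by fact
  show ?thesis
  proof (intro banach_algebra.intro banach_algebra_axioms.intro)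
    show "banach_space (opposite A)"
      using banach_space_axioms unfolding banach_space_def opposite_simps vdist_opposite .
    show "vnorm (opposite A) (amult (opposite A) x y) \<le> vnorm (opposite A) x * vnorm (opposite A) y"
      if "x \<in> vcarrier (opposite A)" "y \<in> vcarrier (opposite A)" for x y
      using that norm_mult[of y x] by (simp add: mult.commute)
  qed (simp_all add: mult_closed mult_assoc mult_add_left mult_add_right mult_scale_left mult_scale_right)
qed

text \<open>
  In \<open>projective_right_module_opposite\<close> only the acting algebra is replaced by its opposite. Here
  the module is replaced too, which changes nothing, as module morphisms do not see its
  multiplication.
\<close>

lemma left_projective_opposite:
  fixes A :: "('b, 'u) nalgebra_scheme"
  assumes "right_projective A"
  shows "left_projective (opposite A)"
proof -
  have "left_module_morphism R X actX (opposite A) actY f \<longleftrightarrow> left_module_morphism R X actX A actY f"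
    "left_module_morphism R (opposite A) actX' X actX g \<longleftrightarrow> left_module_morphism R A actX' X actX g"
    "banach_morphism (opposite A) X g \<longleftrightarrow> banach_morphism A X g"
    for R :: "('b, 'u) nalgebra_scheme" and X :: "'b module_code nspace" and actX actY actX' f g
    by (simp_all add: left_module_morphism_def banach_morphism_def linear_map_def)
  then have "projective_left_module_wrt T (opposite A) (opposite A) act \<longleftrightarrow>
      projective_left_module_wrt T (opposite A) A act" for T :: "'b module_code itself" and act
    unfolding projective_left_module_wrt_def by simp
  moreover have "amult (opposite A) = (\<lambda>x y. amult A y x)" by (intro ext) simp
  ultimately show ?thesis
    using assms by (simp add: left_projective_def right_projective_def projective_right_module_opposite)
qed

definition opposite_field :: "('t, 'a) alg_field \<Rightarrow> ('t, 'a) alg_field" where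
  "opposite_field U = U\<lparr>fibre := (\<lambda>t. opposite (fibre U t))\<rparr>"

lemma opposite_field_simps [simp]:
  "base (opposite_field U) = base U" "fibre (opposite_field U) t = opposite (fibre U t)"
  "sections (opposite_field U) = sections U"
  by (simp_all add: opposite_field_def)

lemma sec_opposite_field [simp]:
  "sec_add (opposite_field U) = sec_add U" "sec_zero (opposite_field U) = sec_zero U"
  "sec_scale (opposite_field U) = sec_scale U" "sec_mult (opposite_field U) x y = sec_mult U y x"
  by (simp_all add: fun_eq_iff sec_add_def sec_zero_def sec_scale_def sec_mult_def)

lemma field_algebra_opposite_field: "field_algebra (opposite_field U) = opposite (field_algebra U)"
  by (simp add: field_algebra_def opposite_def fun_eq_iff)

lemma continuous_field_opposite:
  assumes "continuous_field U"
  shows "continuous_field (opposite_field U)"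
proof -
  interpret continuous_field U by fact
  show ?thesis
  proof (rule continuous_field.intro)
    show "x \<in> sections (opposite_field U)"
      if "x \<in> fibre_prod (topspace (base (opposite_field U))) (fibre (opposite_field U))"
        "locally_approximable (base (opposite_field U)) (fibre (opposite_field U)) (sections (opposite_field U)) x" for x
      using that sections_closed by (simp add: locally_approximable_def)
  qed (simp_all add: Hausdorff locally_compact fibre_algebra banach_algebra_opposite sections_subset
      zero_section add_section scale_section mult_section sections_dense norm_continuous)
qed

lemma trivialized_field_opposite:
  assumes "trivialized_field U G A \<phi>"
  shows "trivialized_field (opposite_field U) G (opposite A) \<phi>"
proof -
  interpret trivialized_field U G A \<phi> by fact
  show ?thesis
  proof (intro trivialized_field.intro continuous_field_opposite continuous_field_axioms
      trivialized_field_axioms.intro)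
    show "isometric_algebra_iso (fibre (opposite_field U) t) (opposite A) (\<phi> t)" if "t \<in> G" for t
      using iso[OF that] by (simp add: isometric_algebra_iso_def linear_map_def)
  qed (simp_all add: open_G banach_algebra_opposite model trivialization_continuous)
qed

section \<open>Disjoint unions of locally trivial fields\<close>

text \<open>
  In the right projective case the relation is taken from the opposite field, which has the same
  base and the same trivializations.
\<close>

lemma trivialized_field_proper_neighbourhood_relation_on:
  assumes "trivialized_field U G A \<phi>"
    and nonzero: "\<And>t. t \<in> topspace (base U) \<Longrightarrow> vcarrier (fibre U t) \<noteq> {vzero (fibre U t)}"
    and proj: "left_projective (field_algebra U) \<or> right_projective (field_algebra U)"
    and H: "openin (base U) H" "base U closure_of H \<subseteq> G"
  shows "\<exists>R. proper_neighbourhood_relation_on (base U) H R"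
proof -
  interpret trivialized_field U G A \<phi> by fact
  have "\<exists>R \<subseteq> G \<times> G.
    (\<forall>K. compactin (base U) K \<longrightarrow> K \<subseteq> G \<longrightarrow> (\<exists>K'. compactin (base U) K' \<and> R `` K \<subseteq> K')) \<and>
    (\<forall>t\<in>G. \<exists>N. openin (base U) N \<and> t \<in> N \<and> N \<subseteq> G \<and> (\<forall>s\<in>N. (s, t) \<in> R \<and> (t, s) \<in> R))"
    using proj
  proof
    assume "left_projective (field_algebra U)"
    then show ?thesis by (rule exists_proper_neighbourhood_relation) (rule nonzero[OF G_subset])
  next
    assume "right_projective (field_algebra U)"
    then have "left_projective (field_algebra (opposite_field U))"
      unfolding field_algebra_opposite_field by (rule left_projective_opposite)
    from trivialized_field.exists_proper_neighbourhood_relation[OF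
        trivialized_field_opposite[OF trivialized_field_axioms] this]
    show ?thesis using nonzero[OF G_subset] by simp
  qed
  then obtain R where R: "\<And>K. compactin (base U) K \<Longrightarrow> K \<subseteq> G \<Longrightarrow> \<exists>K'. compactin (base U) K' \<and> R `` K \<subseteq> K'"
    "\<And>t. t \<in> G \<Longrightarrow> \<exists>N. openin (base U) N \<and> t \<in> N \<and> N \<subseteq> G \<and> (\<forall>s\<in>N. (s, t) \<in> R \<and> (t, s) \<in> R)"
    by metis
  have "proper_neighbourhood_relation_on (base U) H (R \<inter> H \<times> H)"
    using H R(1) by (rule proper_neighbourhood_relation_on_restrict) (use R(2) in blast)+
  then show ?thesis ..
qed

lemma (in continuous_field) restrict_section:
  assumes Y: "Y \<subseteq> topspace (base U)" and x: "x \<in> sections U"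
  shows "restrict x Y \<in> sections (induced_field U Y)"
proof -
  have top: "topspace (subtopology (base U) Y) = Y" using Y by (simp add: inf_absorb2)
  have "locally_approximable (subtopology (base U) Y) (fibre U) (sections U) (restrict x Y)"
    unfolding locally_approximable_def top
  proof (intro ballI allI impI)
    fix t and e :: real assume t: "t \<in> Y" and e: "e > 0"
    have "vdist (fibre U s) (restrict x Y s) (x s) \<le> e" if "s \<in> Y" for s
    proof -
      interpret F: banach_space "fibre U s" using fibre_banach Y that by blast
      have "x s \<in> vcarrier (fibre U s)" using section_mem[OF x] Y that by blast
      then show ?thesis using that e by simp
    qed
    moreover have "openin (subtopology (base U) Y) Y" using openin_topspace[of "subtopology (base U) Y"] top by simp
    ultimately show "\<exists>x'\<in>sections U. \<exists>N. openin (subtopology (base U) Y) N \<and> t \<in> N \<and>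
        (\<forall>s\<in>N. vdist (fibre U s) (restrict x Y s) (x' s) \<le> e)"
      using x t by blast
  qed
  moreover have "restrict x Y \<in> fibre_prod Y (fibre U)" using section_mem[OF x] Y by auto
  ultimately show ?thesis unfolding induced_field_def top by simp
qed

text \<open>
  Sections of the whole field restrict to sections of the twice induced field, so a
  trivialization of the latter sends them to continuous maps.
\<close>

lemma trivialized_field_of_trivial_field:
  fixes U :: "('t, 'a) alg_field"
  assumes U: "continuous_field U" and W: "openin (base U) W" and G: "openin (base U) G" "G \<subseteq> W"
    and triv: "trivial_field (induced_field (induced_field U W) G)"
  shows "\<exists>(A :: 'a nalgebra) \<phi>. trivialized_field U G A \<phi>"
proof -
  interpret continuous_field U by (rule U)
  let ?V = "induced_field (induced_field U W) G"
  have WX: "W \<subseteq> topspace (base U)" using W by (rule openin_subset)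
  have base: "base ?V = subtopology (base U) G"
    using G(2) by (simp add: induced_field_def subtopology_subtopology inf_absorb2)
  have top: "topspace (base ?V) = G" unfolding base using G(2) WX by (simp add: inf_absorb2 subset_trans)
  have fib: "fibre ?V t = fibre U t" for t by (simp add: induced_field_def)
  obtain A :: "'a nalgebra" and \<phi> where A: "banach_algebra A"
    and iso: "\<forall>t\<in>G. isometric_algebra_iso (fibre U t) A (\<phi> t)"
    and cont: "\<forall>x\<in>sections ?V. (\<lambda>t\<in>G. \<phi> t (x t)) \<in> sections (constant_field (base ?V) A)"
    using triv unfolding trivial_field_def isomorphic_fields_def top fib
    by (auto simp: constant_field_def)
  have "trivialized_field U G A \<phi>"
  proof (intro trivialized_field.intro U trivialized_field_axioms.intro)
    show "isometric_algebra_iso (fibre U t) A (\<phi> t)" if "t \<in> G" for t using iso that by blast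
    fix x assume x: "x \<in> sections U"
    have xW: "restrict x W \<in> sections (induced_field U W)" using WX x by (rule restrict_section)
    have topG: "topspace (subtopology (subtopology (base U) W) G) = G"
      using top by (simp add: induced_field_def)
    have "locally_approximable (subtopology (subtopology (base U) W) G) (fibre U)
        (sections (induced_field U W)) (restrict x G)"
      unfolding locally_approximable_def topG
    proof (intro ballI allI impI)
      fix t and e :: real assume t: "t \<in> G" and e: "e > 0"
      have "vdist (fibre U s) (restrict x G s) (restrict x W s) \<le> e" if "s \<in> G" for s
      proof -
        have sX: "s \<in> topspace (base U)" using that G(2) WX by blast
        interpret F: banach_space "fibre U s" by (rule fibre_banach[OF sX])
        have "x s \<in> vcarrier (fibre U s)" using x sX by (rule section_mem)
        then show ?thesis using that e G(2) by (auto simp: subset_iff)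
      qed
      moreover have "openin (subtopology (subtopology (base U) W) G) G"
        using openin_topspace[of "subtopology (subtopology (base U) W) G"] topG by simp
      ultimately show "\<exists>x'\<in>sections (induced_field U W).
          \<exists>N. openin (subtopology (subtopology (base U) W) G) N \<and> t \<in> N \<and>
            (\<forall>s\<in>N. vdist (fibre U s) (restrict x G s) (x' s) \<le> e)"
        using xW t by blast
    qed
    moreover have "restrict x G \<in> fibre_prod G (fibre U)" using section_mem[OF x] G(2) WX by auto
    ultimately have "restrict x G \<in> sections ?V"
      using topG by (simp add: induced_field_def)
    then have "(\<lambda>t\<in>G. \<phi> t (restrict x G t)) \<in> sections (constant_field (base ?V) A)" using cont by blast
    then have "continuous_map (subtopology (base U) G) (vtopology A) (\<lambda>t\<in>G. \<phi> t (restrict x G t))"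
      unfolding base by (simp add: constant_field_def)
    moreover have "(\<lambda>t\<in>G. \<phi> t (restrict x G t)) t = \<phi> t (x t)"
      if "t \<in> topspace (subtopology (base U) G)" for t
      using that by simp
    ultimately show "continuous_map (subtopology (base U) G) (vtopology A) (\<lambda>t. \<phi> t (x t))"
      by (rule continuous_map_eq)
  qed (fact A G)+
  then show ?thesis by blast
qed

theorem theorem4p7:
  fixes U :: "('t, 'a) alg_field" and W :: "'m \<Rightarrow> 't set" and M :: "'m set"
  assumes field: "continuous_field U"
    and nonzero: "\<And>t. t \<in> topspace (base U) \<Longrightarrow> vcarrier (fibre U t) \<noteq> {vzero (fibre U t)}"
    and open_W: "\<And>\<mu>. \<mu> \<in> M \<Longrightarrow> openin (base U) (W \<mu>)"
    and disjoint_W: "disjoint_family_on W M"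
    and cover_W: "(\<Union>\<mu>\<in>M. W \<mu>) = topspace (base U)"
    and triv: "\<And>\<mu>. \<mu> \<in> M \<Longrightarrow> sigma_locally_trivial (induced_field U (W \<mu>))"
    and proj: "left_projective (field_algebra U) \<or> right_projective (field_algebra U)"
  shows "paracompact_space (base U)"
proof (rule paracompact_space_if_countable_local_relations[OF _ _ open_W disjoint_W cover_W])
  show "Hausdorff_space (base U)" "locally_compact_space (base U)"
    using field by (simp_all add: continuous_field_def)
  fix \<mu> assume \<mu>: "\<mu> \<in> M"
  let ?X = "base U" and ?W = "W \<mu>"
  have base: "base (induced_field U ?W) = subtopology ?X ?W" by (simp add: induced_field_def)
  have W: "openin ?X ?W" using \<mu> by (rule open_W)
  have top: "topspace (subtopology ?X ?W) = ?W" using openin_subset[OF W] by (simp add: inf_absorb2)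
  have "closedin ?X ?W"
  proof -
    have "topspace ?X - ?W = (\<Union>\<nu>\<in>M - {\<mu>}. W \<nu>)"
      using disjoint_W \<mu> by (auto simp: cover_W[symmetric] disjoint_family_on_def)
    moreover have "openin ?X (\<Union>\<nu>\<in>M - {\<mu>}. W \<nu>)" using open_W by (intro openin_Union) auto
    ultimately show ?thesis using openin_subset[OF W] by (simp add: closedin_def)
  qed
  obtain \<G> \<V> where \<G>: "\<And>G. G \<in> \<G> \<Longrightarrow> openin (subtopology ?X ?W) G"
      "\<And>G. G \<in> \<G> \<Longrightarrow> trivial_field (induced_field (induced_field U ?W) G)"
    and \<V>: "countable \<V>" "\<And>H. H \<in> \<V> \<Longrightarrow> openin (subtopology ?X ?W) H" "\<Union>\<V> = ?W"
      "\<And>H. H \<in> \<V> \<Longrightarrow> \<exists>G\<in>\<G>. subtopology ?X ?W closure_of H \<subseteq> G"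
    using triv[OF \<mu>] unfolding sigma_locally_trivial_def base top by metis
  have "\<exists>R. proper_neighbourhood_relation_on ?X H R" if H: "H \<in> \<V>" for H
  proof -
    obtain G where G: "G \<in> \<G>" "subtopology ?X ?W closure_of H \<subseteq> G" using \<V>(4)[OF H] by blast
    have Gopen: "openin ?X G" "G \<subseteq> ?W" using \<G>(1)[OF G(1)] W openin_open_subtopology by blast+
    have Hopen: "openin ?X H" "H \<subseteq> ?W" using \<V>(2)[OF H] W openin_open_subtopology by blast+
    \<comment> \<open>The closure of \<open>H\<close> is taken in \<open>W \<mu>\<close>; as \<open>W \<mu>\<close> is closed, it is the closure in the whole space.\<close>
    have "?X closure_of H \<subseteq> ?W" using Hopen(2) \<open>closedin ?X ?W\<close> by (rule closure_of_minimal)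
    then have "?X closure_of H \<subseteq> G"
      using G(2) Hopen(2) by (simp add: closure_of_subtopology inf_absorb2)
    moreover obtain A :: "'a nalgebra" and \<phi> where "trivialized_field U G A \<phi>"
      using trivialized_field_of_trivial_field[OF field W Gopen \<G>(2)[OF G(1)]] by blast
    ultimately show ?thesis
      using trivialized_field_proper_neighbourhood_relation_on nonzero proj Hopen(1) by blast
  qed
  then show "\<exists>\<V>. countable \<V> \<and> \<Union>\<V> = ?W \<and> (\<forall>H\<in>\<V>. \<exists>R. proper_neighbourhood_relation_on ?X H R)"
    using \<V>(1,3) by blast
qed

end
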